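(* Let $c\ge1$ and let $\mathcal N_c$ be the variety of nilpotent groups of class at most $c$. Let $A$ and $B$ be groups, let $A\cong F_1/R_1$ be a free presentation of $A$, let $K=F_1*B$, and let $D_c$, $E_c$ be the subgroups of $K$ defined in the context. Let $A\,\mathrm{Wr}_*\,B$ be the free wreath product of $A$ by $B$. Then there exists an epimorphism $$\mathcal N_cM(A\,\mathrm{Wr}_*\,B)\longrightarrow\mathcal N_cM(A)\oplus\mathcal N_cM(B)\oplus\frac{E_c}{D_c}.$$ Moreover, if $\mathcal N_cM(A\,\mathrm{Wr}_*\,B)$ is finite, then $\mathcal N_cM(A)\oplus\mathcal N_cM(B)\oplus E_c/D_c$ is isomorphic to a subgroup of $\mathcal N_cM(A\,\mathrm{Wr}_*\,B)$.
   Context: Conventions: $[x,y]=x^{-1}y^{-1}xy$; commutators of several entries are left-normed; $[X,\,_cY]=[X,Y,\dots,Y]$ with $c$ copies of $Y$; $\gamma_{c+1}(X)$ is the $(c+1)$-st term of the lower central series; $X^Y$ is the normal closure of $X$ in $Y$. For a group $G\cong F/R$ with $F$ free, $\mathcal N_cM(G)=(R\cap\gamma_{c+1}(F))/[R,\,_cF]$ (the Baer invariant with respect to $\mathcal N_c$), independent, up to isomorphism, of the free presentation. Free wreath product: for $b\in B$ let $A_b$ be a copy of $A$, with $a_b\in A_b$ corresponding to $a\in A$, and let $C=\prod^*_{b\in B}A_b$ be their free product. For $b'\in B$ the map $a_b\mapsto a_{bb'}$ induces an automorphism of $C$; $A\,\mathrm{Wr}_*\,B$ is the corresponding semidirect product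 of the normal subgroup $C$ by $B$, i.e. $b'^{-1}a_bb'=a_{bb'}$. In $K=F_1*B$, $$D_c=\prod_{\substack{G_1,\dots,G_c\in\{F_1,B\}\\ \exists j:\ G_j=B}}[R_1,G_1,\dots,G_c]^K,\qquad E_c=[R_1,K]^K\cap\gamma_{c+1}(K)\cap[F_1,B].$$ *)

theory Defs
  imports "HOL-Algebra.Elementary_Groups"
begin

inductive_set word_cong :: "'x set \<Rightarrow> ('x list \<times> 'x list) set \<Rightarrow> ('x list \<times> 'x list) set"
  for L :: "'x set" and S :: "('x list \<times> 'x list) set" where
  refl: "w \<in> lists L \<Longrightarrow> (w, w) \<in> word_cong L S"
| sym: "(u, v) \<in> word_cong L S \<Longrightarrow> (v, u) \<in> word_cong L S"
| trans: "(u, v) \<in> word_cong L S \<Longrightarrow> (v, w) \<in> word_cong L S \<Longrightarrow> (u, w) \<in> word_cong L S"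
| rel: "(u, v) \<in> S \<Longrightarrow> u \<in> lists L \<Longrightarrow> v \<in> lists L \<Longrightarrow> p \<in> lists L \<Longrightarrow> q \<in> lists L
    \<Longrightarrow> (p @ u @ q, p @ v @ q) \<in> word_cong L S"

definition word_class :: "'x set \<Rightarrow> ('x list \<times> 'x list) set \<Rightarrow> 'x list \<Rightarrow> 'x list set" where
  "word_class L S w = word_cong L S `` {w}"

text \<open>The monoid generated by the letters in \<open>L\<close> subject to the relations \<open>S\<close>.\<close>

definition word_monoid :: "'x set \<Rightarrow> ('x list \<times> 'x list) set \<Rightarrow> 'x list set monoid" where
  "word_monoid L S =
     \<lparr>carrier = lists L // word_cong L S,
      monoid.mult = (\<lambda>U V. \<Union>u\<in>U. \<Union>v\<in>V. word_class L S (u @ v)),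
      one = word_class L S []\<rparr>"

text \<open>The letter \<open>(x, True)\<close> stands for the generator \<open>x\<close> and \<open>(x, False)\<close> for its inverse.\<close>

definition free_group :: "'x set \<Rightarrow> ('x \<times> bool) list set monoid" where
  "free_group X = word_monoid (X \<times> UNIV) {([(x, b), (x, \<not> b)], []) |x b. x \<in> X}"

text \<open>A basis of a group embeds into the group, so it is no restriction that \<open>X\<close> is
  taken in the element type of \<open>F\<close>.\<close>

definition is_free :: "('a, 'm) monoid_scheme \<Rightarrow> bool" where
  "is_free F \<longleftrightarrow> group F \<and> (\<exists>X :: 'a set. free_group X \<cong> F)"

definition free_presentation ::
    "('f, 'm) monoid_scheme \<Rightarrow> 'f set \<Rightarrow> ('a, 'n) monoid_scheme \<Rightarrow> bool" where
  "free_presentation F R G \<longleftrightarrow> is_free F \<and> R \<lhd> F \<and> G \<cong> F Mod R"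

text \<open>The free product of the family \<open>G i\<close>, \<open>i \<in> I\<close>; the letter \<open>(i, x)\<close> stands for
  the element \<open>x\<close> of the copy of \<open>G i\<close> with index \<open>i\<close>.\<close>

definition free_product_letters ::
    "'i set \<Rightarrow> ('i \<Rightarrow> ('a, 'm) monoid_scheme) \<Rightarrow> ('i \<times> 'a) set" where
  "free_product_letters I G = (SIGMA i:I. carrier (G i))"

definition free_product_rels ::
    "'i set \<Rightarrow> ('i \<Rightarrow> ('a, 'm) monoid_scheme) \<Rightarrow> (('i \<times> 'a) list \<times> ('i \<times> 'a) list) set" where
  "free_product_rels I G =
     {([(i, x), (i, y)], [(i, x \<otimes>\<^bsub>G i\<^esub> y)]) |i x y.
        i \<in> I \<and> x \<in> carrier (G i) \<and> y \<in> carrier (G i)}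
     \<union> {([(i, \<one>\<^bsub>G i\<^esub>)], []) |i. i \<in> I}"

definition free_product ::
    "'i set \<Rightarrow> ('i \<Rightarrow> ('a, 'm) monoid_scheme) \<Rightarrow> ('i \<times> 'a) list set monoid" where
  "free_product I G = word_monoid (free_product_letters I G) (free_product_rels I G)"

definition free_product_in ::
    "'i set \<Rightarrow> ('i \<Rightarrow> ('a, 'm) monoid_scheme) \<Rightarrow> 'i \<Rightarrow> 'a \<Rightarrow> ('i \<times> 'a) list set" where
  "free_product_in I G i x = word_class (free_product_letters I G) (free_product_rels I G) [(i, x)]"

text \<open>The free product of two groups with possibly different element types.\<close>

definition free_prod2_letters ::
    "('a, 'm) monoid_scheme \<Rightarrow> ('b, 'n) monoid_scheme \<Rightarrow> ('a + 'b) set" where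
  "free_prod2_letters G H = carrier G <+> carrier H"

definition free_prod2_rels ::
    "('a, 'm) monoid_scheme \<Rightarrow> ('b, 'n) monoid_scheme \<Rightarrow> (('a + 'b) list \<times> ('a + 'b) list) set" where
  "free_prod2_rels G H =
     {([Inl x, Inl y], [Inl (x \<otimes>\<^bsub>G\<^esub> y)]) |x y. x \<in> carrier G \<and> y \<in> carrier G}
     \<union> {([Inr x, Inr y], [Inr (x \<otimes>\<^bsub>H\<^esub> y)]) |x y. x \<in> carrier H \<and> y \<in> carrier H}
     \<union> {([Inl \<one>\<^bsub>G\<^esub>], []), ([Inr \<one>\<^bsub>H\<^esub>], [])}"

definition free_prod2 ::
    "('a, 'm) monoid_scheme \<Rightarrow> ('b, 'n) monoid_scheme \<Rightarrow> ('a + 'b) list set monoid" where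
  "free_prod2 G H = word_monoid (free_prod2_letters G H) (free_prod2_rels G H)"

definition free_inl ::
    "('a, 'm) monoid_scheme \<Rightarrow> ('b, 'n) monoid_scheme \<Rightarrow> 'a \<Rightarrow> ('a + 'b) list set" where
  "free_inl G H x = word_class (free_prod2_letters G H) (free_prod2_rels G H) [Inl x]"

definition free_inr ::
    "('a, 'm) monoid_scheme \<Rightarrow> ('b, 'n) monoid_scheme \<Rightarrow> 'b \<Rightarrow> ('a + 'b) list set" where
  "free_inr G H y = word_class (free_prod2_letters G H) (free_prod2_rels G H) [Inr y]"

definition wreath_base ::
    "('a, 'm) monoid_scheme \<Rightarrow> ('b, 'n) monoid_scheme \<Rightarrow> ('b \<times> 'a) list set monoid" where
  "wreath_base A B = free_product (carrier B) (\<lambda>_. A)"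

text \<open>The automorphism of \<open>wreath_base A B\<close> induced by \<open>a\<^sub>b \<mapsto> a\<^bsub>b b'\<^esub>\<close>.  As
  \<open>b \<mapsto> b b'\<close> is a bijection, it relabels letters and preserves the relations in both
  directions, so the image of a congruence class is again a congruence class.\<close>

definition wreath_act :: "('b, 'n) monoid_scheme \<Rightarrow> 'b \<Rightarrow> ('b \<times> 'a) list set \<Rightarrow> ('b \<times> 'a) list set" where
  "wreath_act B b' U = map (\<lambda>(b, a). (b \<otimes>\<^bsub>B\<^esub> b', a)) ` U"

text \<open>The pair \<open>(b, x)\<close> stands for the product \<open>b x\<close>, so that
  \<open>(b x) (b' x') = (b b') (x\<^bsup>b'\<^esup> x')\<close> with \<open>x\<^bsup>b'\<^esup> = b'\<inverse> x b'\<close>.\<close>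

definition free_wreath ::
    "('a, 'm) monoid_scheme \<Rightarrow> ('b, 'n) monoid_scheme \<Rightarrow> ('b \<times> ('b \<times> 'a) list set) monoid" where
  "free_wreath A B =
     \<lparr>carrier = carrier B \<times> carrier (wreath_base A B),
      monoid.mult = (\<lambda>(b, x) (b', x'). (b \<otimes>\<^bsub>B\<^esub> b', wreath_act B b' x \<otimes>\<^bsub>wreath_base A B\<^esub> x')),
      one = (\<one>\<^bsub>B\<^esub>, \<one>\<^bsub>wreath_base A B\<^esub>)\<rparr>"

definition commutator :: "('a, 'm) monoid_scheme \<Rightarrow> 'a \<Rightarrow> 'a \<Rightarrow> 'a" where
  "commutator G x y = inv\<^bsub>G\<^esub> x \<otimes>\<^bsub>G\<^esub> inv\<^bsub>G\<^esub> y \<otimes>\<^bsub>G\<^esub> x \<otimes>\<^bsub>G\<^esub> y"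

definition comm_subgroup :: "('a, 'm) monoid_scheme \<Rightarrow> 'a set \<Rightarrow> 'a set \<Rightarrow> 'a set" where
  "comm_subgroup G X Y = generate G {commutator G x y |x y. x \<in> X \<and> y \<in> Y}"

text \<open>The left-normed \<open>[X, Y\<^sub>1, \<dots>, Y\<^sub>n]\<close>.\<close>

definition comm_subgroups :: "('a, 'm) monoid_scheme \<Rightarrow> 'a set \<Rightarrow> 'a set list \<Rightarrow> 'a set" where
  "comm_subgroups G X Ys = foldl (comm_subgroup G) X Ys"

text \<open>\<open>lower_central G n\<close> is \<open>\<gamma>\<^sub>n(G)\<close> for \<open>n \<ge> 1\<close>, starting with \<open>\<gamma>\<^sub>1(G) = G\<close>; the value at
  \<open>0\<close> is irrelevant.\<close>

fun lower_central :: "('a, 'm) monoid_scheme \<Rightarrow> nat \<Rightarrow> 'a set" where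
  "lower_central G 0 = carrier G"
| "lower_central G (Suc 0) = carrier G"
| "lower_central G (Suc (Suc n)) = comm_subgroup G (lower_central G (Suc n)) (carrier G)"

definition normal_closure :: "('a, 'm) monoid_scheme \<Rightarrow> 'a set \<Rightarrow> 'a set" where
  "normal_closure G X = \<Inter>{N. N \<lhd> G \<and> X \<subseteq> N}"

text \<open>\<open>(R \<inter> \<gamma>\<^bsub>c+1\<^esub>(F)) / [R, \<^sub>c F]\<close>, which is the Baer invariant \<open>\<N>\<^sub>cM(G)\<close> of every group
  \<open>G\<close> for which \<open>free_presentation F R G\<close>.\<close>

definition nilpotent_baer ::
    "nat \<Rightarrow> ('f, 'm) monoid_scheme \<Rightarrow> 'f set \<Rightarrow> 'f set monoid" where
  "nilpotent_baer c F R =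
     (F\<lparr>carrier := R \<inter> lower_central F (c + 1)\<rparr>) Mod (comm_subgroups F R (replicate c (carrier F)))"

text \<open>\<open>F\<close>, \<open>R\<close> and \<open>B\<close> are identified with their images in \<open>K\<close>.  The product of the family
  of normal subgroups in the definition of \<open>D\<^sub>c\<close> is the subgroup generated by their union.\<close>

definition D_sub ::
    "nat \<Rightarrow> ('f, 'm) monoid_scheme \<Rightarrow> 'f set \<Rightarrow> ('b, 'n) monoid_scheme \<Rightarrow> ('f + 'b) list set set" where
  "D_sub c F R B =
     (let K = free_prod2 F B;
          F' = free_inl F B ` carrier F;
          R' = free_inl F B ` R;
          B' = free_inr F B ` carrier B
      in generate K
           (\<Union>Gs \<in> {Gs. length Gs = c \<and> set Gs \<subseteq> {F', B'} \<and> B' \<in> set Gs}.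
              normal_closure K (comm_subgroups K R' Gs)))"

definition E_sub ::
    "nat \<Rightarrow> ('f, 'm) monoid_scheme \<Rightarrow> 'f set \<Rightarrow> ('b, 'n) monoid_scheme \<Rightarrow> ('f + 'b) list set set" where
  "E_sub c F R B =
     (let K = free_prod2 F B;
          F' = free_inl F B ` carrier F;
          R' = free_inl F B ` R;
          B' = free_inr F B ` carrier B
      in normal_closure K (comm_subgroup K R' (carrier K))
           \<inter> lower_central K (c + 1)
           \<inter> comm_subgroup K F' B')"

definition E_mod_D ::
    "nat \<Rightarrow> ('f, 'm) monoid_scheme \<Rightarrow> 'f set \<Rightarrow> ('b, 'n) monoid_scheme \<Rightarrow> ('f + 'b) list set set monoid" where
  "E_mod_D c F R B = ((free_prod2 F B)\<lparr>carrier := E_sub c F R B\<rparr>) Mod (D_sub c F R B)"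

text \<open>Basic facts confirming that these constructions are groups with the expected properties.\<close>

context
  notes in_lists_conv_set [simp del] lists.Cons [simp]
    and in_listsD [rule del] and in_listsI [rule del] and append_in_lists_conv [iff]
begin

private lemma append_lists [simp] : "u \<in> lists L \<Longrightarrow> v \<in> lists L \<Longrightarrow> u @ v \<in> lists L" by auto

lemma word_cong_lists: "(u, v) \<in> word_cong L S \<Longrightarrow> u \<in> lists L \<and> v \<in> lists L"
  by (induction rule: word_cong.induct) auto

lemma equiv_word_cong: "equiv (lists L) (word_cong L S)"
proof (rule equivI)
  show "word_cong L S \<subseteq> lists L \<times> lists L" using word_cong_lists by fast
  show "refl_on (lists L) (word_cong L S)" by (rule refl_onI) (rule word_cong.refl)
  show "sym (word_cong L S)" by (rule symI) (rule word_cong.sym)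
  show "trans (word_cong L S)" by (rule transI) (rule word_cong.trans)
qed

lemma word_cong_append_right:
  "(u, v) \<in> word_cong L S \<Longrightarrow> w \<in> lists L \<Longrightarrow> (u @ w, v @ w) \<in> word_cong L S"
proof (induction rule: word_cong.induct)
  case (rel u v p q)
  then show ?case using word_cong.rel[of u v S L p "q @ w"] by simp
qed (simp add: word_cong.refl, (blast intro: word_cong.sym word_cong.trans)+)

lemma word_cong_append_left:
  "(u, v) \<in> word_cong L S \<Longrightarrow> w \<in> lists L \<Longrightarrow> (w @ u, w @ v) \<in> word_cong L S"
proof (induction rule: word_cong.induct)
  case (rel u v p q)
  then show ?case using word_cong.rel[of u v S L "w @ p" q] by simp
qed (simp add: word_cong.refl, (blast intro: word_cong.sym word_cong.trans)+)

lemma word_cong_append: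
  assumes "(u, v) \<in> word_cong L S" "(u', v') \<in> word_cong L S"
  shows "(u @ u', v @ v') \<in> word_cong L S"
  using word_cong_append_right[OF assms(1) conjunct1[OF word_cong_lists[OF assms(2)]]]
    word_cong_append_left[OF assms(2) conjunct2[OF word_cong_lists[OF assms(1)]]]
  by (rule word_cong.trans)

lemma word_class_eq_iff:
  "u \<in> lists L \<Longrightarrow> v \<in> lists L \<Longrightarrow> word_class L S u = word_class L S v \<longleftrightarrow> (u, v) \<in> word_cong L S"
  unfolding word_class_def by (rule eq_equiv_class_iff[OF equiv_word_cong])

lemma word_class_rel:
  "(u, v) \<in> S \<Longrightarrow> u \<in> lists L \<Longrightarrow> v \<in> lists L \<Longrightarrow> word_class L S u = word_class L S v"
  using word_cong.rel[of u v S L "[]" "[]"] by (simp add: word_class_eq_iff)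

lemma carrier_word_monoid: "carrier (word_monoid L S) = word_class L S ` lists L"
  by (auto simp: word_monoid_def word_class_def quotient_def)

lemma one_word_monoid: "\<one>\<^bsub>word_monoid L S\<^esub> = word_class L S []"
  by (simp add: word_monoid_def)

lemma mult_word_class:
  assumes "u \<in> lists L" "v \<in> lists L"
  shows "word_class L S u \<otimes>\<^bsub>word_monoid L S\<^esub> word_class L S v = word_class L S (u @ v)"
proof -
  have *: "word_class L S (u' @ v') = word_class L S (u @ v)"
    if "u' \<in> word_class L S u" "v' \<in> word_class L S v" for u' v'
  proof -
    have "(u @ v, u' @ v') \<in> word_cong L S"
      using that word_cong_append unfolding word_class_def by blast
    moreover from this have "u @ v \<in> lists L" "u' @ v' \<in> lists L"
      using word_cong_lists[of "u @ v" "u' @ v'" L S] by blast+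
    ultimately have "word_class L S (u @ v) = word_class L S (u' @ v')"
      using word_class_eq_iff[of "u @ v" L "u' @ v'" S] by blast
    then show ?thesis by (rule HOL.sym)
  qed
  have "u \<in> word_class L S u" "v \<in> word_class L S v"
    using assms by (auto simp: word_class_def intro: word_cong.refl)
  then have eq: "(\<Union>u'\<in>word_class L S u. \<Union>v'\<in>word_class L S v. word_class L S (u' @ v')) = word_class L S (u @ v)"
    using * by fast
  show ?thesis unfolding word_monoid_def monoid.simps by (rule eq)
qed

lemma monoid_word_monoid: "monoid (word_monoid L S)"
  by (rule monoidI; (unfold carrier_word_monoid one_word_monoid)?; (elim imageE)?;
      simp add: mult_word_class)

lemma group_word_monoid:
  assumes "\<And>x. x \<in> L \<Longrightarrow> \<exists>y\<in>L. word_class L S [y, x] = word_class L S []"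
  shows "group (word_monoid L S)"
proof -
  interpret monoid "word_monoid L S" by (rule monoid_word_monoid)
  have inv: "\<exists>v\<in>lists L. word_class L S (v @ w) = word_class L S []" if "w \<in> lists L" for w
    using that
  proof (induction w)
    case (Cons x w)
    obtain v where v: "v \<in> lists L" "word_class L S (v @ w) = word_class L S []" using Cons by auto
    obtain y where y: "y \<in> L" "word_class L S [y, x] = word_class L S []" using assms Cons by blast
    have "word_class L S ((v @ [y]) @ x # w)
        = word_class L S v \<otimes>\<^bsub>word_monoid L S\<^esub> (word_class L S [y,x] \<otimes>\<^bsub>word_monoid L S\<^esub> word_class L S w)"
      using Cons v(1) y(1) by (simp add: mult_word_class)
    also have "\<dots> = word_class L S (v @ w)"
      unfolding y(2) using Cons v(1) by (simp add: mult_word_class)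
    also note v(2)
    finally have "word_class L S ((v @ [y]) @ x # w) = word_class L S []" .
    moreover have "v @ [y] \<in> lists L" using v y by simp
    ultimately show ?case by blast
  qed auto
  show ?thesis
  proof (rule groupI)
    fix x assume "x \<in> carrier (word_monoid L S)"
    then show "\<exists>y\<in>carrier (word_monoid L S). y \<otimes>\<^bsub>word_monoid L S\<^esub> x = \<one>\<^bsub>word_monoid L S\<^esub>"
      using inv by (fastforce simp: carrier_word_monoid one_word_monoid mult_word_class)
  qed (auto simp: m_assoc)
qed

lemma group_free_group: "group (free_group X)"
  unfolding free_group_def
proof (rule group_word_monoid, clarify)
  fix x b assume x: "x \<in> X"
  show "\<exists>y\<in>X \<times> UNIV. word_class (X \<times> UNIV) {([(x, b), (x, \<not> b)], []) |x b. x \<in> X} [y, (x, b)]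
        = word_class (X \<times> UNIV) {([(x, b), (x, \<not> b)], []) |x b. x \<in> X} []"
    by (rule bexI[of _ "(x, \<not> b)"]) (rule word_class_rel, use x in \<open>auto\<close>)
qed

lemma group_free_product:
  assumes "\<And>i. i \<in> I \<Longrightarrow> group (G i)"
  shows "group (free_product I G)"
  unfolding free_product_def
proof (rule group_word_monoid)
  fix l assume "l \<in> free_product_letters I G"
  then obtain i x where l: "l = (i, x)" "i \<in> I" "x \<in> carrier (G i)"
    by (auto simp: free_product_letters_def)
  interpret group "G i" using assms l by auto
  let ?L = "free_product_letters I G" and ?S = "free_product_rels I G"
  have "word_class ?L ?S [(i, inv\<^bsub>G i\<^esub> x), l] = word_class ?L ?S [(i, \<one>\<^bsub>G i\<^esub>)]"
    by (rule word_class_rel)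
       (use l in \<open>auto simp: free_product_letters_def free_product_rels_def intro!: exI[of _ x] exI[of _ "inv\<^bsub>G i\<^esub> x"]\<close>)
  also have "\<dots> = word_class ?L ?S []"
    by (rule word_class_rel) (use l in \<open>auto simp: free_product_letters_def free_product_rels_def\<close>)
  finally show "\<exists>y\<in>?L. word_class ?L ?S [y, l] = word_class ?L ?S []"
    using l by (intro bexI[of _ "(i, inv\<^bsub>G i\<^esub> x)"]) (auto simp: free_product_letters_def)
qed

lemma group_free_prod2:
  assumes "group G" "group H"
  shows "group (free_prod2 G H)"
  unfolding free_prod2_def
proof (rule group_word_monoid)
  interpret G: group G by fact
  interpret H: group H by fact
  let ?L = "free_prod2_letters G H" and ?S = "free_prod2_rels G H"
  note defs = free_prod2_letters_def free_prod2_rels_def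
  fix l assume "l \<in> ?L"
  then consider x where "l = Inl x" "x \<in> carrier G" | x where "l = Inr x" "x \<in> carrier H"
    by (auto simp: defs)
  then show "\<exists>y\<in>?L. word_class ?L ?S [y, l] = word_class ?L ?S []"
  proof cases
    case 1
    have "word_class ?L ?S [Inl (inv\<^bsub>G\<^esub> x), l] = word_class ?L ?S [Inl (inv\<^bsub>G\<^esub> x \<otimes>\<^bsub>G\<^esub> x)]"
      by (rule word_class_rel) (use 1 in \<open>auto simp: defs simp del: G.l_inv\<close>)
    also have "\<dots> = word_class ?L ?S []"
      by (rule word_class_rel) (use 1 in \<open>auto simp: defs\<close>)
    finally show ?thesis
      using 1 by (intro bexI[of _ "Inl (inv\<^bsub>G\<^esub> x)"]) (auto simp: defs)
  next
    case 2
    have "word_class ?L ?S [Inr (inv\<^bsub>H\<^esub> x), l] = word_class ?L ?S [Inr (inv\<^bsub>H\<^esub> x \<otimes>\<^bsub>H\<^esub> x)]"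
      by (rule word_class_rel) (use 2 in \<open>auto simp: defs simp del: H.l_inv\<close>)
    also have "\<dots> = word_class ?L ?S []"
      by (rule word_class_rel) (use 2 in \<open>auto simp: defs\<close>)
    finally show ?thesis
      using 2 by (intro bexI[of _ "Inr (inv\<^bsub>H\<^esub> x)"]) (auto simp: defs)
  qed
qed

lemma free_inl_hom: "group G \<Longrightarrow> free_inl G H \<in> hom G (free_prod2 G H)"
  apply (rule homI)
   apply (auto simp: free_inl_def free_prod2_def carrier_word_monoid free_prod2_letters_def)[1]
  apply (simp add: free_inl_def free_prod2_def)
  apply (subst mult_word_class)
    apply (auto simp: free_prod2_letters_def)[2]
  apply (rule word_class_rel[THEN HOL.sym])
  by (auto simp: free_prod2_letters_def free_prod2_rels_def group.is_monoid monoid.m_closed)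

lemma word_monoid_lift:
  assumes "group H" "\<And>x. x \<in> L \<Longrightarrow> f x \<in> carrier H"
    and "\<And>u v. (u, v) \<in> S \<Longrightarrow> u \<in> lists L \<Longrightarrow> v \<in> lists L
      \<Longrightarrow> foldr (\<lambda>x y. f x \<otimes>\<^bsub>H\<^esub> y) u \<one>\<^bsub>H\<^esub> = foldr (\<lambda>x y. f x \<otimes>\<^bsub>H\<^esub> y) v \<one>\<^bsub>H\<^esub>"
  shows "\<exists>h\<in>hom (word_monoid L S) H. \<forall>x\<in>L. h (word_class L S [x]) = f x"
proof -
  interpret H: group H by fact
  let ?e = "\<lambda>w. foldr (\<lambda>x y. f x \<otimes>\<^bsub>H\<^esub> y) w \<one>\<^bsub>H\<^esub>"
  have c: "?e w \<in> carrier H" if "w \<in> lists L" for w using that by induction (auto simp: assms)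
  have app: "?e (u @ v) = ?e u \<otimes>\<^bsub>H\<^esub> ?e v" if "u \<in> lists L" "v \<in> lists L" for u v
    using that by (induction u) (auto simp: assms H.m_assoc c)
  have r: "?e u = ?e v" if "(u, v) \<in> word_cong L S" for u v
    using that
  proof (induction rule: word_cong.induct)
    case (rel u v p q)
    then show ?case using assms(3)[of u v] by (simp add: app del: foldr_append)
  qed auto
  define h where "h U = ?e (SOME w. w \<in> U)" for U
  have h: "h (word_class L S w) = ?e w" if "w \<in> lists L" for w
  proof -
    have "w \<in> word_class L S w" using that by (auto simp: word_class_def intro: word_cong.refl)
    then have "(SOME w'. w' \<in> word_class L S w) \<in> word_class L S w" by (rule someI)
    then show ?thesis unfolding h_def word_class_def using r by auto
  qed
  have "h \<in> hom (word_monoid L S) H"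
    by (rule homI) (auto simp: carrier_word_monoid h c mult_word_class app simp del: foldr_append)
  then show ?thesis using h assms by (intro bexI[of _ h]) auto
qed

lemma inj_free_inl:
  fixes G :: "('a, 'm) monoid_scheme" and H :: "('b, 'n) monoid_scheme"
  assumes "group G" "group H"
  shows "inj_on (free_inl G H) (carrier G)"
proof -
  interpret G: group G by fact
  define f where "f = case_sum (\<lambda>x. x) (\<lambda>y::'b. \<one>\<^bsub>G\<^esub>)"
  have "\<exists>h\<in>hom (free_prod2 G H) G. \<forall>x\<in>free_prod2_letters G H.
       h (word_class (free_prod2_letters G H) (free_prod2_rels G H) [x]) = f x"
    unfolding free_prod2_def
    by (rule word_monoid_lift) (auto simp: f_def free_prod2_letters_def free_prod2_rels_def)
  then show ?thesis unfolding free_inl_def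
    by (auto intro!: inj_onI simp: free_prod2_letters_def f_def) (metis InlI old.sum.simps(5))
qed

lemma wreath_act_class:
  assumes "group A" "group B" "b' \<in> carrier B"
    and w: "w \<in> lists (carrier B \<times> carrier A)"
  defines "L \<equiv> free_product_letters (carrier B) (\<lambda>_. A)"
      and "S \<equiv> free_product_rels (carrier B) (\<lambda>_. A)"
  shows "wreath_act B b' (word_class L S w) = word_class L S (map (\<lambda>(b, a). (b \<otimes>\<^bsub>B\<^esub> b', a)) w)"
proof -
  interpret A: group A by fact
  interpret B: group B by fact
  have L: "L = carrier B \<times> carrier A" by (auto simp: L_def free_product_letters_def)
  define f where "f b' = (\<lambda>(b, a::'a). (b \<otimes>\<^bsub>B\<^esub> b', a))" for b'
  have fl: "map (f b') w \<in> lists L" if "w \<in> lists L" "b' \<in> carrier B" for w b'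
    using that by (auto simp: L f_def in_lists_conv_set)
  have S: "(map (f b') u, map (f b') v) \<in> S" if "(u,v) \<in> S" "b' \<in> carrier B" for u v b'
    using that by (auto simp: S_def free_product_rels_def f_def)
  have m: "(map (f b') u, map (f b') v) \<in> word_cong L S"
    if "(u,v) \<in> word_cong L S" "b' \<in> carrier B" for u v b'
    using that
  proof (induction rule: word_cong.induct)
    case (rel u v p q)
    then show ?case using word_cong.rel[OF S[OF rel(1) rel.prems] fl[OF _ rel.prems] fl[OF _ rel.prems] fl[OF _ rel.prems] fl[OF _ rel.prems], of p q] by simp
  qed (simp add: word_cong.refl fl, (blast intro: word_cong.sym word_cong.trans)+)
  have inv: "map (f b') (map (f (inv\<^bsub>B\<^esub> b')) u) = u" if "u \<in> lists L" for u
    using that assms(3) by (induction u) (auto simp: f_def L B.m_assoc)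
  have "map (f b') ` word_class L S w = word_class L S (map (f b') w)"
  proof (intro equalityI subsetI)
    fix v assume "v \<in> map (f b') ` word_class L S w"
    then show "v \<in> word_class L S (map (f b') w)" using m assms(3) by (auto simp: word_class_def)
  next
    fix v assume v: "v \<in> word_class L S (map (f b') w)"
    then have vl: "v \<in> lists L" using word_cong_lists by (fastforce simp: word_class_def)
    have "(map (f (inv\<^bsub>B\<^esub> b')) (map (f b') w), map (f (inv\<^bsub>B\<^esub> b')) v) \<in> word_cong L S"
      using v m assms(3) by (auto simp: word_class_def simp del: map_map)
    moreover have "map (f (inv\<^bsub>B\<^esub> b')) (map (f b') w) = w"
      using w assms(3) by (induction w) (auto simp: f_def L B.m_assoc)
    ultimately have "map (f (inv\<^bsub>B\<^esub> b')) v \<in> word_class L S w" by (simp add: word_class_def)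
    then show "v \<in> map (f b') ` word_class L S w" using inv[OF vl] by (metis imageI)
  qed
  then show ?thesis by (simp add: wreath_act_def f_def)
qed

lemma group_free_wreath:
  assumes "group A" "group B"
  shows "group (free_wreath A B)"
proof -
  interpret A: group A by fact
  interpret B: group B by fact
  interpret C: group "wreath_base A B"
    unfolding wreath_base_def by (rule group_free_product) (rule assms)
  let ?L = "free_product_letters (carrier B) (\<lambda>_. A)" and ?S = "free_product_rels (carrier B) (\<lambda>_. A)"
  have L: "?L = carrier B \<times> carrier A" by (auto simp: free_product_letters_def)
  have C: "carrier (wreath_base A B) = word_class ?L ?S ` lists (carrier B \<times> carrier A)"
    by (simp add: wreath_base_def free_product_def carrier_word_monoid L)
  have M: "word_class ?L ?S u \<otimes>\<^bsub>wreath_base A B\<^esub> word_class ?L ?S v = word_class ?L ?S (u @ v)"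
    if "u \<in> lists (carrier B \<times> carrier A)" "v \<in> lists (carrier B \<times> carrier A)" for u v
    using that by (simp add: wreath_base_def free_product_def mult_word_class L)
  have mc: "map (\<lambda>(b, a). (b \<otimes>\<^bsub>B\<^esub> b', a)) u \<in> lists (carrier B \<times> carrier A)"
    if "u \<in> lists (carrier B \<times> carrier A)" "b' \<in> carrier B" for u b' using that by (auto simp: in_lists_conv_set)
  note act = wreath_act_class[OF assms]
  have a1: "wreath_act B b x \<in> carrier (wreath_base A B)"
    if "b \<in> carrier B" "x \<in> carrier (wreath_base A B)" for b x
    using that mc by (auto simp: C act)
  have a2: "wreath_act B b (x \<otimes>\<^bsub>wreath_base A B\<^esub> y) = wreath_act B b x \<otimes>\<^bsub>wreath_base A B\<^esub> wreath_act B b y"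
    if q: "b \<in> carrier B" "x \<in> carrier (wreath_base A B)" "y \<in> carrier (wreath_base A B)" for b x y
  proof -
    obtain u where u: "x = word_class ?L ?S u" "u \<in> lists (carrier B \<times> carrier A)" using q(2) unfolding C by (rule imageE)
    obtain v where v: "y = word_class ?L ?S v" "v \<in> lists (carrier B \<times> carrier A)" using q(3) unfolding C by (rule imageE)
    note uv = u v
    have "u @ v \<in> lists (carrier B \<times> carrier A)" using uv by auto
    then show ?thesis using that uv mc by (simp add: M act)
  qed
  have a3: "wreath_act B b' (wreath_act B b x) = wreath_act B (b \<otimes>\<^bsub>B\<^esub> b') x"
    if q: "b \<in> carrier B" "b' \<in> carrier B" "x \<in> carrier (wreath_base A B)" for b b' x
  proof -
    obtain u where u: "x = word_class ?L ?S u" "u \<in> lists (carrier B \<times> carrier A)" using q unfolding C by (elim imageE)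
    have "map (\<lambda>(c, a). (c \<otimes>\<^bsub>B\<^esub> b', a)) (map (\<lambda>(c, a). (c \<otimes>\<^bsub>B\<^esub> b, a)) u)
        = map (\<lambda>(c, a). (c \<otimes>\<^bsub>B\<^esub> (b \<otimes>\<^bsub>B\<^esub> b'), a)) u"
      using u(2) that by (induction u) (auto simp: B.m_assoc)
    then show ?thesis using that u mc by (simp add: act del: map_map)
  qed
  have a4: "wreath_act B \<one>\<^bsub>B\<^esub> x = x" if q: "x \<in> carrier (wreath_base A B)" for x
  proof -
    obtain u where u: "x = word_class ?L ?S u" "u \<in> lists (carrier B \<times> carrier A)" using q unfolding C by (elim imageE)
    have "map (\<lambda>(c, a). (c \<otimes>\<^bsub>B\<^esub> \<one>\<^bsub>B\<^esub>, a)) u = u"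
      using u(2) by (induction u) auto
    then show ?thesis using u by (simp add: act)
  qed
  show ?thesis
  proof (rule groupI)
    fix x assume "x \<in> carrier (free_wreath A B)"
    then obtain b c where bc: "x = (b, c)" "b \<in> carrier B" "c \<in> carrier (wreath_base A B)"
      by (auto simp: free_wreath_def)
    have i: "wreath_act B (inv\<^bsub>B\<^esub> b) (inv\<^bsub>wreath_base A B\<^esub> c) \<in> carrier (wreath_base A B)"
      using bc by (intro a1) auto
    show "\<exists>y\<in>carrier (free_wreath A B). y \<otimes>\<^bsub>free_wreath A B\<^esub> x = \<one>\<^bsub>free_wreath A B\<^esub>"
      using bc i
      by (intro bexI[of _ "(inv\<^bsub>B\<^esub> b, wreath_act B (inv\<^bsub>B\<^esub> b) (inv\<^bsub>wreath_base A B\<^esub> c))"])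
         (auto simp: free_wreath_def a3 a4)
  next
    have "wreath_act B b \<one>\<^bsub>wreath_base A B\<^esub> = \<one>\<^bsub>wreath_base A B\<^esub>" if "b \<in> carrier B" for b
      using a1[OF that C.one_closed] a2[OF that C.one_closed C.one_closed] C.l_cancel_one' by auto
    then show "\<one>\<^bsub>free_wreath A B\<^esub> \<otimes>\<^bsub>free_wreath A B\<^esub> x = x" if "x \<in> carrier (free_wreath A B)" for x
      using that by (auto simp: free_wreath_def)
  qed (auto simp: free_wreath_def a1 a2 a3 B.m_assoc C.m_assoc)
qed

text \<open>\<open>b'\<inverse> a\<^sub>b b' = a\<^bsub>b b'\<^esub>\<close>\<close>
lemma free_wreath_conj:
  assumes "group A" "group B" "b \<in> carrier B" "b' \<in> carrier B" "a \<in> carrier A"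
  defines "i \<equiv> (\<lambda>b a. (\<one>\<^bsub>B\<^esub>, free_product_in (carrier B) (\<lambda>_. A) b a))"
  shows "i b a \<otimes>\<^bsub>free_wreath A B\<^esub> (b', \<one>\<^bsub>wreath_base A B\<^esub>)
    = (b', \<one>\<^bsub>wreath_base A B\<^esub>) \<otimes>\<^bsub>free_wreath A B\<^esub> i (b \<otimes>\<^bsub>B\<^esub> b') a"
proof -
  interpret B: group B by fact
  interpret C: group "wreath_base A B"
    unfolding wreath_base_def by (rule group_free_product) (rule assms)
  have *: "wreath_act B b' (free_product_in (carrier B) (\<lambda>_. A) b a)
     = free_product_in (carrier B) (\<lambda>_. A) (b \<otimes>\<^bsub>B\<^esub> b') a" if "b \<in> carrier B" "b' \<in> carrier B" for b b'
    unfolding free_product_in_def using that assms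
    by (subst wreath_act_class) auto
  have c: "free_product_in (carrier B) (\<lambda>_. A) b a \<in> carrier (wreath_base A B)" if "b \<in> carrier B" for b
    using that assms by (auto simp: free_product_in_def wreath_base_def free_product_def
        carrier_word_monoid free_product_letters_def)
  have "wreath_act B \<one>\<^bsub>B\<^esub> \<one>\<^bsub>wreath_base A B\<^esub> = \<one>\<^bsub>wreath_base A B\<^esub>"
   "wreath_act B \<one>\<^bsub>B\<^esub> \<one>\<^bsub>wreath_base A B\<^esub> = \<one>\<^bsub>wreath_base A B\<^esub>"
    using wreath_act_class[OF assms(1,2), of "\<one>\<^bsub>B\<^esub>" "[]"] 
    by (simp_all add: wreath_base_def free_product_def one_word_monoid)
  moreover have "wreath_act B \<one>\<^bsub>B\<^esub> \<one>\<^bsub>wreath_base A B\<^esub> = \<one>\<^bsub>wreath_base A B\<^esub>" by fact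
  moreover have "wreath_act B \<one>\<^bsub>B\<^esub> (\<one>\<^bsub>wreath_base A B\<^esub>) \<otimes>\<^bsub>wreath_base A B\<^esub> x = x"
      if "x \<in> carrier (wreath_base A B)" for x using that calculation by simp
  ultimately show ?thesis
    using assms c[of "b"] c[of "b \<otimes>\<^bsub>B\<^esub> b'"] by (simp add: free_wreath_def *)
qed

end

end

theory Submission
  imports Defs "HOL-Algebra.Multiplicative_Group" "HOL-Computational_Algebra.Primes"
begin

text \<open>
  The free wreath product \<open>W\<close> of \<open>A\<close> by \<open>B\<close> is the free product \<open>A * B\<close> in disguise: the copy \<open>A\<^sub>b\<close> is the
  conjugate of \<open>A\<^sub>1\<close> by \<open>b\<close>, so a homomorphism on \<open>W\<close> is the same as a pair of homomorphisms on \<open>A\<close> and \<open>B\<close>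
  (\<open>free_wreath_lift\<close>).  In particular \<open>A\<close> and \<open>B\<close> are retracts of \<open>W\<close>, each killed by the retraction onto
  the other, and \<open>W \<cong> K/R\<^sup>K\<close> for \<open>K = F * B\<close>, where \<open>A \<cong> F/R\<close> (\<open>wreath_projection\<close>).

  For a normal subgroup \<open>T\<close> of a group \<open>Q\<close> form \<open>(T \<inter> \<gamma>\<^bsub>c+1\<^esub>(Q)) / [T, \<^sub>c Q]\<close>.  Homomorphisms that agree modulo \<open>T\<close>
  induce the same map on these groups (\<open>hom_cong_rel_lcs\<close>), and if \<open>Q\<close> is generated by \<open>T\<close> and the image
  of \<open>u : P \<rightarrow> Q\<close>, then \<open>\<gamma>\<^bsub>c+1\<^esub>(Q) = u(\<gamma>\<^bsub>c+1\<^esub>(P)) [T, \<^sub>c Q]\<close> (\<open>lower_central_lift\<close>).  Both facts rest on the estimate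
  \<open>[T, \<gamma>\<^bsub>n+1\<^esub>(Q)] \<le> [T, \<^bsub>n+1\<^esub> Q]\<close>.  Lifting the homomorphisms between \<open>A\<close>, \<open>B\<close> and \<open>W\<close> to the given free presentations
  therefore exhibits the Baer invariants of \<open>A\<close> and \<open>B\<close> as retracts of that of \<open>W\<close>, and a lift
  of \<open>W \<cong> K/R\<^sup>K\<close> to \<open>K\<close> maps the Baer invariant of \<open>W\<close> onto the group formed from \<open>K\<close> and \<open>R\<^sup>K\<close>.

  The group formed from \<open>K\<close> and \<open>R\<^sup>K\<close> maps onto \<open>E\<^sub>c/D\<^sub>c\<close> by \<open>x \<mapsto> \<rho>(x)\<inverse> x\<close>, where \<open>\<rho>\<close> is the retraction of \<open>K\<close> onto
  \<open>F\<close> (\<open>baer_to_E_mod_D\<close>).  Indeed \<open>E\<^sub>c\<close> consists of the elements of \<open>R\<^sup>K \<inter> \<gamma>\<^bsub>c+1\<^esub>(K)\<close> killed by \<open>\<rho>\<close>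
  (\<open>E_sub_eq\<close>), and multilinearity of commutators yields \<open>[R\<^sup>K, \<^sub>c K] = [R, \<^sub>c F] D\<^sub>c\<close>, which the
  map takes into \<open>D\<^sub>c\<close>.  The parts of the Baer invariant of \<open>W\<close> that come from \<open>A\<close> and \<open>B\<close> vanish
  in \<open>E\<^sub>c/D\<^sub>c\<close>, so the three maps together are still onto.

  The second claim is the first one combined with a fact about finite abelian groups: every
  subgroup is the kernel of an endomorphism (\<open>endomorphism_with_kernel\<close>), so every quotient is
  isomorphic to a subgroup.  For a subgroup of prime order \<open>p\<close>, one splits off a cyclic direct factor that
  contains it and takes \<open>p\<close>-th powers there.
\<close>

section \<open>Commutators modulo a normal subgroup\<close>

text \<open>Quotients are only accessed through the homomorphism \<open>x \<mapsto> N #> x\<close>, so products of cosets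
  should not be unfolded into products of sets.\<close>

declare mult_FactGroup [simp del] one_FactGroup [simp del]

lemma comm_subgroups_Nil [simp]: "comm_subgroups G X [] = X"
  and comm_subgroups_snoc [simp]:
    "comm_subgroups G X (Ys @ [Y]) = comm_subgroup G (comm_subgroups G X Ys) Y"
  by (simp_all add: comm_subgroups_def)

context group
begin

lemma inv_cancel_left [simp]:
  "x \<in> carrier G \<Longrightarrow> y \<in> carrier G \<Longrightarrow> inv x \<otimes> (x \<otimes> y) = y"
  "x \<in> carrier G \<Longrightarrow> y \<in> carrier G \<Longrightarrow> x \<otimes> (inv x \<otimes> y) = y"
  by (simp_all flip: m_assoc)

lemmas word_simps = m_assoc inv_mult_group

lemma commutator_closed [simp]:
  "x \<in> carrier G \<Longrightarrow> y \<in> carrier G \<Longrightarrow> commutator G x y \<in> carrier G"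
  by (simp add: commutator_def)

lemma commutator_eq_one_iff:
  assumes "x \<in> carrier G" "y \<in> carrier G"
  shows "commutator G x y = \<one> \<longleftrightarrow> x \<otimes> y = y \<otimes> x"
proof -
  have "x \<otimes> y = y \<otimes> x \<otimes> commutator G x y"
    using assms by (simp add: commutator_def word_simps)
  moreover have "y \<otimes> x \<otimes> commutator G x y = y \<otimes> x \<longleftrightarrow> commutator G x y = \<one>"
    using assms by (intro l_cancel_one) auto
  ultimately show ?thesis by auto
qed

lemma commute_inv:
  assumes "x \<in> carrier G" "y \<in> carrier G" "x \<otimes> y = y \<otimes> x"
  shows "x \<otimes> inv y = inv y \<otimes> x"
  using assms by (metis inv_closed inv_solve_left' inv_solve_right m_assoc m_closed)

lemma commute_mult:
  assumes "x \<in> carrier G" "y \<in> carrier G" "z \<in> carrier G"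
    "x \<otimes> y = y \<otimes> x" "x \<otimes> z = z \<otimes> x"
  shows "x \<otimes> (y \<otimes> z) = (y \<otimes> z) \<otimes> x"
  using assms by (metis m_assoc)

lemma commute_commutator:
  assumes "x \<in> carrier G" "y \<in> carrier G" "z \<in> carrier G"
    "x \<otimes> y = y \<otimes> x" "x \<otimes> z = z \<otimes> x"
  shows "x \<otimes> commutator G y z = commutator G y z \<otimes> x"
  unfolding commutator_def using assms by (simp add: commute_inv commute_mult)

lemma rcoset_eq_iff:
  assumes "N \<lhd> G" "x \<in> carrier G" "y \<in> carrier G"
  shows "N #> x = N #> y \<longleftrightarrow> x \<otimes> inv y \<in> N"
proof -
  interpret N: normal N G by fact
  show ?thesis
    using assms by (metis N.is_subgroup N.rcos_module N.subgroup_axioms is_group rcos_self repr_independence)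
qed

lemma rcoset_eq_self_iff:
  assumes "N \<lhd> G" "x \<in> carrier G"
  shows "N #> x = N \<longleftrightarrow> x \<in> N"
  using assms by (meson coset_join1 coset_join2 normal_imp_subgroup normal_imp_subgroup subgroup.subset)

lemma quotient_hom:
  assumes "N \<lhd> G"
  shows "group_hom G (G Mod N) (\<lambda>x. N #> x)"
  using assms by (simp add: group_hom_def group_hom_axioms_def normal.factorgroup_is_group
      normal.r_coset_hom_Mod is_group)

lemma inv_mult_eq_one_iff:
  assumes "x \<in> carrier G" "y \<in> carrier G"
  shows "inv x \<otimes> y = \<one> \<longleftrightarrow> x = y"
  using assms by (metis inv_cancel_left(2) l_inv r_one inv_closed)

lemma inv_mult_in_normal_iff:
  assumes "N \<lhd> G" "x \<in> carrier G" "y \<in> carrier G"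
  shows "inv x \<otimes> y \<in> N \<longleftrightarrow> N #> x = N #> y"
proof -
  interpret q: group_hom G "G Mod N" "\<lambda>x. N #> x" by (rule quotient_hom) fact
  have "inv x \<otimes> y \<in> N \<longleftrightarrow> N #> (inv x \<otimes> y) = \<one>\<^bsub>G Mod N\<^esub>"
    using assms by (simp add: rcoset_eq_self_iff one_FactGroup del: q.hom_mult)
  also have "\<dots> \<longleftrightarrow> N #> x = N #> y"
    using assms by (simp add: q.H.inv_mult_eq_one_iff del: q.hom_closed) (use assms q.hom_closed q.H.inv_mult_eq_one_iff in blast)
  finally show ?thesis .
qed

lemma subgroup_comm_subgroup:
  assumes "X \<subseteq> carrier G" "Y \<subseteq> carrier G"
  shows "subgroup (comm_subgroup G X Y) G"
  unfolding comm_subgroup_def using assms by (intro generate_is_subgroup) (blast intro: commutator_closed)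

lemma comm_subgroup_closed:
  assumes "X \<subseteq> carrier G" "Y \<subseteq> carrier G"
  shows "comm_subgroup G X Y \<subseteq> carrier G"
  using subgroup_comm_subgroup[OF assms] by (rule subgroup.subset)

lemma commutator_in_comm_subgroup:
  "x \<in> X \<Longrightarrow> y \<in> Y \<Longrightarrow> commutator G x y \<in> comm_subgroup G X Y"
  unfolding comm_subgroup_def by (rule generate.incl) auto

lemma comm_subgroup_least:
  assumes "subgroup H G" "\<And>x y. x \<in> X \<Longrightarrow> y \<in> Y \<Longrightarrow> commutator G x y \<in> H"
  shows "comm_subgroup G X Y \<subseteq> H"
  unfolding comm_subgroup_def using assms by (intro generate_subgroup_incl) auto

lemma comm_subgroup_mono:
  assumes "X \<subseteq> X'" "Y \<subseteq> Y'" "X' \<subseteq> carrier G" "Y' \<subseteq> carrier G"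
  shows "comm_subgroup G X Y \<subseteq> comm_subgroup G X' Y'"
  using assms by (intro comm_subgroup_least subgroup_comm_subgroup commutator_in_comm_subgroup) auto

lemma comm_subgroups_closed:
  assumes "X \<subseteq> carrier G" "\<And>Y. Y \<in> set Ys \<Longrightarrow> Y \<subseteq> carrier G"
  shows "comm_subgroups G X Ys \<subseteq> carrier G"
  using assms(2)
proof (induction Ys rule: rev_induct)
  case (snoc Y Ys)
  have "comm_subgroups G X Ys \<subseteq> carrier G" by (rule snoc.IH) (simp add: snoc.prems)
  moreover have "Y \<subseteq> carrier G" by (rule snoc.prems) simp
  ultimately show ?case by (simp add: comm_subgroup_closed)
qed (simp add: assms(1))

text \<open>Once the left-normed commutator has entered a normal subgroup, further entries cannot lead out of it.\<close>

lemma comm_subgroups_in_normal: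
  assumes N: "N \<lhd> G" and X: "X \<subseteq> carrier G" and Ys: "\<And>Y. Y \<in> set Ys \<Longrightarrow> Y \<subseteq> carrier G"
    and "X \<subseteq> N \<or> (\<exists>Y\<in>set Ys. Y \<subseteq> N)"
  shows "comm_subgroups G X Ys \<subseteq> N"
  using assms(3,4)
proof (induction Ys rule: rev_induct)
  case (snoc Y Ys)
  interpret N: normal N G by fact
  have IH: "comm_subgroups G X Ys \<subseteq> N" if "X \<subseteq> N \<or> (\<exists>Y\<in>set Ys. Y \<subseteq> N)"
    using snoc.IH snoc.prems(1) that by simp
  have c: "comm_subgroups G X Ys \<subseteq> carrier G" "Y \<subseteq> carrier G"
    using snoc.prems(1) comm_subgroups_closed[OF X, of Ys] by auto
  have "commutator G x y \<in> N" if "x \<in> comm_subgroups G X Ys" "y \<in> Y" for x y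
  proof -
    have xy: "x \<in> carrier G" "y \<in> carrier G" using that c by auto
    have "x \<in> N \<or> y \<in> N"
    proof (cases "Y \<subseteq> N")
      case False
      then have "X \<subseteq> N \<or> (\<exists>Y\<in>set Ys. Y \<subseteq> N)" using snoc.prems(2) by simp
      then show ?thesis using IH that by blast
    qed (use that in blast)
    then show ?thesis
    proof
      assume "x \<in> N"
      then have "inv x \<otimes> (inv y \<otimes> x \<otimes> y) \<in> N"
        using N.m_closed[OF N.m_inv_closed[OF \<open>x \<in> N\<close>] N.inv_op_closed1[OF xy(2) \<open>x \<in> N\<close>]] by simp
      then show ?thesis using xy by (simp add: commutator_def m_assoc)
    next
      assume "y \<in> N"
      then have "(inv x \<otimes> inv y \<otimes> x) \<otimes> y \<in> N"
        using N.m_closed[OF N.inv_op_closed1[OF xy(1) N.m_inv_closed[OF \<open>y \<in> N\<close>]] \<open>y \<in> N\<close>] by simp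
      then show ?thesis using xy by (simp add: commutator_def)
    qed
  qed
  then show ?case
    unfolding comm_subgroups_snoc by (rule comm_subgroup_least[OF N.is_subgroup])
qed simp

lemma comm_subgroups_mono:
  assumes X: "X \<subseteq> X'" "X' \<subseteq> carrier G"
    and f: "\<And>Y. Y \<in> set Ys \<Longrightarrow> Y \<subseteq> f Y" "\<And>Y. Y \<in> set Ys \<Longrightarrow> f Y \<subseteq> carrier G"
  shows "comm_subgroups G X Ys \<subseteq> comm_subgroups G X' (map f Ys)"
  using f
proof (induction Ys rule: rev_induct)
  case (snoc Y Ys)
  have Y: "Y \<subseteq> f Y" "f Y \<subseteq> carrier G"
    by (rule snoc.prems; simp)+
  have Ys: "Z \<subseteq> f Z" "f Z \<subseteq> carrier G" if "Z \<in> set Ys" for Z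
    by (rule snoc.prems; simp add: that)+
  have "comm_subgroups G X' (map f Ys) \<subseteq> carrier G"
    by (rule comm_subgroups_closed[OF X(2)]) (use Ys(2) in fastforce)
  moreover have "comm_subgroups G X Ys \<subseteq> comm_subgroups G X' (map f Ys)"
    by (rule snoc.IH[OF Ys])
  ultimately have "comm_subgroup G (comm_subgroups G X Ys) Y
      \<subseteq> comm_subgroup G (comm_subgroups G X' (map f Ys)) (f Y)"
    using Y by (intro comm_subgroup_mono)
  then show ?case by simp
qed (simp add: X)

lemma comm_subgroups_mono_replicate:
  assumes "X \<subseteq> X'" "X' \<subseteq> carrier G" "Y \<subseteq> Y'" "Y' \<subseteq> carrier G"
  shows "comm_subgroups G X (replicate n Y) \<subseteq> comm_subgroups G X' (replicate n Y')"
proof -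
  have "comm_subgroups G X (replicate n Y) \<subseteq> comm_subgroups G X' (map (\<lambda>_. Y') (replicate n Y))"
    using assms by (intro comm_subgroups_mono) (auto simp only: in_set_replicate)
  then show ?thesis by (simp only: map_replicate)
qed

text \<open>The set of elements that conjugate \<open>Z\<close> into itself is closed under products but in general not
  under inverses; hence the generating set has to be closed under inversion.\<close>

lemma normal_if_normalized_by_generators:
  assumes Z: "subgroup Z G" and S: "S \<subseteq> carrier G" "carrier G \<subseteq> generate G S"
    and inv: "\<And>s. s \<in> S \<Longrightarrow> inv s \<in> S"
    and conj: "\<And>s z. s \<in> S \<Longrightarrow> z \<in> Z \<Longrightarrow> s \<otimes> z \<otimes> inv s \<in> Z"
  shows "Z \<lhd> G"
proof -
  have Zc: "z \<in> Z \<Longrightarrow> z \<in> carrier G" for z using Z by (rule subgroup.mem_carrier)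
  have "\<forall>z\<in>Z. g \<otimes> z \<otimes> inv g \<in> Z" if "g \<in> generate G S" for g
    using that
  proof (induction rule: generate.induct)
    case (eng g h)
    have gh: "g \<in> carrier G" "h \<in> carrier G" using eng S(1) generate_in_carrier by auto
    have "g \<otimes> h \<otimes> z \<otimes> inv (g \<otimes> h) = g \<otimes> (h \<otimes> z \<otimes> inv h) \<otimes> inv g" if "z \<in> Z" for z
      using gh Zc[OF that] by (simp add: word_simps)
    then show ?case using eng.IH by auto
  next
    case one
    then show ?case using Zc by simp
  next
    case (incl s)
    then show ?case using conj by blast
  next
    case (inv s)
    then show ?case using conj assms(4) by blast
  qed
  then show ?thesis using S(2) Z by (auto simp: normal_inv_iff)
qed

lemma generate_normal_if_normalized_by_generators:
  assumes H: "H \<subseteq> carrier G" and S: "S \<subseteq> carrier G" "carrier G \<subseteq> generate G S"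
    and inv: "\<And>s. s \<in> S \<Longrightarrow> inv s \<in> S"
    and conj: "\<And>s h. s \<in> S \<Longrightarrow> h \<in> H \<Longrightarrow> s \<otimes> h \<otimes> inv s \<in> generate G H"
  shows "generate G H \<lhd> G"
proof (rule normal_if_normalized_by_generators[OF generate_is_subgroup[OF H] S inv])
  note sub = generate_is_subgroup[OF H]
  fix s z assume s: "s \<in> S" and "z \<in> generate G H"
  have sc: "s \<in> carrier G" using s S by auto
  from \<open>z \<in> generate G H\<close> show "s \<otimes> z \<otimes> inv s \<in> generate G H"
  proof (induction rule: generate.induct)
    case one
    then show ?case using sc subgroup.one_closed[OF sub] by simp
  next
    case (incl h)
    then show ?case using conj s by simp
  next
    case (inv h)
    have "s \<otimes> inv h \<otimes> inv s = inv (s \<otimes> h \<otimes> inv s)" using inv H sc by (auto simp: word_simps)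
    then show ?case using subgroup.m_inv_closed[OF sub conj[OF s inv]] by simp
  next
    case (eng x y)
    have "x \<in> carrier G" "y \<in> carrier G" using eng H generate_in_carrier by auto
    then have "s \<otimes> (x \<otimes> y) \<otimes> inv s = (s \<otimes> x \<otimes> inv s) \<otimes> (s \<otimes> y \<otimes> inv s)"
      using sc by (simp add: word_simps)
    then show ?case using eng subgroup.m_closed[OF sub] by simp
  qed
qed

end

lemma equalizer_is_subgroup:
  assumes "group_hom G H f" "group_hom G H g"
  shows "subgroup {x \<in> carrier G. f x = g x} G"
proof -
  interpret f: group_hom G H f by fact
  interpret g: group_hom G H g by fact
  show ?thesis by (rule f.G.subgroupI) auto
qed

context group_hom
begin

lemma hom_commutator:
  "x \<in> carrier G \<Longrightarrow> y \<in> carrier G \<Longrightarrow> h (commutator G x y) = commutator H (h x) (h y)"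
  by (simp add: commutator_def)

lemma hom_comm_subgroup:
  assumes "X \<subseteq> carrier G" "Y \<subseteq> carrier G"
  shows "h ` comm_subgroup G X Y = comm_subgroup H (h ` X) (h ` Y)"
proof -
  have "{commutator H x y |x y. x \<in> h ` X \<and> y \<in> h ` Y} = h ` {commutator G x y |x y. x \<in> X \<and> y \<in> Y}"
  proof (intro equalityI subsetI)
    fix c assume "c \<in> {commutator H x y |x y. x \<in> h ` X \<and> y \<in> h ` Y}"
    then obtain x y where "c = commutator H (h x) (h y)" "x \<in> X" "y \<in> Y" by auto
    moreover from this have "c = h (commutator G x y)"
      using assms by (subst hom_commutator) auto
    ultimately show "c \<in> h ` {commutator G x y |x y. x \<in> X \<and> y \<in> Y}"
      by (intro image_eqI[of c h "commutator G x y"]) auto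
  next
    fix c assume "c \<in> h ` {commutator G x y |x y. x \<in> X \<and> y \<in> Y}"
    then obtain x y where "c = h (commutator G x y)" "x \<in> X" "y \<in> Y" by auto
    moreover from this have "c = commutator H (h x) (h y)"
      using assms by (subst hom_commutator[symmetric]) auto
    ultimately show "c \<in> {commutator H x y |x y. x \<in> h ` X \<and> y \<in> h ` Y}" by blast
  qed
  then show ?thesis
    unfolding comm_subgroup_def using assms by (subst generate_img[symmetric]) (blast intro: G.commutator_closed, simp)
qed

lemma hom_comm_subgroups:
  assumes "X \<subseteq> carrier G" "\<And>Y. Y \<in> set Ys \<Longrightarrow> Y \<subseteq> carrier G"
  shows "h ` comm_subgroups G X Ys = comm_subgroups H (h ` X) (map (image h) Ys)"
  using assms(2)
proof (induction Ys rule: rev_induct)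
  case (snoc Y Ys)
  then show ?case
    using hom_comm_subgroup[OF G.comm_subgroups_closed[OF assms(1)], of Ys Y] by simp
qed simp

lemma normal_preimage:
  assumes "N \<lhd> H"
  shows "{x \<in> carrier G. h x \<in> N} \<lhd> G"
proof -
  interpret N: normal N H by fact
  have "subgroup {x \<in> carrier G. h x \<in> N} G" by (rule G.subgroupI) auto
  then show ?thesis by (auto simp: G.normal_inv_iff N.inv_op_closed2)
qed

end

context group
begin

text \<open>This translates memberships of commutators in \<open>N\<close> into statements about commuting elements of
  \<open>G/N\<close>, where centralisers are at hand.\<close>

lemma commutator_in_normal_iff:
  assumes N: "N \<lhd> G" and xy: "x \<in> carrier G" "y \<in> carrier G"
  shows "commutator G x y \<in> N \<longleftrightarrow>
    (N #> x) \<otimes>\<^bsub>G Mod N\<^esub> (N #> y) = (N #> y) \<otimes>\<^bsub>G Mod N\<^esub> (N #> x)"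
proof -
  interpret q: group_hom G "G Mod N" "\<lambda>x. N #> x" by (rule quotient_hom) fact
  have "commutator G x y \<in> N \<longleftrightarrow> N #> commutator G x y = \<one>\<^bsub>G Mod N\<^esub>"
    using assms by (simp add: rcoset_eq_self_iff one_FactGroup)
  also have "\<dots> \<longleftrightarrow> commutator (G Mod N) (N #> x) (N #> y) = \<one>\<^bsub>G Mod N\<^esub>"
    using q.hom_commutator xy by simp
  also have "\<dots> \<longleftrightarrow> (N #> x) \<otimes>\<^bsub>G Mod N\<^esub> (N #> y) = (N #> y) \<otimes>\<^bsub>G Mod N\<^esub> (N #> x)"
    using xy by (intro q.H.commutator_eq_one_iff q.hom_closed)
  finally show ?thesis .
qed

lemma commutator_swap_in_normal:
  assumes "N \<lhd> G" "x \<in> carrier G" "y \<in> carrier G" "commutator G x y \<in> N"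
  shows "commutator G y x \<in> N"
  using assms by (simp add: commutator_in_normal_iff)

lemma subgroup_centralizer_mod:
  assumes N: "N \<lhd> G" and x: "x \<in> carrier G"
  shows "subgroup {g \<in> carrier G. commutator G x g \<in> N} G"
proof -
  interpret q: group_hom G "G Mod N" "\<lambda>x. N #> x" by (rule quotient_hom) fact
  let ?C = "{g \<in> carrier G. (N #> x) \<otimes>\<^bsub>G Mod N\<^esub> (N #> g) = (N #> g) \<otimes>\<^bsub>G Mod N\<^esub> (N #> x)}"
  have eq: "{g \<in> carrier G. commutator G x g \<in> N} = ?C"
    using commutator_in_normal_iff[OF N x] by auto
  have xc: "N #> x \<in> carrier (G Mod N)" using x by (rule q.hom_closed)
  show ?thesis
    unfolding eq
  proof (rule subgroupI)
    show "?C \<noteq> {}"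
      using x by blast
  next
    fix g assume "g \<in> ?C"
    then show "inv g \<in> ?C"
      using q.H.commute_inv[OF xc q.hom_closed, of g] by auto
  next
    fix g h assume "g \<in> ?C"
      "h \<in> ?C"
    then show "g \<otimes> h \<in> ?C"
      using q.H.commute_mult[OF xc q.hom_closed q.hom_closed, of g h] by auto
  qed auto
qed

text \<open>This set is the preimage of the centre of \<open>G/N\<close>.\<close>

lemma normal_center_mod:
  assumes N: "N \<lhd> G"
  shows "{x \<in> carrier G. \<forall>g\<in>carrier G. commutator G x g \<in> N} \<lhd> G"
proof -
  have eq: "{x \<in> carrier G. \<forall>g\<in>carrier G. commutator G x g \<in> N}
    = (\<Inter>g\<in>carrier G. {x \<in> carrier G. commutator G g x \<in> N})" (is "?Z = ?I")
  proof (intro equalityI subsetI)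
    fix x assume "x \<in> ?I"
    moreover from this have "x \<in> carrier G" using one_closed by blast
    ultimately show "x \<in> ?Z" using commutator_swap_in_normal[OF N] by auto
  qed (auto intro: commutator_swap_in_normal[OF N])
  have sub: "subgroup ?Z G"
    unfolding eq using N by (intro subgroups_Inter) (auto intro: subgroup_centralizer_mod)
  have "g \<otimes> x \<otimes> inv g \<in> ?Z" if x: "x \<in> ?Z" and g: "g \<in> carrier G" for g x
  proof -
    interpret N: normal N G by fact
    have "g \<otimes> x \<otimes> inv g = x \<otimes> commutator G x (inv g)"
      using x g by (simp add: commutator_def word_simps)
    moreover have "commutator G x (inv g) \<in> N" using x g by simp
    moreover have "N \<subseteq> ?Z"
    proof
      fix n assume n: "n \<in> N"
      have "inv n \<otimes> (inv h \<otimes> n \<otimes> h) \<in> N" if "h \<in> carrier G" for h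
        by (rule N.m_closed[OF N.m_inv_closed[OF n] N.inv_op_closed1[OF that n]])
      then show "n \<in> ?Z" using n N.mem_carrier by (auto simp: commutator_def m_assoc)
    qed
    ultimately show ?thesis using subgroup.m_closed[OF sub x] by auto
  qed
  then show ?thesis using sub by (auto simp: normal_inv_iff)
qed

lemma normal_closure_normal:
  assumes "X \<subseteq> carrier G"
  shows "normal_closure G X \<lhd> G"
proof -
  have "carrier G \<in> {N. N \<lhd> G \<and> X \<subseteq> N}" using assms normal_self by simp
  then have "subgroup (normal_closure G X) G"
    unfolding normal_closure_def by (intro subgroups_Inter) (auto dest: normal_imp_subgroup)
  then show ?thesis by (auto simp: normal_inv_iff normal_closure_def)
qed

lemma normal_closure_least: "N \<lhd> G \<Longrightarrow> X \<subseteq> N \<Longrightarrow> normal_closure G X \<subseteq> N"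
  by (auto simp: normal_closure_def)

lemma subset_normal_closure: "X \<subseteq> normal_closure G X"
  by (auto simp: normal_closure_def)

lemma generate_Union_normal:
  assumes "\<And>N. N \<in> \<N> \<Longrightarrow> N \<lhd> G"
  shows "generate G (\<Union>\<N>) \<lhd> G"
proof (rule normal_generateI)
  show "\<Union>\<N> \<subseteq> carrier G" using assms by (meson Sup_least normal_imp_subgroup subgroup.subset)
  show "g \<otimes> h \<otimes> inv g \<in> \<Union>\<N>" if "h \<in> \<Union>\<N>" "g \<in> carrier G" for h g
    using that assms normal.inv_op_closed2 by fastforce
qed

end

section \<open>The series \<open>[T, \<^sub>n G]\<close>\<close>

text \<open>The subgroup \<open>[T, \<^sub>n G]\<close>, in the comments also \<open>T\<^sub>n\<close>.  The choice \<open>T = G\<close> gives \<open>\<gamma>\<^bsub>n+1\<^esub>(G)\<close>, so that one set of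
  lemmas serves for numerator and denominator of the Baer invariant.\<close>

definition rel_lcs :: "('a, 'm) monoid_scheme \<Rightarrow> 'a set \<Rightarrow> nat \<Rightarrow> 'a set" where
  "rel_lcs G T n = comm_subgroups G T (replicate n (carrier G))"

lemma rel_lcs_0 [simp]: "rel_lcs G T 0 = T"
  by (simp add: rel_lcs_def)

lemma rel_lcs_Suc: "rel_lcs G T (Suc n) = comm_subgroup G (rel_lcs G T n) (carrier G)"
  by (simp only: rel_lcs_def replicate_Suc replicate_append_same[symmetric] comm_subgroups_snoc)

lemma lower_central_eq_rel_lcs: "lower_central G (n + 1) = rel_lcs G (carrier G) n"
  by (induction n) (simp_all add: rel_lcs_Suc)

context group
begin

lemma rel_lcs_normal:
  assumes "T \<lhd> G"
  shows "rel_lcs G T n \<lhd> G"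
proof (induction n)
  case (Suc n)
  interpret N: normal "rel_lcs G T n" G by fact
  show ?case
    unfolding rel_lcs_Suc comm_subgroup_def
  proof (rule normal_generateI)
    fix h g assume "h \<in> {commutator G x y |x y. x \<in> rel_lcs G T n \<and> y \<in> carrier G}" and g: "g \<in> carrier G"
    then obtain x y where xy: "h = commutator G x y" "x \<in> rel_lcs G T n" "y \<in> carrier G" by blast
    have "g \<otimes> h \<otimes> inv g = commutator G (g \<otimes> x \<otimes> inv g) (g \<otimes> y \<otimes> inv g)"
      unfolding xy(1) using xy(2,3) g by (simp add: commutator_def word_simps)
    then show "g \<otimes> h \<otimes> inv g \<in> {commutator G x y |x y. x \<in> rel_lcs G T n \<and> y \<in> carrier G}"
      using xy(2,3) g N.inv_op_closed2 by blast
  qed auto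
qed (simp add: assms)

lemma rel_lcs_mem: "T \<lhd> G \<Longrightarrow> x \<in> rel_lcs G T n \<Longrightarrow> x \<in> carrier G"
  using rel_lcs_normal[of T n] by (meson normal_imp_subgroup subgroup.mem_carrier)

lemma commutator_in_rel_lcs:
  "x \<in> rel_lcs G T n \<Longrightarrow> g \<in> carrier G \<Longrightarrow> commutator G x g \<in> rel_lcs G T (Suc n)"
  by (simp add: rel_lcs_Suc commutator_in_comm_subgroup)

lemma rel_lcs_Suc_subset:
  assumes "T \<lhd> G"
  shows "rel_lcs G T (Suc n) \<subseteq> rel_lcs G T n"
proof -
  interpret N: normal "rel_lcs G T n" G by (rule rel_lcs_normal) fact
  have "inv x \<otimes> (inv y \<otimes> x \<otimes> y) \<in> rel_lcs G T n" if "x \<in> rel_lcs G T n" "y \<in> carrier G" for x y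
    using N.m_closed[OF N.m_inv_closed[OF that(1)] N.inv_op_closed1[OF that(2,1)]] .
  then show ?thesis
    unfolding rel_lcs_Suc by (intro comm_subgroup_least N.is_subgroup) (simp add: commutator_def m_assoc)
qed

lemma rel_lcs_antimono:
  assumes "T \<lhd> G" "m \<le> n"
  shows "rel_lcs G T n \<subseteq> rel_lcs G T m"
  using assms(2) by (induction rule: dec_induct) (use rel_lcs_Suc_subset[OF assms(1)] in blast)+

lemma rel_lcs_mono:
  assumes "T \<subseteq> T'" "T' \<subseteq> carrier G"
  shows "rel_lcs G T n \<subseteq> rel_lcs G T' n"
  unfolding rel_lcs_def using assms by (intro comm_subgroups_mono_replicate) auto

lemma rel_lcs_subset: "T \<lhd> G \<Longrightarrow> rel_lcs G T n \<subseteq> T"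
  using rel_lcs_antimono[of T 0 n] by simp

text \<open>Write \<open>t\<^sup>y = t a\<close> and \<open>t\<^sup>g = t b\<close>.  As \<open>a\<close> commutes with \<open>g\<close>, and \<open>b\<close> with \<open>y\<close>,
  conjugation by \<open>y g\<close> takes \<open>t\<close> to \<open>t b a\<close> and conjugation by \<open>g y\<close> takes it to \<open>t a b\<close>, which is the same
  because \<open>a\<close> and \<open>b\<close> commute; so \<open>t\<close> commutes with \<open>y g (g y)\<inverse> = [y\<inverse>, g\<inverse>]\<close>.\<close>

lemma commute_commutator_if:
  assumes c: "t \<in> carrier G" "y \<in> carrier G" "g \<in> carrier G"
    and comm: "commutator G t y \<otimes> g = g \<otimes> commutator G t y"
      "commutator G t y \<otimes> commutator G t g = commutator G t g \<otimes> commutator G t y"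
      "commutator G t g \<otimes> y = y \<otimes> commutator G t g"
  shows "t \<otimes> commutator G (inv y) (inv g) = commutator G (inv y) (inv g) \<otimes> t"
proof -
  define a where "a = commutator G t y"
  define b where "b = commutator G t g"
  have ac: "a \<in> carrier G" and bc: "b \<in> carrier G" using c by (simp_all add: a_def b_def)
  have ag: "a \<otimes> g = g \<otimes> a" and ab: "a \<otimes> b = b \<otimes> a" and yb: "b \<otimes> y = y \<otimes> b"
    using comm by (simp_all only: a_def b_def)
  have ty: "t \<otimes> y = y \<otimes> (t \<otimes> a)" and tg: "t \<otimes> g = g \<otimes> (t \<otimes> b)"
    using c by (simp_all add: a_def b_def commutator_def word_simps)
  define w where "w = t \<otimes> (b \<otimes> a)"
  have wc: "w \<in> carrier G" using c ac bc by (simp add: w_def)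
  have "t \<otimes> (y \<otimes> g) = y \<otimes> (t \<otimes> (a \<otimes> g))" using c ac ty by (simp flip: m_assoc)
  also have "\<dots> = y \<otimes> ((t \<otimes> g) \<otimes> a)" using c ac by (simp add: ag m_assoc)
  also have "\<dots> = (y \<otimes> g) \<otimes> w" using c ac bc by (simp add: tg w_def m_assoc)
  finally have yg: "t \<otimes> (y \<otimes> g) = (y \<otimes> g) \<otimes> w" .
  have "t \<otimes> (g \<otimes> y) = g \<otimes> (t \<otimes> (b \<otimes> y))" using c bc tg by (simp flip: m_assoc)
  also have "\<dots> = g \<otimes> ((t \<otimes> y) \<otimes> b)" using c bc by (simp add: yb m_assoc)
  also have "\<dots> = (g \<otimes> y) \<otimes> (t \<otimes> (a \<otimes> b))" using c ac bc by (simp add: ty m_assoc)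
  also have "\<dots> = (g \<otimes> y) \<otimes> w" by (simp only: ab w_def)
  finally have gy: "t \<otimes> (g \<otimes> y) = (g \<otimes> y) \<otimes> w" .
  have k: "commutator G (inv y) (inv g) = (y \<otimes> g) \<otimes> inv (g \<otimes> y)"
    using c by (simp add: commutator_def word_simps)
  have "t \<otimes> ((y \<otimes> g) \<otimes> inv (g \<otimes> y)) = (t \<otimes> (y \<otimes> g)) \<otimes> inv (g \<otimes> y)"
    using c by (simp add: m_assoc)
  also have "\<dots> = (y \<otimes> g) \<otimes> w \<otimes> inv (g \<otimes> y)" by (simp only: yg)
  also have "w = inv (g \<otimes> y) \<otimes> (t \<otimes> (g \<otimes> y))"
    unfolding gy using c wc by (intro inv_cancel_left(1)[symmetric]) auto
  also have "(y \<otimes> g) \<otimes> (inv (g \<otimes> y) \<otimes> (t \<otimes> (g \<otimes> y))) \<otimes> inv (g \<otimes> y) = (y \<otimes> g) \<otimes> inv (g \<otimes> y) \<otimes> t"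
    using c by (simp add: word_simps)
  finally show ?thesis by (simp only: k)
qed

text \<open>Let \<open>t \<in> T\<^sub>m\<close> and \<open>y \<in> \<gamma>\<^bsub>n+1\<^esub>(G)\<close>.  Inductively \<open>[t, y] \<in> T\<^bsub>m+n+1\<^esub>\<close> and \<open>[t, g] \<in> T\<^bsub>m+1\<^esub>\<close>, so modulo
  \<open>T\<^bsub>m+n+2\<^esub>\<close> the first is central and the second commutes with \<open>y\<close>.  By the preceding lemma \<open>t\<close> then
  commutes with \<open>[y\<inverse>, g\<inverse>]\<close>, and these elements range over all generators of \<open>\<gamma>\<^bsub>n+2\<^esub>(G)\<close>.\<close>

lemma commutator_rel_lcs_lower_central:
  assumes T: "T \<lhd> G"
  shows "t \<in> rel_lcs G T m \<Longrightarrow> x \<in> rel_lcs G (carrier G) n \<Longrightarrow> commutator G t x \<in> rel_lcs G T (Suc (m + n))"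
proof (induction n arbitrary: m t x)
  case 0
  then show ?case by (simp add: commutator_in_rel_lcs)
next
  case (Suc n)
  define N where "N = rel_lcs G T (Suc (m + Suc n))"
  have N: "N \<lhd> G" unfolding N_def by (rule rel_lcs_normal) fact
  interpret q: group_hom G "G Mod N" "\<lambda>x. N #> x" by (rule quotient_hom) fact
  have tc: "t \<in> carrier G" using Suc.prems(1) T rel_lcs_mem by blast
  have inverses: "commutator G t (commutator G (inv y) (inv g)) \<in> N"
    if y: "y \<in> rel_lcs G (carrier G) n" and g: "g \<in> carrier G" for y g
  proof -
    have yc: "y \<in> carrier G" using y normal_self rel_lcs_mem by blast
    define a where "a = commutator G t y"
    define b where "b = commutator G t g"
    have ac: "a \<in> carrier G" and bc: "b \<in> carrier G" using tc yc g by (auto simp: a_def b_def)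
    have a: "a \<in> rel_lcs G T (Suc (m + n))" unfolding a_def using Suc.IH Suc.prems(1) y by blast
    have b: "b \<in> rel_lcs G T (Suc m)" unfolding b_def using Suc.prems(1) g by (rule commutator_in_rel_lcs)
    have "commutator G a g \<in> N" "commutator G a b \<in> N"
      unfolding N_def using commutator_in_rel_lcs[OF a] g bc by auto
    moreover have "commutator G b y \<in> N"
      unfolding N_def using Suc.IH[OF b y] by simp
    ultimately have "(N #> t) \<otimes>\<^bsub>G Mod N\<^esub> commutator (G Mod N) (inv\<^bsub>G Mod N\<^esub> (N #> y)) (inv\<^bsub>G Mod N\<^esub> (N #> g))
       = commutator (G Mod N) (inv\<^bsub>G Mod N\<^esub> (N #> y)) (inv\<^bsub>G Mod N\<^esub> (N #> g)) \<otimes>\<^bsub>G Mod N\<^esub> (N #> t)"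
      unfolding commutator_in_normal_iff[OF N ac g] commutator_in_normal_iff[OF N ac bc]
        commutator_in_normal_iff[OF N bc yc]
      unfolding a_def b_def q.hom_commutator[OF tc yc] q.hom_commutator[OF tc g]
      using tc yc g by (intro q.H.commute_commutator_if q.hom_closed)
    then show ?thesis
      unfolding commutator_in_normal_iff[OF N tc commutator_closed[OF inv_closed[OF yc] inv_closed[OF g]]]
        q.hom_commutator[OF inv_closed[OF yc] inv_closed[OF g]] q.hom_inv[OF yc] q.hom_inv[OF g] .
  qed
  have "commutator G t (commutator G y g) \<in> N"
    if y: "y \<in> rel_lcs G (carrier G) n" and g: "g \<in> carrier G" for y g
  proof -
    interpret L: normal "rel_lcs G (carrier G) n" G by (rule rel_lcs_normal[OF normal_self])
    show ?thesis
      using inverses[OF L.m_inv_closed[OF y] inv_closed[OF g]] y g by simp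
  qed
  then have "rel_lcs G (carrier G) (Suc n) \<subseteq> {x \<in> carrier G. commutator G t x \<in> N}"
    unfolding rel_lcs_Suc using rel_lcs_mem[OF normal_self]
    by (intro comm_subgroup_least subgroup_centralizer_mod[OF N tc]) auto
  then show ?case using Suc.prems(2) by (auto simp: N_def)
qed

text \<open>Write \<open>x' = x t\<close> and \<open>y' = s y\<close> with \<open>t \<in> T\<^sub>n\<close> and \<open>s \<in> T\<close>.  Modulo \<open>T\<^bsub>n+1\<^esub>\<close> the element \<open>t\<close> is central, and \<open>s\<close>
  commutes with \<open>x\<close> because \<open>[T, \<gamma>\<^bsub>n+1\<^esub>(G)] \<le> T\<^bsub>n+1\<^esub>\<close>; so \<open>[x', y'] = [x, y]\<close> there.\<close>

lemma commutator_cong_rel_lcs: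
  assumes T: "T \<lhd> G" and x: "x \<in> rel_lcs G (carrier G) n" and y: "y \<in> carrier G"
    and x': "x' \<in> carrier G" "rel_lcs G T n #> x' = rel_lcs G T n #> x"
    and y': "y' \<in> carrier G" "T #> y' = T #> y"
  shows "rel_lcs G T (Suc n) #> commutator G x' y' = rel_lcs G T (Suc n) #> commutator G x y"
proof -
  define N where "N = rel_lcs G T (Suc n)"
  have N: "N \<lhd> G" unfolding N_def by (rule rel_lcs_normal) fact
  interpret q: group_hom G "G Mod N" "\<lambda>x. N #> x" by (rule quotient_hom) fact
  have xc: "x \<in> carrier G" using x normal_self rel_lcs_mem by blast
  define t where "t = inv x \<otimes> x'"
  define s where "s = y' \<otimes> inv y"
  have tc: "t \<in> carrier G" and sc: "s \<in> carrier G" using xc x' y y' by (auto simp: t_def s_def)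
  have t: "t \<in> rel_lcs G T n"
    using inv_mult_in_normal_iff[OF rel_lcs_normal[OF T] xc x'(1)] x'(2) by (auto simp: t_def)
  have s: "s \<in> T" using rcoset_eq_iff[OF T y'(1) y] y'(2) by (auto simp: s_def)
  have eqs: "x' = x \<otimes> t" "y' = s \<otimes> y" using xc x' y y' by (simp_all add: t_def s_def m_assoc)
  have tcomm: "(N #> t) \<otimes>\<^bsub>G Mod N\<^esub> (N #> g) = (N #> g) \<otimes>\<^bsub>G Mod N\<^esub> (N #> t)" if "g \<in> carrier G" for g
    using commutator_in_rel_lcs[OF t that] commutator_in_normal_iff[OF N tc that] by (simp add: N_def)
  have scomm: "(N #> s) \<otimes>\<^bsub>G Mod N\<^esub> (N #> x) = (N #> x) \<otimes>\<^bsub>G Mod N\<^esub> (N #> s)"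
    using commutator_rel_lcs_lower_central[OF T, of s 0 x n] s x
      commutator_in_normal_iff[OF N sc xc] by (simp add: N_def)
  have 1: "commutator H (x \<otimes>\<^bsub>H\<^esub> t) w = commutator H x w"
    if "group H" "x \<in> carrier H" "t \<in> carrier H" "w \<in> carrier H" "t \<otimes>\<^bsub>H\<^esub> x = x \<otimes>\<^bsub>H\<^esub> t" "t \<otimes>\<^bsub>H\<^esub> w = w \<otimes>\<^bsub>H\<^esub> t"
    for H :: "('c, 'd) monoid_scheme" and x t w
  proof -
    interpret H: group H by fact
    have "commutator H (x \<otimes>\<^bsub>H\<^esub> t) w = inv\<^bsub>H\<^esub> t \<otimes>\<^bsub>H\<^esub> (inv\<^bsub>H\<^esub> x \<otimes>\<^bsub>H\<^esub> inv\<^bsub>H\<^esub> w \<otimes>\<^bsub>H\<^esub> x \<otimes>\<^bsub>H\<^esub> (t \<otimes>\<^bsub>H\<^esub> w))"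
      using that by (simp add: commutator_def H.word_simps)
    also have "\<dots> = inv\<^bsub>H\<^esub> t \<otimes>\<^bsub>H\<^esub> (commutator H x w \<otimes>\<^bsub>H\<^esub> t)"
      using that by (simp add: commutator_def H.word_simps)
    also have "commutator H x w \<otimes>\<^bsub>H\<^esub> t = t \<otimes>\<^bsub>H\<^esub> commutator H x w"
      using that by (simp add: H.commute_commutator)
    also have "inv\<^bsub>H\<^esub> t \<otimes>\<^bsub>H\<^esub> (t \<otimes>\<^bsub>H\<^esub> commutator H x w) = commutator H x w"
      using that by simp
    finally show ?thesis .
  qed
  have 2: "commutator H x (s \<otimes>\<^bsub>H\<^esub> y) = commutator H x y"
    if "group H" "x \<in> carrier H" "s \<in> carrier H" "y \<in> carrier H" "s \<otimes>\<^bsub>H\<^esub> x = x \<otimes>\<^bsub>H\<^esub> s"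
    for H :: "('c, 'd) monoid_scheme" and x s y
  proof -
    interpret H: group H by fact
    have "commutator H x (s \<otimes>\<^bsub>H\<^esub> y) = inv\<^bsub>H\<^esub> x \<otimes>\<^bsub>H\<^esub> inv\<^bsub>H\<^esub> y \<otimes>\<^bsub>H\<^esub> inv\<^bsub>H\<^esub> s \<otimes>\<^bsub>H\<^esub> (x \<otimes>\<^bsub>H\<^esub> s) \<otimes>\<^bsub>H\<^esub> y"
      using that by (simp add: commutator_def H.word_simps)
    also have "x \<otimes>\<^bsub>H\<^esub> s = s \<otimes>\<^bsub>H\<^esub> x" using that by simp
    also have "inv\<^bsub>H\<^esub> x \<otimes>\<^bsub>H\<^esub> inv\<^bsub>H\<^esub> y \<otimes>\<^bsub>H\<^esub> inv\<^bsub>H\<^esub> s \<otimes>\<^bsub>H\<^esub> (s \<otimes>\<^bsub>H\<^esub> x) \<otimes>\<^bsub>H\<^esub> y = commutator H x y"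
      using that(1-4) by (simp add: commutator_def H.word_simps)
    finally show ?thesis .
  qed
  have "N #> commutator G x' y'
      = commutator (G Mod N) ((N #> x) \<otimes>\<^bsub>G Mod N\<^esub> (N #> t)) (N #> (s \<otimes> y))"
    using xc tc sc y unfolding eqs by (simp only: q.hom_commutator q.hom_mult m_closed)
  also have "\<dots> = commutator (G Mod N) (N #> x) (N #> (s \<otimes> y))"
    using xc tc sc y by (intro 1 q.H.is_group q.hom_closed tcomm m_closed)
  also have "\<dots> = commutator (G Mod N) (N #> x) (N #> y)"
    unfolding q.hom_mult[OF sc y]
    using xc sc y by (intro 2 q.H.is_group q.hom_closed scomm)
  also have "\<dots> = N #> commutator G x y" using xc y by (simp only: q.hom_commutator)
  finally show ?thesis unfolding N_def .
qed

end

text \<open>The subgroup on which two homomorphisms agree modulo \<open>[T, \<^bsub>n+1\<^esub> Q]\<close> contains the generators \<open>[y, p]\<close>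
  of \<open>\<gamma>\<^bsub>n+2\<^esub>(P)\<close> by the preceding lemma.  This is why the map induced on Baer invariants does not
  depend on the chosen lift of a homomorphism.\<close>

lemma hom_cong_rel_lcs:
  assumes f: "group_hom P Q f" and g: "group_hom P Q g" and T: "T \<lhd> Q"
    and fg: "\<And>p. p \<in> carrier P \<Longrightarrow> T #>\<^bsub>Q\<^esub> f p = T #>\<^bsub>Q\<^esub> g p"
  shows "x \<in> rel_lcs P (carrier P) n \<Longrightarrow> rel_lcs Q T n #>\<^bsub>Q\<^esub> f x = rel_lcs Q T n #>\<^bsub>Q\<^esub> g x"
proof (induction n arbitrary: x)
  case 0
  then show ?case unfolding rel_lcs_0 by (rule fg)
next
  case (Suc n)
  interpret f: group_hom P Q f by fact
  interpret g: group_hom P Q g by fact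
  define N where "N = rel_lcs Q T (Suc n)"
  have N: "N \<lhd> Q" unfolding N_def by (rule f.H.rel_lcs_normal) fact
  interpret q: group_hom Q "Q Mod N" "\<lambda>x. N #>\<^bsub>Q\<^esub> x" by (rule f.H.quotient_hom) fact
  have "subgroup {x \<in> carrier P. (\<lambda>x. N #>\<^bsub>Q\<^esub> f x) x = (\<lambda>x. N #>\<^bsub>Q\<^esub> g x) x} P"
    by (rule equalizer_is_subgroup[where H = "Q Mod N"]; unfold_locales; rule homI;
        simp only: f.hom_mult g.hom_mult f.hom_closed g.hom_closed q.hom_mult q.hom_closed)
  moreover have "commutator P y p \<in> {x \<in> carrier P. N #>\<^bsub>Q\<^esub> f x = N #>\<^bsub>Q\<^esub> g x}"
    if "y \<in> rel_lcs P (carrier P) n" "p \<in> carrier P" for y p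
  proof -
    have yc: "y \<in> carrier P" using that(1) f.G.normal_self f.G.rel_lcs_mem by blast
    have "g y \<in> rel_lcs Q (carrier Q) n"
    proof -
      have "g ` rel_lcs P (carrier P) n = comm_subgroups Q (g ` carrier P) (map (image g) (replicate n (carrier P)))"
        unfolding rel_lcs_def by (rule g.hom_comm_subgroups) auto
      also have "\<dots> \<subseteq> rel_lcs Q (carrier Q) n"
        unfolding rel_lcs_def unfolding map_replicate by (rule f.H.comm_subgroups_mono_replicate) auto
      finally show ?thesis using that(1) by auto
    qed
    then have "N #>\<^bsub>Q\<^esub> commutator Q (f y) (f p) = N #>\<^bsub>Q\<^esub> commutator Q (g y) (g p)"
      unfolding N_def
      by (rule f.H.commutator_cong_rel_lcs[OF T _ g.hom_closed[OF that(2)] f.hom_closed[OF yc] Suc.IH[OF that(1)]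
            f.hom_closed[OF that(2)] fg[OF that(2)]])
    then show ?thesis using yc that(2) f.hom_commutator g.hom_commutator by simp
  qed
  ultimately have "rel_lcs P (carrier P) (Suc n) \<subseteq> {x \<in> carrier P. N #>\<^bsub>Q\<^esub> f x = N #>\<^bsub>Q\<^esub> g x}"
    unfolding rel_lcs_Suc by (intro f.G.comm_subgroup_least) auto
  then show ?case using Suc.prems unfolding N_def by blast
qed

lemma (in group_hom) hom_rel_lcs:
  assumes "T \<subseteq> carrier G" "h ` T \<subseteq> T'" "T' \<subseteq> carrier H" "x \<in> rel_lcs G T n"
  shows "h x \<in> rel_lcs H T' n"
proof -
  have "h ` rel_lcs G T n = comm_subgroups H (h ` T) (map (image h) (replicate n (carrier G)))"
    unfolding rel_lcs_def using assms by (intro hom_comm_subgroups) auto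
  also have "\<dots> \<subseteq> rel_lcs H T' n"
    unfolding rel_lcs_def unfolding map_replicate using assms by (intro H.comm_subgroups_mono_replicate) auto
  finally show ?thesis using assms(4) by auto
qed

text \<open>In a generator \<open>[y, k]\<close> of \<open>\<gamma>\<^bsub>n+2\<^esub>(H)\<close>, both entries may be replaced by images under \<open>h\<close>, at the expense of
  a factor in \<open>[T, \<^bsub>n+1\<^esub> H]\<close>.  Hence \<open>\<gamma>\<^bsub>n+1\<^esub>(H) = h(\<gamma>\<^bsub>n+1\<^esub>(G)) [T, \<^sub>n H]\<close> whenever \<open>H = h(G) T\<close>.\<close>

lemma (in group_hom) lower_central_lift:
  assumes T: "T \<lhd> H" and surj: "\<And>y. y \<in> carrier H \<Longrightarrow> \<exists>x\<in>carrier G. T #>\<^bsub>H\<^esub> y = T #>\<^bsub>H\<^esub> h x"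
  shows "y \<in> rel_lcs H (carrier H) n \<Longrightarrow>
    \<exists>x\<in>rel_lcs G (carrier G) n. rel_lcs H T n #>\<^bsub>H\<^esub> y = rel_lcs H T n #>\<^bsub>H\<^esub> h x"
proof (induction n arbitrary: y)
  case 0
  then show ?case unfolding rel_lcs_0 by (rule surj)
next
  case (Suc n)
  define N where "N = rel_lcs H T (Suc n)"
  have N: "N \<lhd> H" unfolding N_def by (rule H.rel_lcs_normal) fact
  interpret q: group_hom H "H Mod N" "\<lambda>x. N #>\<^bsub>H\<^esub> x" by (rule H.quotient_hom) fact
  define L where "L = rel_lcs G (carrier G) (Suc n)"
  interpret L: normal L G unfolding L_def by (intro G.rel_lcs_normal G.normal_self)
  define S where "S = {y \<in> carrier H. \<exists>x\<in>L. N #>\<^bsub>H\<^esub> y = N #>\<^bsub>H\<^esub> h x}"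
  have "subgroup S H"
  proof (rule H.subgroupI)
    have "N #>\<^bsub>H\<^esub> \<one>\<^bsub>H\<^esub> = N #>\<^bsub>H\<^esub> h \<one>\<^bsub>G\<^esub>" by simp
    then show "S \<noteq> {}" using L.one_closed H.one_closed unfolding S_def by blast
  next
    fix y assume "y \<in> S"
    then obtain x where x: "y \<in> carrier H" "x \<in> L" "N #>\<^bsub>H\<^esub> y = N #>\<^bsub>H\<^esub> h x" by (auto simp: S_def)
    then have "N #>\<^bsub>H\<^esub> (inv\<^bsub>H\<^esub> y) = N #>\<^bsub>H\<^esub> h (inv\<^bsub>G\<^esub> x)"
      by (simp only: q.hom_inv hom_inv L.mem_carrier hom_closed)
    then show "inv\<^bsub>H\<^esub> y \<in> S" using x L.m_inv_closed H.inv_closed unfolding S_def by blast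
  next
    fix y z assume "y \<in> S" "z \<in> S"
    then obtain x w where x: "y \<in> carrier H" "x \<in> L" "N #>\<^bsub>H\<^esub> y = N #>\<^bsub>H\<^esub> h x"
      "z \<in> carrier H" "w \<in> L" "N #>\<^bsub>H\<^esub> z = N #>\<^bsub>H\<^esub> h w" by (auto simp: S_def)
    then have "N #>\<^bsub>H\<^esub> (y \<otimes>\<^bsub>H\<^esub> z) = N #>\<^bsub>H\<^esub> h (x \<otimes>\<^bsub>G\<^esub> w)"
      by (simp only: q.hom_mult hom_mult L.mem_carrier hom_closed)
    then show "y \<otimes>\<^bsub>H\<^esub> z \<in> S" using x L.m_closed H.m_closed unfolding S_def by blast
  qed (auto simp: S_def)
  moreover have "commutator H y k \<in> S" if y: "y \<in> rel_lcs H (carrier H) n" and k: "k \<in> carrier H" for y k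
  proof -
    have yc: "y \<in> carrier H" using y H.normal_self H.rel_lcs_mem by blast
    obtain x where x: "x \<in> rel_lcs G (carrier G) n" "rel_lcs H T n #>\<^bsub>H\<^esub> y = rel_lcs H T n #>\<^bsub>H\<^esub> h x"
      using Suc.IH[OF y] by blast
    have xc: "x \<in> carrier G" using x(1) G.normal_self G.rel_lcs_mem by blast
    obtain p where p: "p \<in> carrier G" "T #>\<^bsub>H\<^esub> k = T #>\<^bsub>H\<^esub> h p" using surj k by blast
    have "h x \<in> rel_lcs H (carrier H) n" using x(1) by (rule hom_rel_lcs[rotated -1]) auto
    then have "N #>\<^bsub>H\<^esub> commutator H y k = N #>\<^bsub>H\<^esub> commutator H (h x) (h p)"
      unfolding N_def
      by (rule H.commutator_cong_rel_lcs[OF T _ hom_closed[OF p(1)] yc x(2) k p(2)])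
    also have "\<dots> = N #>\<^bsub>H\<^esub> h (commutator G x p)" using xc p(1) by (simp only: hom_commutator)
    finally have "N #>\<^bsub>H\<^esub> commutator H y k = N #>\<^bsub>H\<^esub> h (commutator G x p)" .
    moreover have "commutator G x p \<in> L" unfolding L_def using x(1) p(1) by (rule G.commutator_in_rel_lcs)
    ultimately show ?thesis using H.commutator_closed[OF yc k] unfolding S_def by blast
  qed
  ultimately have "rel_lcs H (carrier H) (Suc n) \<subseteq> S"
    unfolding rel_lcs_Suc by (intro H.comm_subgroup_least) auto
  then show ?case using Suc.prems unfolding S_def L_def N_def by blast
qed

section \<open>Subquotients and Baer invariants\<close>

lemma group_homI: "group G \<Longrightarrow> group H \<Longrightarrow> f \<in> hom G H \<Longrightarrow> group_hom G H f"
  by (simp add: group_hom_def group_hom_axioms_def)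

lemma trivial_hom: "group G \<Longrightarrow> group H \<Longrightarrow> group_hom G H (\<lambda>_. \<one>\<^bsub>H\<^esub>)"
  by (intro group_homI homI) (auto simp: group.is_monoid monoid.one_closed monoid.l_one)

context group
begin

text \<open>Both the Baer invariants and \<open>E\<^sub>c/D\<^sub>c\<close> have the form \<open>M/L\<close> with \<open>L\<close> normal in the whole group.\<close>

context
  fixes M L
  assumes M: "subgroup M G" and L: "L \<lhd> G" and LM: "L \<subseteq> M"
begin

lemma normal_in_subquotient: "L \<lhd> G\<lparr>carrier := M\<rparr>"
  using normal_restrict_supergroup[OF M L LM] .

lemma group_subquotient: "group ((G\<lparr>carrier := M\<rparr>) Mod L)"
  using normal_in_subquotient by (rule normal.factorgroup_is_group)

lemma carrier_subquotient: "carrier ((G\<lparr>carrier := M\<rparr>) Mod L) = (\<lambda>x. L #> x) ` M"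
  by (simp add: carrier_FactGroup r_coset_def)

lemma subquotient_hom: "(\<lambda>x. L #> x) \<in> hom (G\<lparr>carrier := M\<rparr>) ((G\<lparr>carrier := M\<rparr>) Mod L)"
  using normal.r_coset_hom_Mod[OF normal_in_subquotient] by (simp add: r_coset_def)

lemma mult_subquotient:
  assumes "x \<in> M" "y \<in> M"
  shows "(L #> x) \<otimes>\<^bsub>(G\<lparr>carrier := M\<rparr>) Mod L\<^esub> (L #> y) = L #> (x \<otimes> y)"
  using hom_mult[OF subquotient_hom, of x y] assms by simp

lemma one_subquotient: "\<one>\<^bsub>(G\<lparr>carrier := M\<rparr>) Mod L\<^esub> = L"
  by (rule one_FactGroup)

lemma subquotient_lift:
  assumes H: "group H" and f: "f \<in> hom (G\<lparr>carrier := M\<rparr>) H" and ker: "\<And>x. x \<in> L \<Longrightarrow> f x = \<one>\<^bsub>H\<^esub>"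
  shows "\<exists>h \<in> hom ((G\<lparr>carrier := M\<rparr>) Mod L) H. \<forall>x\<in>M. h (L #> x) = f x"
proof -
  interpret f: group_hom "G\<lparr>carrier := M\<rparr>" H f
    by (rule group_homI[OF subgroup_imp_group[OF M] H f])
  have "L \<subseteq> kernel (G\<lparr>carrier := M\<rparr>) H f" using ker LM by (auto simp: kernel_def)
  from f.FactGroup_universal_kernel[OF normal_in_subquotient this] obtain h where
    "h \<in> hom ((G\<lparr>carrier := M\<rparr>) Mod L) H" "\<And>x. x \<in> M \<Longrightarrow> h (L #> x) = f x"
    by (auto simp: r_coset_def)
  then show ?thesis by blast
qed

end

context
  fixes R assumes R: "R \<lhd> G"
begin

lemma baer_numerator: "subgroup (R \<inter> rel_lcs G (carrier G) c) G"
  using R rel_lcs_normal[OF normal_self] by (intro subgroups_Inter_pair normal_imp_subgroup)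

lemma baer_denominator: "rel_lcs G R c \<subseteq> R \<inter> rel_lcs G (carrier G) c"
  using rel_lcs_subset[OF R] rel_lcs_mono[of R "carrier G"] subgroup.subset[OF normal_imp_subgroup[OF R]]
  by simp

lemma nilpotent_baer_eq:
  "nilpotent_baer c G R = (G\<lparr>carrier := R \<inter> rel_lcs G (carrier G) c\<rparr>) Mod rel_lcs G R c"
  by (simp add: nilpotent_baer_def lower_central_eq_rel_lcs[simplified] rel_lcs_def)

lemmas baer_subquotient = baer_numerator rel_lcs_normal[OF R] baer_denominator

lemma group_baer: "group (nilpotent_baer c G R)"
  unfolding nilpotent_baer_eq by (rule group_subquotient[OF baer_subquotient])

lemma carrier_baer:
  "carrier (nilpotent_baer c G R) = (\<lambda>x. rel_lcs G R c #> x) ` (R \<inter> rel_lcs G (carrier G) c)"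
  unfolding nilpotent_baer_eq by (rule carrier_subquotient[OF baer_subquotient])

text \<open>\<open>[R, \<gamma>\<^bsub>c+1\<^esub>(G)] \<le> [R, \<^bsub>c+1\<^esub> G]\<close>, so elements of \<open>R\<close> and of \<open>\<gamma>\<^bsub>c+1\<^esub>(G)\<close> commute modulo \<open>[R, \<^sub>c G]\<close>.\<close>

lemma baer_commute:
  assumes x: "x \<in> R" and y: "y \<in> rel_lcs G (carrier G) c"
  shows "rel_lcs G R c #> (x \<otimes> y) = rel_lcs G R c #> (y \<otimes> x)"
proof -
  have xc: "x \<in> carrier G" using x R by (meson normal_imp_subgroup subgroup.mem_carrier)
  have yc: "y \<in> carrier G" using y normal_self rel_lcs_mem by blast
  have L: "rel_lcs G R c \<lhd> G" by (rule rel_lcs_normal[OF R])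
  interpret q: group_hom G "G Mod rel_lcs G R c" "\<lambda>x. rel_lcs G R c #> x" by (rule quotient_hom[OF L])
  have "commutator G x y \<in> rel_lcs G R (Suc (0 + c))"
    using x y by (intro commutator_rel_lcs_lower_central[OF R]) simp_all
  then have "commutator G x y \<in> rel_lcs G R c"
    using rel_lcs_antimono[OF R, of c "Suc (0 + c)"] by auto
  then show ?thesis
    unfolding commutator_in_normal_iff[OF L xc yc] q.hom_mult[OF xc yc] q.hom_mult[OF yc xc] .
qed

lemma comm_group_baer: "comm_group (nilpotent_baer c G R)"
proof (rule group.group_comm_groupI[OF group_baer])
  fix X Y assume "X \<in> carrier (nilpotent_baer c G R)" "Y \<in> carrier (nilpotent_baer c G R)"
  then obtain x y where xy: "X = rel_lcs G R c #> x" "x \<in> R \<inter> rel_lcs G (carrier G) c"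
     "Y = rel_lcs G R c #> y" "y \<in> R \<inter> rel_lcs G (carrier G) c"
    unfolding carrier_baer by blast
  show "X \<otimes>\<^bsub>nilpotent_baer c G R\<^esub> Y = Y \<otimes>\<^bsub>nilpotent_baer c G R\<^esub> X"
    unfolding xy(1,3) nilpotent_baer_eq
      mult_subquotient[OF baer_subquotient xy(2,4)] mult_subquotient[OF baer_subquotient xy(4,2)]
    using xy by (intro baer_commute) auto
qed

end

end

text \<open>The Baer invariant is functorial in pairs of a group and a normal subgroup; besides the free
  presentations the pair of \<open>F * B\<close> and the normal closure of \<open>R\<close> will serve as a target.\<close>

lemma (in group_hom) baer_map:
  assumes R: "R \<lhd> G" and T: "T \<lhd> H" and RT: "h ` R \<subseteq> T"
  shows "\<exists>f \<in> hom (nilpotent_baer c G R) (nilpotent_baer c H T).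
    \<forall>x\<in>R \<inter> rel_lcs G (carrier G) c. f (rel_lcs G R c #> x) = rel_lcs H T c #>\<^bsub>H\<^esub> h x"
proof -
  note sG = G.baer_subquotient[OF R] and sH = H.baer_subquotient[OF T]
  let ?M = "R \<inter> rel_lcs G (carrier G) c"
  have Rc: "R \<subseteq> carrier G" and Tc: "T \<subseteq> carrier H"
    using R T by (meson normal_imp_subgroup subgroup.subset)+
  have h: "h x \<in> T \<inter> rel_lcs H (carrier H) c" if "x \<in> ?M" for x
  proof -
    have "h ` carrier G \<subseteq> carrier H" by auto
    then show ?thesis using that RT hom_rel_lcs[of "carrier G" "carrier H" x c] by auto
  qed
  have "(\<lambda>x. rel_lcs H T c #>\<^bsub>H\<^esub> h x) \<in> hom (G\<lparr>carrier := ?M\<rparr>) (nilpotent_baer c H T)"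
  proof (rule homI)
    fix x assume "x \<in> carrier (G\<lparr>carrier := ?M\<rparr>)"
    then show "rel_lcs H T c #>\<^bsub>H\<^esub> h x \<in> carrier (nilpotent_baer c H T)"
      unfolding H.carrier_baer[OF T] using h by auto
  next
    fix x y assume "x \<in> carrier (G\<lparr>carrier := ?M\<rparr>)"
      "y \<in> carrier (G\<lparr>carrier := ?M\<rparr>)"
    then have xy: "x \<in> ?M" "y \<in> ?M" by simp_all
    then have xyc: "x \<in> carrier G" "y \<in> carrier G" using Rc by auto
    show "rel_lcs H T c #>\<^bsub>H\<^esub> h (x \<otimes>\<^bsub>G\<lparr>carrier := ?M\<rparr>\<^esub> y)
       = (rel_lcs H T c #>\<^bsub>H\<^esub> h x) \<otimes>\<^bsub>nilpotent_baer c H T\<^esub> (rel_lcs H T c #>\<^bsub>H\<^esub> h y)"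
      unfolding H.nilpotent_baer_eq[OF T] H.mult_subquotient[OF sH h[OF xy(1)] h[OF xy(2)]]
      using xyc by simp
  qed
  moreover have "rel_lcs H T c #>\<^bsub>H\<^esub> h x = \<one>\<^bsub>nilpotent_baer c H T\<^esub>" if x: "x \<in> rel_lcs G R c" for x
  proof -
    have "h x \<in> rel_lcs H T c" using hom_rel_lcs[OF Rc RT Tc x] .
    then show ?thesis
      unfolding H.nilpotent_baer_eq[OF T] H.one_subquotient[OF sH]
      using H.rcoset_eq_self_iff[OF H.rel_lcs_normal[OF T]] H.rel_lcs_mem[OF T] by blast
  qed
  ultimately show ?thesis
    unfolding G.nilpotent_baer_eq[OF R]
    by (rule G.subquotient_lift[OF sG H.group_baer[OF T]])
qed

section \<open>Free groups, free products and free wreath products\<close>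

lemma carrier_word_monoid_generate:
  assumes "group (word_monoid L S)"
  shows "carrier (word_monoid L S) = generate (word_monoid L S) ((\<lambda>x. word_class L S [x]) ` L)"
proof -
  interpret group "word_monoid L S" by fact
  have letters: "(\<lambda>x. word_class L S [x]) ` L \<subseteq> carrier (word_monoid L S)"
    by (auto simp: carrier_word_monoid)
  have "word_class L S w \<in> generate (word_monoid L S) ((\<lambda>x. word_class L S [x]) ` L)" if "w \<in> lists L" for w
    using that
  proof (induction w)
    case Nil
    then show ?case using generate.one by (metis one_word_monoid)
  next
    case (Cons x w)
    have "word_class L S (x # w) = word_class L S [x] \<otimes>\<^bsub>word_monoid L S\<^esub> word_class L S w"
      using Cons.hyps by (simp add: mult_word_class)
    then show ?case using Cons.hyps(1) Cons.IH by (auto intro: generate.eng generate.incl)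
  qed
  then show ?thesis
    using generate_incl[OF letters] by (auto simp: carrier_word_monoid)
qed

lemma hom_eq_on_generators:
  assumes "group_hom G H f" "group_hom G H g" "carrier G \<subseteq> generate G S"
    and "\<And>s. s \<in> S \<Longrightarrow> s \<in> carrier G" "\<And>s. s \<in> S \<Longrightarrow> f s = g s" "x \<in> carrier G"
  shows "f x = g x"
proof -
  interpret f: group_hom G H f by fact
  have "generate G S \<subseteq> {x \<in> carrier G. f x = g x}"
    by (rule f.G.generate_subgroup_incl[OF _ equalizer_is_subgroup[OF assms(1,2)]]) (use assms(4,5) in blast)
  then show ?thesis using assms(3,6) by blast
qed

text \<open>Free groups are projective: send each basis element to a preimage of its image, and its inverse
  letter to the inverse of that preimage.\<close>

lemma free_group_lift:
  fixes F :: "('f, 'm) monoid_scheme"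
  assumes "is_free F" and p: "group_hom Q G p" "p ` carrier Q = carrier G" and f: "group_hom F G f"
  shows "\<exists>u. group_hom F Q u \<and> (\<forall>x\<in>carrier F. p (u x) = f x)"
proof -
  interpret p: group_hom Q G p by fact
  interpret f: group_hom F G f by fact
  obtain X :: "'f set" and \<theta> where \<theta>: "\<theta> \<in> iso (free_group X) F" using assms(1) by (auto simp: is_free_def is_iso_def)
  interpret X: group "free_group X" by (rule group_free_group)
  interpret \<theta>: group_hom "free_group X" F \<theta> using \<theta> by (intro group_homI X.is_group f.G.is_group) (simp add: iso_def)
  define L where "L = X \<times> (UNIV :: bool set)"
  define S :: "(('f \<times> bool) list \<times> ('f \<times> bool) list) set"
    where "S = {([(x, b), (x, \<not> b)], []) |x b. x \<in> X}"
  have FX: "free_group X = word_monoid L S" by (simp add: free_group_def L_def S_def)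
  have letter: "word_class L S [(x, b)] \<in> carrier (free_group X)" if "x \<in> X" for x b
    using that by (auto simp: FX carrier_word_monoid L_def)
  have "\<exists>q\<in>carrier Q. p q = f (\<theta> (word_class L S [(x, True)]))" if "x \<in> X" for x
    using p(2) f.hom_closed[OF \<theta>.hom_closed[OF letter[OF that]], of True] by (metis imageE)
  then obtain q where q: "\<And>x. x \<in> X \<Longrightarrow> q x \<in> carrier Q"
    "\<And>x. x \<in> X \<Longrightarrow> p (q x) = f (\<theta> (word_class L S [(x, True)]))" by metis
  define e where "e = (\<lambda>(x, b). if b then q x else inv\<^bsub>Q\<^esub> q x)"
  have "\<exists>h\<in>hom (word_monoid L S) Q. \<forall>x\<in>L. h (word_class L S [x]) = e x"
  proof (rule word_monoid_lift)
    show "group Q" by (rule p.G.is_group)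
    show "e x \<in> carrier Q" if "x \<in> L" for x using that q(1) by (auto simp: e_def L_def)
  next
    fix u v assume "(u, v) \<in> S"
    then obtain x b where "u = [(x, b), (x, \<not> b)]" "v = []" "x \<in> X" by (auto simp: S_def)
    then show "foldr (\<lambda>x y. e x \<otimes>\<^bsub>Q\<^esub> y) u \<one>\<^bsub>Q\<^esub> = foldr (\<lambda>x y. e x \<otimes>\<^bsub>Q\<^esub> y) v \<one>\<^bsub>Q\<^esub>"
      using q(1)[of x] by (simp add: e_def)
  qed
  then obtain u where u: "u \<in> hom (free_group X) Q" "\<And>l. l \<in> L \<Longrightarrow> u (word_class L S [l]) = e l"
    unfolding FX by blast
  interpret u: group_hom "free_group X" Q u by (rule group_homI[OF X.is_group p.G.is_group u(1)])
  have pu: "p (u x) = f (\<theta> x)" if "x \<in> carrier (free_group X)" for x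
  proof (rule hom_eq_on_generators[of _ G "\<lambda>x. p (u x)" "\<lambda>x. f (\<theta> x)" "(\<lambda>x. word_class L S [x]) ` L"])
    show "group_hom (free_group X) G (\<lambda>x. p (u x))" "group_hom (free_group X) G (\<lambda>x. f (\<theta> x))"
      by (intro group_homI X.is_group p.H.is_group; rule homI; simp)+
    show "carrier (free_group X) \<subseteq> generate (free_group X) ((\<lambda>x. word_class L S [x]) ` L)"
      using carrier_word_monoid_generate[of L S] X.is_group by (simp add: FX)
    show "s \<in> carrier (free_group X)" if "s \<in> (\<lambda>x. word_class L S [x]) ` L" for s
      using that letter by (auto simp: L_def)
    show "p (u s) = f (\<theta> s)" if "s \<in> (\<lambda>x. word_class L S [x]) ` L" for s
    proof -
      from that obtain x b where s: "s = word_class L S [(x, b)]" "x \<in> X" by (auto simp: L_def)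
      have L: "(x, b) \<in> L" using s by (simp add: L_def)
      show ?thesis
      proof (cases b)
        case True
        then show ?thesis using s q(2) u(2)[OF L] by (simp add: e_def)
      next
        case False
        have "word_class L S [(x, False)] \<otimes>\<^bsub>free_group X\<^esub> word_class L S [(x, True)] = \<one>\<^bsub>free_group X\<^esub>"
        proof -
          have "word_class L S [(x, False), (x, True)] = word_class L S []"
            by (rule word_class_rel) (use s(2) in \<open>auto simp: L_def S_def\<close>)
          moreover have "[(x, False)] \<in> lists L" "[(x, True)] \<in> lists L" using s(2) by (auto simp: L_def)
          ultimately show ?thesis unfolding FX one_word_monoid by (simp add: mult_word_class)
        qed
        then have "s = inv\<^bsub>free_group X\<^esub> word_class L S [(x, True)]"
          using X.inv_equality[OF _ letter[OF s(2)] letter[OF s(2)]] s False by simp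
        then have "f (\<theta> s) = inv\<^bsub>G\<^esub> f (\<theta> (word_class L S [(x, True)]))"
          using letter[OF s(2), of True] by (simp only: \<theta>.hom_inv f.hom_inv \<theta>.hom_closed)
        moreover have "p (u s) = inv\<^bsub>G\<^esub> p (q x)"
          using u(2)[OF L] False s q(1)[OF s(2)] by (simp add: e_def)
        ultimately show ?thesis using q(2)[OF s(2)] by simp
      qed
    qed
  qed fact
  define \<theta>' where "\<theta>' = inv_into (carrier (free_group X)) \<theta>"
  have \<theta>': "\<theta>' \<in> iso F (free_group X)" unfolding \<theta>'_def by (rule X.iso_set_sym[OF \<theta>])
  then have \<theta>'h: "\<theta>' \<in> hom F (free_group X)" by (simp add: iso_def)
  interpret \<theta>': group_hom F "free_group X" \<theta>' by (rule group_homI[OF f.G.is_group X.is_group \<theta>'h])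
  have inv: "\<theta> (\<theta>' x) = x" if "x \<in> carrier F" for x
    unfolding \<theta>'_def using \<theta> that by (intro f_inv_into_f) (auto simp: iso_def bij_betw_def)
  have "group_hom F Q (\<lambda>x. u (\<theta>' x))"
    by (intro group_homI f.G.is_group p.G.is_group; rule homI; simp)
  moreover have "p (u (\<theta>' x)) = f x" if "x \<in> carrier F" for x
    using pu[OF \<theta>'.hom_closed[OF that]] inv[OF that] by simp
  ultimately show ?thesis by blast
qed

text \<open>A presentation \<open>F \<rightarrow> G\<close> with kernel \<open>R\<close>, given by the projection instead of an isomorphism
  \<open>G \<cong> F/R\<close>.  It is also used for the presentation of the wreath product by \<open>F * B\<close>.\<close>

definition projection_with_kernel ::
    "('f, 'm) monoid_scheme \<Rightarrow> ('a, 'n) monoid_scheme \<Rightarrow> ('f \<Rightarrow> 'a) \<Rightarrow> 'f set \<Rightarrow> bool" where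
  "projection_with_kernel F G p R \<longleftrightarrow> group_hom F G p \<and> p ` carrier F = carrier G \<and> kernel F G p = R"

lemma free_presentation_projection:
  assumes "free_presentation F R G" "group G"
  shows "\<exists>p. projection_with_kernel F G p R"
proof -
  have R: "R \<lhd> F" and F: "group F" using assms(1) by (auto simp: free_presentation_def is_free_def)
  interpret F: group F by fact
  obtain \<theta> where \<theta>: "\<theta> \<in> iso G (F Mod R)" using assms(1) by (auto simp: free_presentation_def is_iso_def)
  define \<theta>' where "\<theta>' = inv_into (carrier G) \<theta>"
  have \<theta>': "\<theta>' \<in> iso (F Mod R) G" unfolding \<theta>'_def by (rule group.iso_set_sym[OF assms(2) \<theta>])
  interpret q: group_hom F "F Mod R" "\<lambda>x. R #>\<^bsub>F\<^esub> x" by (rule F.quotient_hom[OF R])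
  have "\<theta>' \<in> hom (F Mod R) G" using \<theta>' by (simp add: iso_def)
  from group_homI[OF q.H.is_group assms(2) this] interpret \<theta>': group_hom "F Mod R" G \<theta>' .
  define p where "p = (\<lambda>x. \<theta>' (R #>\<^bsub>F\<^esub> x))"
  have bij: "inj_on \<theta>' (carrier (F Mod R))" "\<theta>' ` carrier (F Mod R) = carrier G"
    using \<theta>' by (auto simp: iso_def bij_betw_def)
  have "group_hom F G p" unfolding p_def by (intro group_homI F assms(2); rule homI; simp)
  moreover have "p ` carrier F = carrier G"
    unfolding p_def bij(2)[symmetric] carrier_FactGroup by (simp add: image_image)
  moreover have "kernel F G p = R"
  proof -
    have "p x = \<one>\<^bsub>G\<^esub> \<longleftrightarrow> x \<in> R" if x: "x \<in> carrier F" for x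
    proof -
      have "p x = \<one>\<^bsub>G\<^esub> \<longleftrightarrow> \<theta>' (R #>\<^bsub>F\<^esub> x) = \<theta>' \<one>\<^bsub>F Mod R\<^esub>" by (simp add: p_def)
      also have "\<dots> \<longleftrightarrow> R #>\<^bsub>F\<^esub> x = \<one>\<^bsub>F Mod R\<^esub>"
        using inj_on_eq_iff[OF bij(1)] q.hom_closed[OF x] q.H.one_closed by blast
      also have "\<dots> \<longleftrightarrow> x \<in> R" unfolding one_FactGroup by (rule F.rcoset_eq_self_iff[OF R x])
      finally show ?thesis .
    qed
    moreover have "R \<subseteq> carrier F" using R by (meson normal_imp_subgroup subgroup.subset)
    ultimately show ?thesis by (auto simp: kernel_def)
  qed
  ultimately show ?thesis unfolding projection_with_kernel_def by blast
qed

context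
  fixes A :: "('a, 'm) monoid_scheme" and B :: "('b, 'n) monoid_scheme"
  assumes A: "group A" and B: "group B"
begin

interpretation A: group A by (rule A)
interpretation B: group B by (rule B)

lemma free_inr_hom: "free_inr A B \<in> hom B (free_prod2 A B)"
proof (rule homI)
  fix x assume "x \<in> carrier B"
  then show "free_inr A B x \<in> carrier (free_prod2 A B)"
    by (auto simp: free_inr_def free_prod2_def carrier_word_monoid free_prod2_letters_def)
next
  fix x y assume xy: "x \<in> carrier B" "y \<in> carrier B"
  have "word_class (free_prod2_letters A B) (free_prod2_rels A B) [Inr x, Inr y]
      = word_class (free_prod2_letters A B) (free_prod2_rels A B) [Inr (x \<otimes>\<^bsub>B\<^esub> y)]"
    by (rule word_class_rel) (use xy in \<open>auto simp: free_prod2_letters_def free_prod2_rels_def\<close>)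
  moreover have "[Inr x] \<in> lists (free_prod2_letters A B)" "[Inr y] \<in> lists (free_prod2_letters A B)"
    using xy by (auto simp: free_prod2_letters_def)
  ultimately show "free_inr A B (x \<otimes>\<^bsub>B\<^esub> y) = free_inr A B x \<otimes>\<^bsub>free_prod2 A B\<^esub> free_inr A B y"
    by (simp add: free_inr_def free_prod2_def mult_word_class)
qed

lemma carrier_free_prod2_generate:
  "carrier (free_prod2 A B) =
     generate (free_prod2 A B) (free_inl A B ` carrier A \<union> free_inr A B ` carrier B)"
proof -
  have "(\<lambda>x. word_class (free_prod2_letters A B) (free_prod2_rels A B) [x]) ` free_prod2_letters A B
      = free_inl A B ` carrier A \<union> free_inr A B ` carrier B"
    by (simp add: free_prod2_letters_def Plus_def image_Un image_image free_inl_def free_inr_def)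
  then show ?thesis
    using carrier_word_monoid_generate group_free_prod2[OF A B] unfolding free_prod2_def by metis
qed

lemma free_prod2_lift:
  assumes "group_hom A X \<alpha>" "group_hom B X \<beta>"
  shows "\<exists>\<phi>. group_hom (free_prod2 A B) X \<phi> \<and> (\<forall>x\<in>carrier A. \<phi> (free_inl A B x) = \<alpha> x)
      \<and> (\<forall>y\<in>carrier B. \<phi> (free_inr A B y) = \<beta> y)"
proof -
  interpret \<alpha>: group_hom A X \<alpha> by fact
  interpret \<beta>: group_hom B X \<beta> by fact
  let ?L = "free_prod2_letters A B" and ?S = "free_prod2_rels A B"
  define e where "e = case_sum \<alpha> \<beta>"
  have "\<exists>h\<in>hom (word_monoid ?L ?S) X. \<forall>x\<in>?L. h (word_class ?L ?S [x]) = e x"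
    by (rule word_monoid_lift) (auto simp: e_def free_prod2_letters_def free_prod2_rels_def \<alpha>.H.m_assoc)
  then obtain \<phi> where \<phi>: "\<phi> \<in> hom (free_prod2 A B) X" "\<And>x. x \<in> ?L \<Longrightarrow> \<phi> (word_class ?L ?S [x]) = e x"
    unfolding free_prod2_def by blast
  have "\<phi> (free_inl A B x) = \<alpha> x" if "x \<in> carrier A" for x
    using \<phi>(2)[of "Inl x"] that by (auto simp: e_def free_prod2_letters_def free_inl_def)
  moreover have "\<phi> (free_inr A B y) = \<beta> y" if "y \<in> carrier B" for y
    using \<phi>(2)[of "Inr y"] that by (auto simp: e_def free_prod2_letters_def free_inr_def)
  ultimately show ?thesis
    using group_homI[OF group_free_prod2[OF A B] \<alpha>.H.is_group \<phi>(1)] by blast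
qed

text \<open>The group \<open>A\<close> is embedded as its copy with index \<open>1\<close>; the other copies are conjugates of it by
  elements of \<open>B\<close>.\<close>

definition wreath_inl :: "'a \<Rightarrow> 'b \<times> ('b \<times> 'a) list set" where
  "wreath_inl a = (\<one>\<^bsub>B\<^esub>, free_product_in (carrier B) (\<lambda>_. A) \<one>\<^bsub>B\<^esub> a)"

definition wreath_inr :: "'b \<Rightarrow> 'b \<times> ('b \<times> 'a) list set" where
  "wreath_inr b = (b, \<one>\<^bsub>wreath_base A B\<^esub>)"

private abbreviation "WL \<equiv> free_product_letters (carrier B) (\<lambda>_. A)"
private abbreviation "WS \<equiv> free_product_rels (carrier B) (\<lambda>_. A)"

lemma wreath_letters: "WL = carrier B \<times> carrier A"
  by (auto simp: free_product_letters_def)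

lemma carrier_wreath_base: "carrier (wreath_base A B) = word_class WL WS ` lists WL"
  by (simp add: wreath_base_def free_product_def carrier_word_monoid)

lemma mult_wreath_base:
  "u \<in> lists WL \<Longrightarrow> v \<in> lists WL \<Longrightarrow>
    word_class WL WS u \<otimes>\<^bsub>wreath_base A B\<^esub> word_class WL WS v = word_class WL WS (u @ v)"
  by (simp only: wreath_base_def free_product_def mult_word_class)

lemma one_wreath_base: "\<one>\<^bsub>wreath_base A B\<^esub> = word_class WL WS []"
  by (simp add: wreath_base_def free_product_def one_word_monoid)

lemma wreath_act_word:
  "b \<in> carrier B \<Longrightarrow> w \<in> lists WL \<Longrightarrow>
    wreath_act B b (word_class WL WS w) = word_class WL WS (map (\<lambda>(b', a). (b' \<otimes>\<^bsub>B\<^esub> b, a)) w)"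
  using wreath_act_class[OF A B] wreath_letters by simp

lemma wreath_act_word_one:
  assumes "w \<in> lists WL"
  shows "wreath_act B \<one>\<^bsub>B\<^esub> (word_class WL WS w) = word_class WL WS w"
proof -
  have "map (\<lambda>(b', a). (b' \<otimes>\<^bsub>B\<^esub> \<one>\<^bsub>B\<^esub>, a)) w = w"
    using assms by (intro map_idI) (auto simp: wreath_letters)
  then show ?thesis using wreath_act_word[OF B.one_closed assms] by simp
qed

lemma mult_wreath_words:
  assumes "b \<in> carrier B" "u \<in> lists WL" "v \<in> lists WL"
  shows "(b, word_class WL WS u) \<otimes>\<^bsub>free_wreath A B\<^esub> (\<one>\<^bsub>B\<^esub>, word_class WL WS v) = (b, word_class WL WS (u @ v))"
  using assms by (simp add: free_wreath_def wreath_act_word_one mult_wreath_base)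

lemma free_wreath_cases:
  assumes "x \<in> carrier (free_wreath A B)"
  obtains b w where "x = (b, word_class WL WS w)" "b \<in> carrier B" "w \<in> lists WL"
proof -
  obtain b y where "x = (b, y)" "b \<in> carrier B" "y \<in> carrier (wreath_base A B)"
    using assms by (auto simp: free_wreath_def)
  then show ?thesis using that unfolding carrier_wreath_base by blast
qed

lemma wreath_inr_hom: "wreath_inr \<in> hom B (free_wreath A B)"
proof (rule homI)
  fix x assume "x \<in> carrier B"
  then show "wreath_inr x \<in> carrier (free_wreath A B)"
    by (auto simp: wreath_inr_def free_wreath_def one_wreath_base carrier_wreath_base)
next
  fix x y assume "x \<in> carrier B" "y \<in> carrier B"
  then show "wreath_inr (x \<otimes>\<^bsub>B\<^esub> y) = wreath_inr x \<otimes>\<^bsub>free_wreath A B\<^esub> wreath_inr y"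
    by (simp add: wreath_inr_def free_wreath_def one_wreath_base wreath_act_word mult_wreath_base)
qed

lemma wreath_inl_hom: "wreath_inl \<in> hom A (free_wreath A B)"
proof (rule homI)
  fix x assume "x \<in> carrier A"
  then show "wreath_inl x \<in> carrier (free_wreath A B)"
    by (auto simp: wreath_inl_def free_wreath_def free_product_in_def carrier_wreath_base wreath_letters)
next
  fix x y assume xy: "x \<in> carrier A" "y \<in> carrier A"
  have "word_class WL WS [(\<one>\<^bsub>B\<^esub>, x), (\<one>\<^bsub>B\<^esub>, y)] = word_class WL WS [(\<one>\<^bsub>B\<^esub>, x \<otimes>\<^bsub>A\<^esub> y)]"
    by (rule word_class_rel) (use xy in \<open>auto simp: free_product_rels_def wreath_letters\<close>)
  then show "wreath_inl (x \<otimes>\<^bsub>A\<^esub> y) = wreath_inl x \<otimes>\<^bsub>free_wreath A B\<^esub> wreath_inl y"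
    using xy mult_wreath_words[of "\<one>\<^bsub>B\<^esub>" "[(\<one>\<^bsub>B\<^esub>, x)]" "[(\<one>\<^bsub>B\<^esub>, y)]"]
    by (simp add: wreath_inl_def free_product_in_def wreath_letters)
qed

lemma wreath_in_conj:
  assumes "a \<in> carrier A" "b \<in> carrier B"
  shows "(\<one>\<^bsub>B\<^esub>, word_class WL WS [(b, a)]) =
    inv\<^bsub>free_wreath A B\<^esub> wreath_inr b \<otimes>\<^bsub>free_wreath A B\<^esub> wreath_inl a \<otimes>\<^bsub>free_wreath A B\<^esub> wreath_inr b"
proof -
  interpret W: group "free_wreath A B" by (rule group_free_wreath[OF A B])
  have in_carrier: "(\<one>\<^bsub>B\<^esub>, word_class WL WS [(b, a)]) \<in> carrier (free_wreath A B)"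
    using assms by (simp add: free_wreath_def carrier_wreath_base wreath_letters)
  have c: "wreath_inl a \<in> carrier (free_wreath A B)" "wreath_inr b \<in> carrier (free_wreath A B)"
    using wreath_inl_hom wreath_inr_hom assms by (auto simp: hom_def)
  have "wreath_inl a \<otimes>\<^bsub>free_wreath A B\<^esub> wreath_inr b
      = wreath_inr b \<otimes>\<^bsub>free_wreath A B\<^esub> (\<one>\<^bsub>B\<^esub>, word_class WL WS [(b, a)])"
    using free_wreath_conj[OF A B B.one_closed assms(2,1)] assms
    by (simp add: wreath_inl_def wreath_inr_def free_product_in_def)
  then show ?thesis using c in_carrier by (simp add: W.m_assoc)
qed

lemma carrier_free_wreath_generate:
  "carrier (free_wreath A B) = generate (free_wreath A B) (wreath_inl ` carrier A \<union> wreath_inr ` carrier B)"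
  (is "_ = generate ?W ?S")
proof -
  interpret W: group ?W by (rule group_free_wreath[OF A B])
  have S: "?S \<subseteq> carrier ?W"
    using wreath_inl_hom wreath_inr_hom by (auto simp: hom_def)
  have sub: "subgroup (generate ?W ?S) ?W" by (rule W.generate_is_subgroup[OF S])
  have letter: "(\<one>\<^bsub>B\<^esub>, word_class WL WS [(b, a)]) \<in> generate ?W ?S" if "b \<in> carrier B" "a \<in> carrier A" for a b
    unfolding wreath_in_conj[OF that(2,1)]
    by (intro subgroup.m_closed[OF sub] subgroup.m_inv_closed[OF sub] generate.incl) (use that in blast)+
  have word: "(\<one>\<^bsub>B\<^esub>, word_class WL WS w) \<in> generate ?W ?S" if "w \<in> lists WL" for w
    using that
  proof (induction w)
    case Nil
    have "\<one>\<^bsub>?W\<^esub> = (\<one>\<^bsub>B\<^esub>, word_class WL WS [])" by (simp add: free_wreath_def one_wreath_base)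
    then show ?case using subgroup.one_closed[OF sub] by simp
  next
    case (Cons x w)
    obtain b a where x: "x = (b, a)" "b \<in> carrier B" "a \<in> carrier A" using Cons.hyps(1) by (auto simp: wreath_letters)
    have "(\<one>\<^bsub>B\<^esub>, word_class WL WS (x # w))
        = (\<one>\<^bsub>B\<^esub>, word_class WL WS [(b, a)]) \<otimes>\<^bsub>?W\<^esub> (\<one>\<^bsub>B\<^esub>, word_class WL WS w)"
      using Cons.hyps x by (simp add: mult_wreath_words)
    then show ?case using subgroup.m_closed[OF sub letter[OF x(2,3)] Cons.IH] by simp
  qed
  have "x \<in> generate ?W ?S" if "x \<in> carrier ?W" for x
  proof -
    obtain b w where x: "x = (b, word_class WL WS w)" "b \<in> carrier B" "w \<in> lists WL"
      by (rule free_wreath_cases[OF \<open>x \<in> carrier ?W\<close>])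
    have "x = wreath_inr b \<otimes>\<^bsub>?W\<^esub> (\<one>\<^bsub>B\<^esub>, word_class WL WS w)"
      using x by (simp add: wreath_inr_def one_wreath_base mult_wreath_words)
    moreover have "wreath_inr b \<in> generate ?W ?S" using x(2) by (intro generate.incl) blast
    ultimately show ?thesis using subgroup.m_closed[OF sub _ word[OF x(3)]] by simp
  qed
  then show ?thesis using W.generate_incl[OF S] by blast
qed

text \<open>The free wreath product has the universal property of the free product \<open>A * B\<close>: the letter
  \<open>a\<^sub>b\<close> is the conjugate \<open>b\<inverse> a b\<close>, so it has to go to \<open>\<beta>(b)\<inverse> \<alpha>(a) \<beta>(b)\<close>.\<close>

lemma free_wreath_lift:
  assumes "group_hom A X \<alpha>" "group_hom B X \<beta>"
  shows "\<exists>\<phi>. group_hom (free_wreath A B) X \<phi> \<and> (\<forall>x\<in>carrier A. \<phi> (wreath_inl x) = \<alpha> x)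
      \<and> (\<forall>y\<in>carrier B. \<phi> (wreath_inr y) = \<beta> y)"
proof -
  interpret \<alpha>: group_hom A X \<alpha> by fact
  interpret \<beta>: group_hom B X \<beta> by fact
  define e where "e = (\<lambda>(b, a). inv\<^bsub>X\<^esub> \<beta> b \<otimes>\<^bsub>X\<^esub> \<alpha> a \<otimes>\<^bsub>X\<^esub> \<beta> b)"
  have ec: "e x \<in> carrier X" if "x \<in> WL" for x using that by (auto simp: e_def wreath_letters)
  have "\<exists>h\<in>hom (word_monoid WL WS) X. \<forall>x\<in>WL. h (word_class WL WS [x]) = e x"
  proof (rule word_monoid_lift[OF \<alpha>.H.is_group ec])
    fix u v assume "(u, v) \<in> WS"
    then consider b x y where "u = [(b, x), (b, y)]" "v = [(b, x \<otimes>\<^bsub>A\<^esub> y)]" "b \<in> carrier B" "x \<in> carrier A" "y \<in> carrier A"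
      | b where "u = [(b, \<one>\<^bsub>A\<^esub>)]" "v = []" "b \<in> carrier B"
      by (auto simp: free_product_rels_def)
    then show "foldr (\<lambda>x y. e x \<otimes>\<^bsub>X\<^esub> y) u \<one>\<^bsub>X\<^esub> = foldr (\<lambda>x y. e x \<otimes>\<^bsub>X\<^esub> y) v \<one>\<^bsub>X\<^esub>"
      by cases (simp_all add: e_def \<alpha>.H.word_simps)
  qed
  then obtain \<theta> where \<theta>: "\<theta> \<in> hom (wreath_base A B) X" "\<And>x. x \<in> WL \<Longrightarrow> \<theta> (word_class WL WS [x]) = e x"
    unfolding wreath_base_def free_product_def by blast
  have C: "group (wreath_base A B)" unfolding wreath_base_def by (rule group_free_product) (rule A)
  interpret \<theta>: group_hom "wreath_base A B" X \<theta> by (rule group_homI[OF C \<alpha>.H.is_group \<theta>(1)])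
  have wc: "word_class WL WS w \<in> carrier (wreath_base A B)" if "w \<in> lists WL" for w
    using that by (simp add: carrier_wreath_base)
  have \<theta>_Cons: "\<theta> (word_class WL WS (x # w)) = e x \<otimes>\<^bsub>X\<^esub> \<theta> (word_class WL WS w)"
    if "x \<in> WL" "w \<in> lists WL" for x w
    using \<theta>.hom_mult[OF wc[of "[x]"] wc[OF that(2)]] that mult_wreath_base[of "[x]" w] \<theta>(2)[OF that(1)] by simp
  have equivariant: "\<theta> (word_class WL WS (map (\<lambda>(b', a). (b' \<otimes>\<^bsub>B\<^esub> b, a)) w))
      = inv\<^bsub>X\<^esub> \<beta> b \<otimes>\<^bsub>X\<^esub> \<theta> (word_class WL WS w) \<otimes>\<^bsub>X\<^esub> \<beta> b"
    if b: "b \<in> carrier B" and w: "w \<in> lists WL" for b w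
    using w
  proof (induction w)
    case Nil
    then show ?case using b by (simp flip: one_wreath_base)
  next
    case (Cons x w)
    obtain b' a where x: "x = (b', a)" "b' \<in> carrier B" "a \<in> carrier A"
      using Cons.hyps(1) by (auto simp: wreath_letters)
    have w': "map (\<lambda>(b', a). (b' \<otimes>\<^bsub>B\<^esub> b, a)) w \<in> lists WL"
      using Cons.hyps(2) b by (fastforce simp: wreath_letters)
    have "\<theta> (word_class WL WS (map (\<lambda>(b', a). (b' \<otimes>\<^bsub>B\<^esub> b, a)) (x # w)))
        = e (b' \<otimes>\<^bsub>B\<^esub> b, a) \<otimes>\<^bsub>X\<^esub> (inv\<^bsub>X\<^esub> \<beta> b \<otimes>\<^bsub>X\<^esub> \<theta> (word_class WL WS w) \<otimes>\<^bsub>X\<^esub> \<beta> b)"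
      using \<theta>_Cons[OF _ w', of "(b' \<otimes>\<^bsub>B\<^esub> b, a)"] Cons.IH x b by (simp add: wreath_letters)
    also have "\<dots> = inv\<^bsub>X\<^esub> \<beta> b \<otimes>\<^bsub>X\<^esub> (e (b', a) \<otimes>\<^bsub>X\<^esub> \<theta> (word_class WL WS w)) \<otimes>\<^bsub>X\<^esub> \<beta> b"
      using x b \<theta>.hom_closed[OF wc[OF Cons.hyps(2)]] by (simp add: e_def \<alpha>.H.word_simps)
    also have "e (b', a) \<otimes>\<^bsub>X\<^esub> \<theta> (word_class WL WS w) = \<theta> (word_class WL WS (x # w))"
      using \<theta>_Cons[OF Cons.hyps(1,2)] x(1) by simp
    finally show ?case .
  qed
  define \<phi> where "\<phi> = (\<lambda>(b, x). \<beta> b \<otimes>\<^bsub>X\<^esub> \<theta> x)"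
  have "\<phi> \<in> hom (free_wreath A B) X"
  proof (rule homI)
    fix x assume "x \<in> carrier (free_wreath A B)"
    then show "\<phi> x \<in> carrier X" by (auto simp: \<phi>_def free_wreath_def)
  next
    fix x y assume "x \<in> carrier (free_wreath A B)" "y \<in> carrier (free_wreath A B)"
    then obtain b u b' v where xy: "x = (b, word_class WL WS u)" "b \<in> carrier B" "u \<in> lists WL"
       "y = (b', word_class WL WS v)" "b' \<in> carrier B" "v \<in> lists WL"
      by (elim free_wreath_cases)
    have u': "map (\<lambda>(b, a). (b \<otimes>\<^bsub>B\<^esub> b', a)) u \<in> lists WL"
      using xy(3,5) by (fastforce simp: wreath_letters)
    have "\<phi> (x \<otimes>\<^bsub>free_wreath A B\<^esub> y) = \<beta> (b \<otimes>\<^bsub>B\<^esub> b') \<otimes>\<^bsub>X\<^esub>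
        \<theta> (word_class WL WS (map (\<lambda>(b, a). (b \<otimes>\<^bsub>B\<^esub> b', a)) u) \<otimes>\<^bsub>wreath_base A B\<^esub> word_class WL WS v)"
      using xy by (simp add: \<phi>_def free_wreath_def wreath_act_word)
    also have "\<dots> = \<beta> (b \<otimes>\<^bsub>B\<^esub> b') \<otimes>\<^bsub>X\<^esub>
        (inv\<^bsub>X\<^esub> \<beta> b' \<otimes>\<^bsub>X\<^esub> \<theta> (word_class WL WS u) \<otimes>\<^bsub>X\<^esub> \<beta> b' \<otimes>\<^bsub>X\<^esub> \<theta> (word_class WL WS v))"
      by (simp only: \<theta>.hom_mult[OF wc[OF u'] wc[OF xy(6)]] equivariant[OF xy(5,3)])
    also have "\<dots> = \<phi> x \<otimes>\<^bsub>X\<^esub> \<phi> y"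
      using xy(2,5) \<theta>.hom_closed[OF wc[OF xy(3)]] \<theta>.hom_closed[OF wc[OF xy(6)]]
      by (simp add: \<phi>_def xy(1,4) \<alpha>.H.word_simps)
    finally show "\<phi> (x \<otimes>\<^bsub>free_wreath A B\<^esub> y) = \<phi> x \<otimes>\<^bsub>X\<^esub> \<phi> y" .
  qed
  moreover have "\<phi> (wreath_inl x) = \<alpha> x" if "x \<in> carrier A" for x
    using \<theta>(2)[of "(\<one>\<^bsub>B\<^esub>, x)"] that by (simp add: \<phi>_def wreath_inl_def free_product_in_def wreath_letters e_def)
  moreover have "\<phi> (wreath_inr y) = \<beta> y" if "y \<in> carrier B" for y
    using that by (simp add: \<phi>_def wreath_inr_def)
  ultimately show ?thesis
    using group_homI[OF group_free_wreath[OF A B] \<alpha>.H.is_group] by blast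
qed

end

section \<open>Generation of normal subgroups\<close>

context group
begin

text \<open>The set in question is \<open>X N\<close>.  It is the full preimage of the image of \<open>X\<close> in \<open>G/N\<close>, and this image
  is what the generators have to normalise.\<close>

lemma normal_product:
  assumes X: "subgroup X G" and N: "N \<lhd> G"
    and S: "S \<subseteq> carrier G" "carrier G \<subseteq> generate G S" "\<And>s. s \<in> S \<Longrightarrow> inv s \<in> S"
    and conj: "\<And>s x. s \<in> S \<Longrightarrow> x \<in> X \<Longrightarrow> \<exists>x'\<in>X. N #> (s \<otimes> x \<otimes> inv s) = N #> x'"
  shows "{g \<in> carrier G. \<exists>x\<in>X. N #> g = N #> x} \<lhd> G"
proof -
  interpret q: group_hom G "G Mod N" "\<lambda>x. N #> x" by (rule quotient_hom[OF N])
  have Xc: "x \<in> carrier G" if "x \<in> X" for x using X that by (rule subgroup.mem_carrier)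
  let ?Z = "{g \<in> carrier G. \<exists>x\<in>X. N #> g = N #> x}"
  have sub: "subgroup ?Z G"
  proof (rule subgroupI)
    have "\<one> \<in> ?Z" using subgroup.one_closed[OF X] by blast
    then show "?Z \<noteq> {}" by blast
  next
    fix g assume "g \<in> ?Z"
    then obtain x where x: "g \<in> carrier G" "x \<in> X" "N #> g = N #> x" by blast
    then have "N #> inv g = N #> inv x" using Xc q.hom_inv by metis
    then show "inv g \<in> ?Z" using x subgroup.m_inv_closed[OF X] by blast
  next
    fix g h assume "g \<in> ?Z" "h \<in> ?Z"
    then obtain x y where x: "g \<in> carrier G" "x \<in> X" "N #> g = N #> x" "h \<in> carrier G" "y \<in> X" "N #> h = N #> y"
      by blast
    then have "N #> (g \<otimes> h) = N #> (x \<otimes> y)" using Xc q.hom_mult by metis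
    then show "g \<otimes> h \<in> ?Z" using x subgroup.m_closed[OF X] by blast
  qed blast
  show ?thesis
  proof (rule normal_if_normalized_by_generators[OF sub S])
    fix s z assume s: "s \<in> S" and "z \<in> ?Z"
    then obtain x where x: "z \<in> carrier G" "x \<in> X" "N #> z = N #> x" by blast
    have sc: "s \<in> carrier G" using s S by blast
    obtain x' where x': "x' \<in> X" "N #> (s \<otimes> x \<otimes> inv s) = N #> x'" using conj[OF s x(2)] by blast
    have "N #> (s \<otimes> z \<otimes> inv s) = N #> (s \<otimes> x \<otimes> inv s)"
      using x sc Xc[OF x(2)] by (simp only: q.hom_mult m_closed inv_closed)
    then show "s \<otimes> z \<otimes> inv s \<in> ?Z" using x' x(1) sc by auto
  qed
qed

lemma conj_eq_mult_commutator:
  "s \<in> carrier G \<Longrightarrow> x \<in> carrier G \<Longrightarrow> s \<otimes> x \<otimes> inv s = x \<otimes> commutator G x (inv s)"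
  by (simp add: commutator_def word_simps)

lemma rcoset_conj_eq:
  assumes "N \<lhd> G" "s \<in> carrier G" "x \<in> carrier G" "commutator G x (inv s) \<in> N"
  shows "N #> (s \<otimes> x \<otimes> inv s) = N #> x"
proof -
  have "inv x \<otimes> (s \<otimes> x \<otimes> inv s) \<in> N"
    using assms by (simp add: conj_eq_mult_commutator)
  then show ?thesis using inv_mult_in_normal_iff[OF assms(1,3), of "s \<otimes> x \<otimes> inv s"] assms by simp
qed

lemma one_commutator [simp]: "y \<in> carrier G \<Longrightarrow> commutator G \<one> y = \<one>"
  by (simp add: commutator_def)

text \<open>The identities \<open>[x s\<inverse>, y] = s [x, y] s\<inverse> [s\<inverse>, y]\<close> and \<open>[x, y s\<inverse>] = [x, s\<inverse>] s [x, y] s\<inverse>\<close> show that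
  conjugation by \<open>s \<in> X\<close> and by \<open>s \<in> Y\<close>, respectively, preserves \<open>[X, Y]\<close>.\<close>

lemma comm_subgroup_normal:
  assumes X: "subgroup X G" and Y: "subgroup Y G" and gen: "carrier G \<subseteq> generate G (X \<union> Y)"
  shows "comm_subgroup G X Y \<lhd> G"
proof -
  have Xc: "x \<in> carrier G" if "x \<in> X" for x using X that by (rule subgroup.mem_carrier)
  have Yc: "y \<in> carrier G" if "y \<in> Y" for y using Y that by (rule subgroup.mem_carrier)
  let ?H = "{commutator G x y |x y. x \<in> X \<and> y \<in> Y}"
  have H: "?H \<subseteq> carrier G" using Xc Yc by (blast intro: commutator_closed)
  note C = generate_is_subgroup[OF H]
  have inC: "commutator G x y \<in> generate G ?H" if "x \<in> X" "y \<in> Y" for x y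
    using that by (blast intro: generate.incl)
  show ?thesis
    unfolding comm_subgroup_def
  proof (rule generate_normal_if_normalized_by_generators[OF H _ gen])
    show "X \<union> Y \<subseteq> carrier G" using Xc Yc by blast
    show "inv s \<in> X \<union> Y" if "s \<in> X \<union> Y" for s
      using that subgroup.m_inv_closed[OF X] subgroup.m_inv_closed[OF Y] by blast
    fix s h assume s: "s \<in> X \<union> Y" and "h \<in> ?H"
    then obtain x y where h: "h = commutator G x y" "x \<in> X" "y \<in> Y" by blast
    note xy = Xc[OF h(2)] Yc[OF h(3)]
    from s show "s \<otimes> h \<otimes> inv s \<in> generate G ?H"
    proof
      assume s: "s \<in> X"
      have eq: "s \<otimes> h \<otimes> inv s = commutator G (x \<otimes> inv s) y \<otimes> inv (commutator G (inv s) y)"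
        using xy Xc[OF s] by (simp add: h(1) commutator_def word_simps)
      show ?thesis
        unfolding eq by (rule subgroup.m_closed[OF C inC[OF subgroup.m_closed[OF X h(2)
                subgroup.m_inv_closed[OF X s]] h(3)] subgroup.m_inv_closed[OF C inC[OF subgroup.m_inv_closed[OF X s] h(3)]]])
    next
      assume s: "s \<in> Y"
      have eq: "s \<otimes> h \<otimes> inv s = inv (commutator G x (inv s)) \<otimes> commutator G x (y \<otimes> inv s)"
        using xy Yc[OF s] by (simp add: h(1) commutator_def word_simps)
      show ?thesis
        unfolding eq by (rule subgroup.m_closed[OF C subgroup.m_inv_closed[OF C inC[OF h(2)
                subgroup.m_inv_closed[OF Y s]]] inC[OF h(2) subgroup.m_closed[OF Y h(3) subgroup.m_inv_closed[OF Y s]]]])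
    qed
  qed
qed

text \<open>Multilinearity of \<open>[X\<^sup>G, \<^sub>n G]\<close> in its last \<open>n\<close> entries.  Let \<open>P\<^sub>n\<close> be the product of the normal closures of
  all \<open>[X, Y\<^sub>1, \<dots>, Y\<^sub>n]\<close>.  Modulo \<open>P\<^bsub>n+1\<^esub>\<close> each \<open>[X, Y\<^sub>1, \<dots>, Y\<^sub>n]\<close> commutes with every generator of \<open>G\<close> and so is
  central; hence \<open>[P\<^sub>n, G] \<le> P\<^bsub>n+1\<^esub>\<close>.\<close>

lemma rel_lcs_normal_closure_subset:
  assumes X: "X \<subseteq> carrier G" and Yc: "\<And>Y. Y \<in> \<Y> \<Longrightarrow> Y \<subseteq> carrier G"
    and gen: "carrier G \<subseteq> generate G (\<Union>\<Y>)"
  shows "rel_lcs G (normal_closure G X) n \<subseteq>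
    generate G (\<Union>Ys\<in>{Ys. length Ys = n \<and> set Ys \<subseteq> \<Y>}. normal_closure G (comm_subgroups G X Ys))"
    (is "_ \<subseteq> ?P n")
proof (induction n)
  case 0
  then show ?case by (auto intro: generate.incl)
next
  case (Suc n)
  have Ysc: "comm_subgroups G X Ys \<subseteq> carrier G" if "set Ys \<subseteq> \<Y>" for Ys
    by (rule comm_subgroups_closed[OF X]) (use that Yc in blast)
  have P_eq: "?P m = generate G (\<Union>((\<lambda>Ys. normal_closure G (comm_subgroups G X Ys)) ` {Ys. length Ys = m \<and> set Ys \<subseteq> \<Y>}))" for m
    by simp
  have P: "?P m \<lhd> G" for m
    by (rule generate_Union_normal) (use Ysc normal_closure_normal in blast)
  define Z where "Z = {x \<in> carrier G. \<forall>g\<in>carrier G. commutator G x g \<in> ?P (Suc n)}"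
  have Z: "Z \<lhd> G" unfolding Z_def by (rule normal_center_mod[OF P])
  have "comm_subgroups G X Ys \<subseteq> Z" if Ys: "length Ys = n" "set Ys \<subseteq> \<Y>" for Ys
  proof
    fix x assume x: "x \<in> comm_subgroups G X Ys"
    have xc: "x \<in> carrier G" using x Ysc[OF Ys(2)] by blast
    have "\<Union>\<Y> \<subseteq> {g \<in> carrier G. commutator G x g \<in> ?P (Suc n)}"
    proof
      fix g assume "g \<in> \<Union>\<Y>"
      then obtain Y where Y: "Y \<in> \<Y>" "g \<in> Y" by blast
      have "commutator G x g \<in> comm_subgroups G X (Ys @ [Y])"
        using x Y(2) by (simp add: commutator_in_comm_subgroup)
      then have "commutator G x g \<in> normal_closure G (comm_subgroups G X (Ys @ [Y]))"
        using subset_normal_closure by blast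
      moreover have "Ys @ [Y] \<in> {Ys. length Ys = Suc n \<and> set Ys \<subseteq> \<Y>}" using Ys Y(1) by simp
      ultimately have "commutator G x g \<in> ?P (Suc n)" by (blast intro: generate.incl)
      then show "g \<in> {g \<in> carrier G. commutator G x g \<in> ?P (Suc n)}" using Y Yc by blast
    qed
    then have "generate G (\<Union>\<Y>) \<subseteq> {g \<in> carrier G. commutator G x g \<in> ?P (Suc n)}"
      by (rule generate_subgroup_incl[OF _ subgroup_centralizer_mod[OF P xc]])
    then show "x \<in> Z" using gen xc unfolding Z_def by blast
  qed
  then have "normal_closure G (comm_subgroups G X Ys) \<subseteq> Z" if "length Ys = n" "set Ys \<subseteq> \<Y>" for Ys
    using that by (intro normal_closure_least[OF Z]) blast
  then have "?P n \<subseteq> Z"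
    by (intro generate_subgroup_incl normal_imp_subgroup[OF Z]) blast
  then have PZ: "rel_lcs G (normal_closure G X) n \<subseteq> Z" using Suc.IH by blast
  show ?case
    unfolding rel_lcs_Suc
    by (rule comm_subgroup_least[OF normal_imp_subgroup[OF P]]) (use PZ in \<open>auto simp: Z_def\<close>)
qed

end

section \<open>The subgroups \<open>D\<^sub>c\<close> and \<open>E\<^sub>c\<close> of \<open>F * B\<close>\<close>

text \<open>The setting is \<open>K = F * B\<close> with a normal subgroup \<open>R\<close> of \<open>F\<close>.  Here \<open>T\<close> is \<open>R\<^sup>K\<close>, and a prime marks images in \<open>K\<close>.\<close>

locale relative_product = F: group F + B: group B + R: normal R F
  for F :: "('f, 'm) monoid_scheme" and B :: "('b, 'n) monoid_scheme" and R :: "'f set"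
begin

abbreviation "K \<equiv> free_prod2 F B"
abbreviation "i1 \<equiv> free_inl F B"
abbreviation "i2 \<equiv> free_inr F B"
abbreviation "F' \<equiv> i1 ` carrier F"
abbreviation "B' \<equiv> i2 ` carrier B"
abbreviation "R' \<equiv> i1 ` R"
abbreviation "T \<equiv> normal_closure K R'"

sublocale K: group K by (rule group_free_prod2[OF F.is_group B.is_group])
sublocale i1: group_hom F K i1 by (rule group_homI[OF F.is_group K.is_group free_inl_hom[OF F.is_group]])
sublocale i2: group_hom B K i2 by (rule group_homI[OF B.is_group K.is_group free_inr_hom[OF F.is_group B.is_group]])

lemma R'_subset: "R' \<subseteq> carrier K" "R' \<subseteq> F'"
  using R.subset by auto

lemma F'_subgroup: "subgroup F' K" and B'_subgroup: "subgroup B' K"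
  by (rule i1.img_is_subgroup i2.img_is_subgroup)+

lemma generators: "F' \<union> B' \<subseteq> carrier K" "carrier K \<subseteq> generate K (F' \<union> B')"
    "\<And>s. s \<in> F' \<union> B' \<Longrightarrow> inv\<^bsub>K\<^esub> s \<in> F' \<union> B'"
proof -
  show "F' \<union> B' \<subseteq> carrier K" by auto
  show "carrier K \<subseteq> generate K (F' \<union> B')"
    by (rule equalityD1[OF carrier_free_prod2_generate[OF F.is_group B.is_group]])
  fix s assume "s \<in> F' \<union> B'"
  then show "inv\<^bsub>K\<^esub> s \<in> F' \<union> B'"
    using subgroup.m_inv_closed[OF F'_subgroup, of s] subgroup.m_inv_closed[OF B'_subgroup, of s] by blast
qed

lemma T_normal: "T \<lhd> K"
  by (rule K.normal_closure_normal[OF R'_subset(1)])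

text \<open>The retractions of \<open>F * B\<close> onto its factors, given by the universal property.\<close>

definition pr :: "('f + 'b) list set \<Rightarrow> 'f" where
  "pr = (SOME p. group_hom K F p \<and> (\<forall>x\<in>carrier F. p (i1 x) = x) \<and> (\<forall>y\<in>carrier B. p (i2 y) = \<one>\<^bsub>F\<^esub>))"

definition prB :: "('f + 'b) list set \<Rightarrow> 'b" where
  "prB = (SOME p. group_hom K B p \<and> (\<forall>x\<in>carrier F. p (i1 x) = \<one>\<^bsub>B\<^esub>) \<and> (\<forall>y\<in>carrier B. p (i2 y) = y))"

lemma pr: "group_hom K F pr \<and> (\<forall>x\<in>carrier F. pr (i1 x) = x) \<and> (\<forall>y\<in>carrier B. pr (i2 y) = \<one>\<^bsub>F\<^esub>)"
proof -
  have "group_hom F F (\<lambda>x. x)" by (intro group_homI homI F.is_group) auto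
  from free_prod2_lift[OF F.is_group B.is_group this trivial_hom[OF B.is_group F.is_group]]
  show ?thesis unfolding pr_def by (rule someI_ex)
qed

lemma prB: "group_hom K B prB \<and> (\<forall>x\<in>carrier F. prB (i1 x) = \<one>\<^bsub>B\<^esub>) \<and> (\<forall>y\<in>carrier B. prB (i2 y) = y)"
proof -
  have "group_hom B B (\<lambda>x. x)" by (intro group_homI homI B.is_group) auto
  from free_prod2_lift[OF F.is_group B.is_group trivial_hom[OF F.is_group B.is_group] this]
  show ?thesis unfolding prB_def by (rule someI_ex)
qed

sublocale pr: group_hom K F pr using pr by blast
sublocale prB: group_hom K B prB using prB by blast

lemma pr_i1: "x \<in> carrier F \<Longrightarrow> pr (i1 x) = x" and pr_i2: "y \<in> carrier B \<Longrightarrow> pr (i2 y) = \<one>\<^bsub>F\<^esub>"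
  using pr by blast+

lemma prB_i1: "x \<in> carrier F \<Longrightarrow> prB (i1 x) = \<one>\<^bsub>B\<^esub>" and prB_i2: "y \<in> carrier B \<Longrightarrow> prB (i2 y) = y"
  using prB by blast+

text \<open>The retraction onto \<open>F\<close> as an idempotent endomorphism of \<open>K\<close>.\<close>

definition \<rho> :: "('f + 'b) list set \<Rightarrow> ('f + 'b) list set" where
  "\<rho> x = i1 (pr x)"

sublocale \<rho>: group_hom K K \<rho>
  unfolding \<rho>_def by (intro group_homI homI K.is_group) auto

lemma \<rho>_F': "x \<in> F' \<Longrightarrow> \<rho> x = x"
  by (auto simp: \<rho>_def pr_i1)

lemma pr_T: "t \<in> T \<Longrightarrow> pr t \<in> R"
proof -
  have "T \<subseteq> {x \<in> carrier K. pr x \<in> R}"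
    by (rule K.normal_closure_least[OF pr.normal_preimage[OF R.normal_axioms]]) (auto simp: pr_i1)
  then show "t \<in> T \<Longrightarrow> pr t \<in> R" by blast
qed

lemma T_subset: "t \<in> T \<Longrightarrow> t \<in> carrier K"
  using T_normal by (meson normal_imp_subgroup subgroup.mem_carrier)

lemma prB_T: "t \<in> T \<Longrightarrow> prB t = \<one>\<^bsub>B\<^esub>"
proof -
  have "T \<subseteq> kernel K B prB"
    by (rule K.normal_closure_least[OF prB.normal_kernel]) (auto simp: kernel_def prB_i1)
  then show "t \<in> T \<Longrightarrow> prB t = \<one>\<^bsub>B\<^esub>" by (auto simp: kernel_def)
qed

lemma \<rho>_T: "t \<in> T \<Longrightarrow> \<rho> t \<in> T"
  using pr_T K.subset_normal_closure[of R'] by (auto simp: \<rho>_def)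

abbreviation "RK \<equiv> normal_closure K (comm_subgroup K R' (carrier K))"

lemma RK_normal: "RK \<lhd> K"
  by (rule K.normal_closure_normal[OF K.comm_subgroup_closed[OF R'_subset(1) subset_refl]])

lemma RK_subset_T: "RK \<subseteq> T"
proof (rule K.normal_closure_least[OF T_normal])
  have "comm_subgroups K R' [carrier K] \<subseteq> T"
    using K.subset_normal_closure R'_subset by (intro K.comm_subgroups_in_normal[OF T_normal]) auto
  then show "comm_subgroup K R' (carrier K) \<subseteq> T" using comm_subgroups_snoc[of K R' "[]"] by simp
qed

text \<open>Modulo \<open>[R, K]\<^sup>K\<close> the subgroup \<open>R\<close> is central, so \<open>R\<^sup>K = R [R, K]\<^sup>K\<close> and \<open>t = r n\<close> accordingly.  As \<open>\<rho>\<close>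
  kills \<open>t\<close>, fixes \<open>r\<close> and preserves \<open>[R, K]\<^sup>K\<close>, the element \<open>\<rho>(n) = r\<inverse>\<close> lies there too, and so does \<open>t\<close>.\<close>

lemma in_RK_if_pr_trivial:
  assumes t: "t \<in> T" "pr t = \<one>\<^bsub>F\<^esub>"
  shows "t \<in> RK"
proof -
  have R'_sub: "subgroup R' K" by (rule i1.subgroup_img_is_subgroup[OF R.is_subgroup])
  have "{g \<in> carrier K. \<exists>x\<in>R'. RK #>\<^bsub>K\<^esub> g = RK #>\<^bsub>K\<^esub> x} \<lhd> K" (is "?Z \<lhd> K")
  proof (rule K.normal_product[OF R'_sub RK_normal subset_refl])
    show "carrier K \<subseteq> generate K (carrier K)" by (rule subsetI) (rule generate.incl)
    fix s x assume s: "s \<in> carrier K" and x: "x \<in> R'"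
    note xc = subsetD[OF R'_subset(1) x]
    have "commutator K x (inv\<^bsub>K\<^esub> s) \<in> RK"
      by (rule subsetD[OF K.subset_normal_closure K.commutator_in_comm_subgroup[OF x K.inv_closed[OF s]]])
    then show "\<exists>x'\<in>R'. RK #>\<^bsub>K\<^esub> (s \<otimes>\<^bsub>K\<^esub> x \<otimes>\<^bsub>K\<^esub> inv\<^bsub>K\<^esub> s) = RK #>\<^bsub>K\<^esub> x'"
      using K.rcoset_conj_eq[OF RK_normal s xc] x by blast
  qed simp
  moreover have "R' \<subseteq> ?Z" using R'_subset(1) by auto
  ultimately have "T \<subseteq> ?Z" by (rule K.normal_closure_least)
  then obtain r where r: "r \<in> R'" "RK #>\<^bsub>K\<^esub> t = RK #>\<^bsub>K\<^esub> r" using t(1) by blast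
  have rc: "r \<in> carrier K" and tc: "t \<in> carrier K" and rF: "r \<in> F'"
    using subsetD[OF R'_subset(1) r(1)] T_subset[OF t(1)] subsetD[OF R'_subset(2) r(1)] by simp_all
  have "RK \<subseteq> {x \<in> carrier K. \<rho> x \<in> RK}"
  proof (rule K.normal_closure_least[OF \<rho>.normal_preimage[OF RK_normal]])
    show "comm_subgroup K R' (carrier K) \<subseteq> {x \<in> carrier K. \<rho> x \<in> RK}"
    proof (rule K.comm_subgroup_least[OF normal_imp_subgroup[OF \<rho>.normal_preimage[OF RK_normal]]])
      fix x y assume x: "x \<in> R'" and y: "y \<in> carrier K"
      note xc = subsetD[OF R'_subset(1) x] and xF = subsetD[OF R'_subset(2) x]
      have "\<rho> (commutator K x y) = commutator K x (\<rho> y)"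
        using \<rho>.hom_commutator[OF xc y] \<rho>_F'[OF xF] by simp
      also have "\<dots> \<in> RK"
        by (rule subsetD[OF K.subset_normal_closure K.commutator_in_comm_subgroup[OF x \<rho>.hom_closed[OF y]]])
      finally show "commutator K x y \<in> {x \<in> carrier K. \<rho> x \<in> RK}" using xc y by simp
    qed
  qed
  moreover have n: "inv\<^bsub>K\<^esub> r \<otimes>\<^bsub>K\<^esub> t \<in> RK"
    using K.inv_mult_in_normal_iff[OF RK_normal rc tc] r(2) by simp
  ultimately have "\<rho> (inv\<^bsub>K\<^esub> r \<otimes>\<^bsub>K\<^esub> t) \<in> RK" by blast
  moreover have "\<rho> (inv\<^bsub>K\<^esub> r \<otimes>\<^bsub>K\<^esub> t) = inv\<^bsub>K\<^esub> r"
  proof -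
    have "\<rho> t = \<one>\<^bsub>K\<^esub>" using t(2) by (simp add: \<rho>_def)
    moreover have "\<rho> r = r" by (rule \<rho>_F'[OF rF])
    ultimately show ?thesis using rc tc by simp
  qed
  ultimately have "inv\<^bsub>K\<^esub> r \<in> RK" by simp
  then have "inv\<^bsub>K\<^esub> (inv\<^bsub>K\<^esub> r) \<in> RK" by (rule subgroup.m_inv_closed[OF normal_imp_subgroup[OF RK_normal]])
  then have "r \<in> RK" using rc by simp
  then have "r \<otimes>\<^bsub>K\<^esub> (inv\<^bsub>K\<^esub> r \<otimes>\<^bsub>K\<^esub> t) \<in> RK"
    by (rule subgroup.m_closed[OF normal_imp_subgroup[OF RK_normal] _ n])
  then show ?thesis using rc tc by simp
qed

text \<open>The common kernel of both retractions is \<open>[F, B]\<close>: modulo \<open>[F, B]\<close>, where \<open>F\<close> and \<open>B\<close> commute,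
  every \<open>x\<close> is the product of its two retractions.\<close>

lemma in_comm_subgroup_if_retractions_trivial:
  assumes x: "x \<in> carrier K" "pr x = \<one>\<^bsub>F\<^esub>" "prB x = \<one>\<^bsub>B\<^esub>"
  shows "x \<in> comm_subgroup K F' B'"
proof -
  define C where "C = comm_subgroup K F' B'"
  have C: "C \<lhd> K" unfolding C_def by (rule K.comm_subgroup_normal[OF F'_subgroup B'_subgroup generators(2)])
  interpret q: group_hom K "K Mod C" "\<lambda>x. C #>\<^bsub>K\<^esub> x" by (rule K.quotient_hom[OF C])
  define g where "g x = (C #>\<^bsub>K\<^esub> i1 (pr x)) \<otimes>\<^bsub>K Mod C\<^esub> (C #>\<^bsub>K\<^esub> i2 (prB x))" for x
  have comm: "(C #>\<^bsub>K\<^esub> i1 a) \<otimes>\<^bsub>K Mod C\<^esub> (C #>\<^bsub>K\<^esub> i2 b) = (C #>\<^bsub>K\<^esub> i2 b) \<otimes>\<^bsub>K Mod C\<^esub> (C #>\<^bsub>K\<^esub> i1 a)"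
    if "a \<in> carrier F" "b \<in> carrier B" for a b
    using K.commutator_in_normal_iff[OF C i1.hom_closed[OF that(1)] i2.hom_closed[OF that(2)]]
      K.commutator_in_comm_subgroup[of "i1 a" F' "i2 b" B'] that unfolding C_def by blast
  have "g \<in> hom K (K Mod C)"
  proof (rule homI)
    show "g x \<in> carrier (K Mod C)" if "x \<in> carrier K" for x
      using that unfolding g_def by (intro q.H.m_closed q.hom_closed) simp_all
  next
    fix x y assume xy: "x \<in> carrier K" "y \<in> carrier K"
    define a a' b b' where "a = C #>\<^bsub>K\<^esub> i1 (pr x)" "a' = C #>\<^bsub>K\<^esub> i1 (pr y)"
      "b = C #>\<^bsub>K\<^esub> i2 (prB x)" "b' = C #>\<^bsub>K\<^esub> i2 (prB y)"
    note ab = this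
    have c: "a \<in> carrier (K Mod C)" "a' \<in> carrier (K Mod C)" "b \<in> carrier (K Mod C)" "b' \<in> carrier (K Mod C)"
      unfolding ab using xy by (intro q.hom_closed; simp)+
    have "g (x \<otimes>\<^bsub>K\<^esub> y) = (a \<otimes>\<^bsub>K Mod C\<^esub> a') \<otimes>\<^bsub>K Mod C\<^esub> (b \<otimes>\<^bsub>K Mod C\<^esub> b')"
      unfolding g_def ab using xy by simp
    also have "\<dots> = a \<otimes>\<^bsub>K Mod C\<^esub> ((a' \<otimes>\<^bsub>K Mod C\<^esub> b) \<otimes>\<^bsub>K Mod C\<^esub> b')"
      using c by (simp add: q.H.m_assoc)
    also have "a' \<otimes>\<^bsub>K Mod C\<^esub> b = b \<otimes>\<^bsub>K Mod C\<^esub> a'"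
      unfolding ab by (rule comm) (use xy in simp_all)
    also have "a \<otimes>\<^bsub>K Mod C\<^esub> (b \<otimes>\<^bsub>K Mod C\<^esub> a' \<otimes>\<^bsub>K Mod C\<^esub> b') = g x \<otimes>\<^bsub>K Mod C\<^esub> g y"
      unfolding g_def using c by (simp add: q.H.m_assoc flip: ab)
    finally show "g (x \<otimes>\<^bsub>K\<^esub> y) = g x \<otimes>\<^bsub>K Mod C\<^esub> g y" .
  qed
  then have g: "group_hom K (K Mod C) g" by (rule group_homI[OF K.is_group q.H.is_group])
  have "C #>\<^bsub>K\<^esub> x = g x"
  proof (rule hom_eq_on_generators[OF q.group_hom_axioms g generators(2)])
    show "C #>\<^bsub>K\<^esub> s = g s" if "s \<in> F' \<union> B'" for s
      using that
    proof
      assume "s \<in> F'"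
      then obtain f where f: "s = i1 f" "f \<in> carrier F" by blast
      have "g s = (C #>\<^bsub>K\<^esub> i1 f) \<otimes>\<^bsub>K Mod C\<^esub> (C #>\<^bsub>K\<^esub> \<one>\<^bsub>K\<^esub>)"
        unfolding g_def f(1) using f(2) by (simp only: pr_i1 prB_i1 i2.hom_one)
      also have "\<dots> = C #>\<^bsub>K\<^esub> i1 f" using f(2) q.hom_closed[OF i1.hom_closed[OF f(2)]] by (simp only: q.hom_one q.H.r_one)
      finally show ?thesis using f(1) by simp
    next
      assume "s \<in> B'"
      then obtain b where b: "s = i2 b" "b \<in> carrier B" by blast
      have "g s = (C #>\<^bsub>K\<^esub> \<one>\<^bsub>K\<^esub>) \<otimes>\<^bsub>K Mod C\<^esub> (C #>\<^bsub>K\<^esub> i2 b)"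
        unfolding g_def b(1) using b(2) by (simp only: pr_i2 prB_i2 i1.hom_one)
      also have "\<dots> = C #>\<^bsub>K\<^esub> i2 b" using q.hom_closed[OF i2.hom_closed[OF b(2)]] by (simp only: q.hom_one q.H.l_one)
      finally show ?thesis using b(1) by simp
    qed
  qed (use generators(1) x(1) in blast)+
  also have "\<dots> = C #>\<^bsub>K\<^esub> \<one>\<^bsub>K\<^esub>" unfolding g_def x(2,3) by (simp only: i1.hom_one i2.hom_one q.hom_one q.H.r_one q.H.one_closed)
  also have "\<dots> = C" unfolding q.hom_one by (rule one_FactGroup)
  finally show ?thesis using K.rcoset_eq_self_iff[OF C x(1)] unfolding C_def by blast
qed

text \<open>The intersection with \<open>[F, B]\<close> only says that both retractions are trivial, and the one to \<open>B\<close> is trivial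
  on all of \<open>R\<^sup>K\<close>; so \<open>E\<^sub>c\<close> is the kernel of the retraction of \<open>R\<^sup>K \<inter> \<gamma>\<^bsub>c+1\<^esub>(K)\<close> onto \<open>R \<inter> \<gamma>\<^bsub>c+1\<^esub>(F)\<close>.\<close>

lemma E_sub_eq: "E_sub c F R B = {e \<in> T \<inter> rel_lcs K (carrier K) c. pr e = \<one>\<^bsub>F\<^esub>}"
proof -
  have "comm_subgroup K F' B' \<subseteq> kernel K F pr"
  proof -
    have "comm_subgroups K F' [B'] \<subseteq> kernel K F pr"
      using generators(1) by (intro K.comm_subgroups_in_normal pr.normal_kernel) (auto simp: kernel_def pr_i2)
    then show ?thesis using comm_subgroups_snoc[of K F' "[]"] by simp
  qed
  then have "e \<in> RK \<inter> rel_lcs K (carrier K) c \<inter> comm_subgroup K F' B' \<longleftrightarrow>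
      e \<in> {e \<in> T \<inter> rel_lcs K (carrier K) c. pr e = \<one>\<^bsub>F\<^esub>}" for e
    using RK_subset_T in_RK_if_pr_trivial[of e] in_comm_subgroup_if_retractions_trivial[of e] prB_T[of e]
      T_subset[of e] by (auto simp: kernel_def)
  then show ?thesis
    unfolding E_sub_def Let_def lower_central_eq_rel_lcs by blast
qed

context
  fixes c :: nat assumes c: "c \<ge> 1"
begin

abbreviation "D \<equiv> D_sub c F R B"
abbreviation "E \<equiv> E_sub c F R B"

lemma D_eq: "D = generate K (\<Union>Gs \<in> {Gs. length Gs = c \<and> set Gs \<subseteq> {F', B'} \<and> B' \<in> set Gs}.
              normal_closure K (comm_subgroups K R' Gs))"
  by (simp add: D_sub_def Let_def)

lemma factors_subset: "Y \<in> {F', B'} \<Longrightarrow> Y \<subseteq> carrier K"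
  using generators(1) by blast

lemma comm_factors_subset: "set Gs \<subseteq> {F', B'} \<Longrightarrow> comm_subgroups K R' Gs \<subseteq> carrier K"
  by (rule K.comm_subgroups_closed[OF R'_subset(1)]) (use factors_subset in blast)

lemma D_normal: "D \<lhd> K"
  unfolding D_eq by (rule K.generate_Union_normal) (auto intro: K.normal_closure_normal[OF comm_factors_subset])

lemma comm_factors_subset_D:
  assumes "length Gs = c" "set Gs \<subseteq> {F', B'}" "B' \<in> set Gs"
  shows "comm_subgroups K R' Gs \<subseteq> D"
proof -
  have "normal_closure K (comm_subgroups K R' Gs) \<subseteq> D"
  proof
    fix x assume "x \<in> normal_closure K (comm_subgroups K R' Gs)"
    then show "x \<in> D" unfolding D_eq using assms by (intro generate.incl) blast
  qed
  then show ?thesis using K.subset_normal_closure by blast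
qed

lemma D_least:
  assumes "N \<lhd> K" "\<And>Gs. length Gs = c \<Longrightarrow> set Gs \<subseteq> {F', B'} \<Longrightarrow> B' \<in> set Gs \<Longrightarrow> comm_subgroups K R' Gs \<subseteq> N"
  shows "D \<subseteq> N"
  unfolding D_eq
proof (rule K.generate_subgroup_incl[OF _ normal_imp_subgroup[OF assms(1)]], rule UN_least)
  fix Gs assume "Gs \<in> {Gs. length Gs = c \<and> set Gs \<subseteq> {F', B'} \<and> B' \<in> set Gs}"
  then have "comm_subgroups K R' Gs \<subseteq> N" using assms(2) by simp
  then show "normal_closure K (comm_subgroups K R' Gs) \<subseteq> N" by (rule K.normal_closure_least[OF assms(1)])
qed

lemma pr_D: "d \<in> D \<Longrightarrow> pr d = \<one>\<^bsub>F\<^esub>"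
proof -
  have "D \<subseteq> kernel K F pr"
  proof (rule D_least[OF pr.normal_kernel])
    fix Gs assume Gs: "set Gs \<subseteq> {F', B'}" "B' \<in> set Gs"
    have "B' \<subseteq> kernel K F pr" by (auto simp: kernel_def pr_i2)
    moreover have "Y \<subseteq> carrier K" if "Y \<in> set Gs" for Y using factors_subset[of Y] Gs(1) that by blast
    ultimately show "comm_subgroups K R' Gs \<subseteq> kernel K F pr"
      using Gs(2) by (intro K.comm_subgroups_in_normal[OF pr.normal_kernel R'_subset(1)]) blast+
  qed
  then show "d \<in> D \<Longrightarrow> pr d = \<one>\<^bsub>F\<^esub>" by (auto simp: kernel_def)
qed

lemma D_subset_rel_lcs: "D \<subseteq> rel_lcs K T c"
proof (rule D_least[OF K.rel_lcs_normal[OF T_normal]])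
  fix Gs assume Gs: "length Gs = c" "set Gs \<subseteq> {F', B'}"
  have "comm_subgroups K R' Gs \<subseteq> comm_subgroups K T (map (\<lambda>_. carrier K) Gs)"
  proof (rule K.comm_subgroups_mono[OF K.subset_normal_closure])
    show "T \<subseteq> carrier K" using T_subset by blast
    show "Y \<subseteq> carrier K" if "Y \<in> set Gs" for Y using factors_subset[of Y] Gs(2) that by blast
  qed simp
  then show "comm_subgroups K R' Gs \<subseteq> rel_lcs K T c"
    using Gs(1) by (simp add: rel_lcs_def map_replicate_const)
qed

lemma D_subset_E: "D \<subseteq> E"
  unfolding E_sub_eq using D_subset_rel_lcs K.baer_denominator[OF T_normal, of c] pr_D by blast

lemma E_subgroup: "subgroup E K"
proof -
  have "E = (T \<inter> rel_lcs K (carrier K) c) \<inter> kernel K F pr"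
    unfolding E_sub_eq using T_subset by (auto simp: kernel_def)
  then show ?thesis
    using K.subgroups_Inter_pair[OF K.baer_numerator[OF T_normal] pr.subgroup_kernel] by metis
qed

text \<open>In the decomposition of \<open>[R\<^sup>K, \<^sub>c K]\<close> by multilinearity all factors except the one of \<open>[R, \<^sub>c F]\<close> lie in \<open>D\<^sub>c\<close>.
  And \<open>[R, \<^sub>c F] D\<^sub>c\<close> is already normal: conjugating by \<open>B\<close> brings in \<open>[R, \<^sub>c F, B] \<le> [R, \<^bsub>c-1\<^esub> F, B] \<le> D\<^sub>c\<close>.\<close>

lemma rel_lcs_subset_product:
  assumes x: "x \<in> rel_lcs K T c"
  shows "\<exists>f\<in>F'. D #>\<^bsub>K\<^esub> x = D #>\<^bsub>K\<^esub> f"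
proof -
  define X where "X = comm_subgroups K R' (replicate c F')"
  have X_eq: "X = i1 ` rel_lcs F R c"
    unfolding X_def rel_lcs_def using i1.hom_comm_subgroups[OF R.subset, of "replicate c (carrier F)"] by simp
  have RN: "rel_lcs F R c \<lhd> F" by (rule F.rel_lcs_normal[OF R.normal_axioms])
  have X_sub: "subgroup X K" unfolding X_eq by (rule i1.subgroup_img_is_subgroup[OF normal_imp_subgroup[OF RN]])
  have XF: "X \<subseteq> F'" unfolding X_eq using F.rel_lcs_mem[OF R.normal_axioms] by blast
  have Z: "{g \<in> carrier K. \<exists>x\<in>X. D #>\<^bsub>K\<^esub> g = D #>\<^bsub>K\<^esub> x} \<lhd> K" (is "?Z \<lhd> K")
  proof (rule K.normal_product[OF X_sub D_normal generators])
    fix s x assume s: "s \<in> F' \<union> B'" and x: "x \<in> X"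
    have xc: "x \<in> carrier K" using x XF generators(1) by blast
    have sc: "s \<in> carrier K" using s generators(1) by blast
    from s show "\<exists>x'\<in>X. D #>\<^bsub>K\<^esub> (s \<otimes>\<^bsub>K\<^esub> x \<otimes>\<^bsub>K\<^esub> inv\<^bsub>K\<^esub> s) = D #>\<^bsub>K\<^esub> x'"
    proof
      assume "s \<in> F'"
      then obtain f where f: "s = i1 f" "f \<in> carrier F" by blast
      obtain r where r: "x = i1 r" "r \<in> rel_lcs F R c" using x unfolding X_eq by blast
      have "f \<otimes>\<^bsub>F\<^esub> r \<otimes>\<^bsub>F\<^esub> inv\<^bsub>F\<^esub> f \<in> rel_lcs F R c" using normal.inv_op_closed2[OF RN f(2) r(2)] .
      moreover have "s \<otimes>\<^bsub>K\<^esub> x \<otimes>\<^bsub>K\<^esub> inv\<^bsub>K\<^esub> s = i1 (f \<otimes>\<^bsub>F\<^esub> r \<otimes>\<^bsub>F\<^esub> inv\<^bsub>F\<^esub> f)"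
        using f F.rel_lcs_mem[OF R.normal_axioms r(2)] by (simp add: r(1))
      ultimately show ?thesis unfolding X_eq by blast
    next
      assume "s \<in> B'"
      then have s': "inv\<^bsub>K\<^esub> s \<in> B'" using subgroup.m_inv_closed[OF B'_subgroup] by blast
      define Y where "Y = comm_subgroups K R' (replicate (c - 1) F')"
      have "Y = i1 ` rel_lcs F R (c - 1)"
        unfolding Y_def rel_lcs_def using i1.hom_comm_subgroups[OF R.subset, of "replicate (c - 1) (carrier F)"] by simp
      then have "x \<in> Y" using x F.rel_lcs_Suc_subset[OF R.normal_axioms, of "c - 1"] c unfolding X_eq by auto
      then have "commutator K x (inv\<^bsub>K\<^esub> s) \<in> comm_subgroups K R' (replicate (c - 1) F' @ [B'])"
        unfolding comm_subgroups_snoc Y_def using s' by (rule K.commutator_in_comm_subgroup)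
      moreover have "comm_subgroups K R' (replicate (c - 1) F' @ [B']) \<subseteq> D"
        using c by (intro comm_factors_subset_D) auto
      ultimately have "commutator K x (inv\<^bsub>K\<^esub> s) \<in> D" by blast
      then show ?thesis using K.rcoset_conj_eq[OF D_normal sc xc] x by blast
    qed
  qed
  have "rel_lcs K T c \<subseteq> generate K (\<Union>Ys\<in>{Ys. length Ys = c \<and> set Ys \<subseteq> {F', B'}}. normal_closure K (comm_subgroups K R' Ys))"
    by (rule K.rel_lcs_normal_closure_subset[OF R'_subset(1) factors_subset]) (use generators(2) in simp_all)
  also have "\<dots> \<subseteq> ?Z"
  proof (rule K.generate_subgroup_incl[OF _ normal_imp_subgroup[OF Z]])
    have "normal_closure K (comm_subgroups K R' Ys) \<subseteq> ?Z" if Ys: "length Ys = c" "set Ys \<subseteq> {F', B'}" for Ys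
    proof (rule K.normal_closure_least[OF Z])
      show "comm_subgroups K R' Ys \<subseteq> ?Z"
      proof (cases "B' \<in> set Ys")
        case True
        have "d \<in> ?Z" if "d \<in> D" for d
        proof -
          have dc: "d \<in> carrier K" using that D_normal by (meson normal_imp_subgroup subgroup.mem_carrier)
          have "D #>\<^bsub>K\<^esub> d = D #>\<^bsub>K\<^esub> \<one>\<^bsub>K\<^esub>"
            using K.rcoset_eq_iff[OF D_normal dc K.one_closed] dc that by simp
          then show ?thesis using subgroup.one_closed[OF X_sub] dc by blast
        qed
        then show ?thesis using comm_factors_subset_D[OF Ys True] by blast
      next
        case False
        then have "\<forall>Y\<in>set Ys. Y = F'" using Ys(2) by blast
        then have "Ys = replicate c F'" using Ys(1) by (simp add: replicate_eqI)
        then have "comm_subgroups K R' Ys = X" by (simp add: X_def)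
        then show ?thesis using XF generators(1) by blast
      qed
    qed
    then show "(\<Union>Ys\<in>{Ys. length Ys = c \<and> set Ys \<subseteq> {F', B'}}. normal_closure K (comm_subgroups K R' Ys)) \<subseteq> ?Z" by blast
  qed
  finally show ?thesis using x XF by blast
qed

text \<open>Write \<open>x = f d\<close> with \<open>f \<in> F\<close> and \<open>d \<in> D\<^sub>c\<close>.  Then \<open>\<rho>(x) = f\<close>, because \<open>\<rho>\<close> kills \<open>D\<^sub>c\<close>, and \<open>\<rho>(x)\<inverse> x = d\<close>.\<close>

lemma rel_lcs_retraction_in_D:
  assumes x: "x \<in> rel_lcs K T c"
  shows "inv\<^bsub>K\<^esub> (\<rho> x) \<otimes>\<^bsub>K\<^esub> x \<in> D"
proof -
  have xc: "x \<in> carrier K" using x K.rel_lcs_mem[OF T_normal] by blast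
  obtain f where f: "f \<in> F'" "D #>\<^bsub>K\<^esub> x = D #>\<^bsub>K\<^esub> f" using rel_lcs_subset_product[OF x] by blast
  have fc: "f \<in> carrier K" using f(1) generators(1) by blast
  have d: "inv\<^bsub>K\<^esub> f \<otimes>\<^bsub>K\<^esub> x \<in> D"
    using K.inv_mult_in_normal_iff[OF D_normal fc xc] f(2) by simp
  have "\<rho> x = \<rho> (f \<otimes>\<^bsub>K\<^esub> (inv\<^bsub>K\<^esub> f \<otimes>\<^bsub>K\<^esub> x))" using fc xc by simp
  also have "\<dots> = \<rho> f \<otimes>\<^bsub>K\<^esub> \<rho> (inv\<^bsub>K\<^esub> f \<otimes>\<^bsub>K\<^esub> x)" by (rule \<rho>.hom_mult) (use fc xc in simp_all)
  also have "\<rho> (inv\<^bsub>K\<^esub> f \<otimes>\<^bsub>K\<^esub> x) = \<one>\<^bsub>K\<^esub>" using pr_D[OF d] by (simp add: \<rho>_def)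
  also have "\<rho> f = f" by (rule \<rho>_F'[OF f(1)])
  finally show ?thesis using d fc by simp
qed

lemma E_mod_D_eq: "E_mod_D c F R B = (K\<lparr>carrier := E\<rparr>) Mod D"
  by (simp add: E_mod_D_def)

lemmas E_mod_D_subquotient = E_subgroup D_normal D_subset_E

lemma group_E_mod_D: "group (E_mod_D c F R B)"
  unfolding E_mod_D_eq by (rule K.group_subquotient[OF E_mod_D_subquotient])

text \<open>The epimorphism is \<open>e(x) = \<rho>(x)\<inverse> x\<close>.  Modulo \<open>D\<^sub>c\<close> it is a homomorphism: \<open>e(x y) = \<rho>(y)\<inverse> e(x) y\<close>, and
  \<open>[e(x), \<rho>(y)]\<close> lies in \<open>D\<^sub>c\<close>, since it lies in \<open>[R\<^sup>K, \<gamma>\<^bsub>c+1\<^esub>(K)] \<le> [R\<^sup>K, \<^sub>c K]\<close> and \<open>\<rho>\<close> kills it.  The denominator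
  \<open>[R\<^sup>K, \<^sub>c K]\<close> goes to \<open>D\<^sub>c\<close> by the preceding lemma, and \<open>e\<close> is the identity on \<open>E\<^sub>c\<close>.\<close>

lemma baer_to_E_mod_D:
  "\<exists>\<epsilon>\<in>epi (nilpotent_baer c K T) (E_mod_D c F R B).
     \<forall>x\<in>(T \<inter> rel_lcs K (carrier K) c) \<inter> F'. \<epsilon> (rel_lcs K T c #>\<^bsub>K\<^esub> x) = \<one>\<^bsub>E_mod_D c F R B\<^esub>"
proof -
  let ?ED = "E_mod_D c F R B" and ?BK = "nilpotent_baer c K T"
  define M where "M = T \<inter> rel_lcs K (carrier K) c"
  define e where "e x = inv\<^bsub>K\<^esub> (\<rho> x) \<otimes>\<^bsub>K\<^esub> x" for x
  interpret q: group_hom K "K Mod D" "\<lambda>x. D #>\<^bsub>K\<^esub> x" by (rule K.quotient_hom[OF D_normal])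
  note M_sub = K.baer_numerator[OF T_normal, of c, folded M_def]
  note MT = K.baer_subquotient[OF T_normal, of c, folded M_def]
  have Mc: "x \<in> carrier K" if "x \<in> M" for x using that by (rule subgroup.mem_carrier[OF M_sub])
  have \<rho>M: "\<rho> x \<in> M" if "x \<in> M" for x
  proof -
    have x: "x \<in> T" "x \<in> rel_lcs K (carrier K) c" using that unfolding M_def by blast+
    have "\<rho> ` carrier K \<subseteq> carrier K" by auto
    from \<rho>.hom_rel_lcs[OF subset_refl this subset_refl x(2)] show ?thesis
      using \<rho>_T[OF x(1)] unfolding M_def by blast
  qed
  have eE: "e x \<in> E" if "x \<in> M" for x
  proof -
    have "e x \<in> M" unfolding e_def
      by (intro subgroup.m_closed[OF M_sub] subgroup.m_inv_closed[OF M_sub] \<rho>M that)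
    moreover have "pr (e x) = \<one>\<^bsub>F\<^esub>" using Mc[OF that] by (simp add: e_def \<rho>_def pr_i1)
    ultimately show ?thesis unfolding E_sub_eq M_def by simp
  qed
  have commE: "commutator K u (\<rho> y) \<in> D" if u: "u \<in> E" and y: "y \<in> M" for u y
  proof -
    have u': "u \<in> T" "pr u = \<one>\<^bsub>F\<^esub>" using u unfolding E_sub_eq by simp_all
    note uc = T_subset[OF u'(1)]
    have "u \<in> rel_lcs K T 0" "\<rho> y \<in> rel_lcs K (carrier K) c"
      using u' \<rho>M[OF y] by (simp_all add: M_def)
    from K.commutator_rel_lcs_lower_central[OF T_normal this]
    have "commutator K u (\<rho> y) \<in> rel_lcs K T (Suc c)" by simp
    then have "commutator K u (\<rho> y) \<in> rel_lcs K T c" by (rule subsetD[OF K.rel_lcs_Suc_subset[OF T_normal]])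
    from rel_lcs_retraction_in_D[OF this]
    have "inv\<^bsub>K\<^esub> (\<rho> (commutator K u (\<rho> y))) \<otimes>\<^bsub>K\<^esub> commutator K u (\<rho> y) \<in> D" .
    moreover have "\<rho> (commutator K u (\<rho> y)) = \<one>\<^bsub>K\<^esub>"
      using \<rho>.hom_commutator[OF uc \<rho>.hom_closed[OF Mc[OF y]]] u'(2) Mc[OF y] by (simp add: \<rho>_def)
    ultimately show ?thesis using uc Mc[OF y] by simp
  qed
  have "(\<lambda>x. D #>\<^bsub>K\<^esub> e x) \<in> hom (K\<lparr>carrier := M\<rparr>) ?ED"
  proof (rule homI)
    fix x assume "x \<in> carrier (K\<lparr>carrier := M\<rparr>)"
    then show "D #>\<^bsub>K\<^esub> e x \<in> carrier ?ED"
      unfolding E_mod_D_eq K.carrier_subquotient[OF E_mod_D_subquotient] using eE by auto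
  next
    fix x y assume "x \<in> carrier (K\<lparr>carrier := M\<rparr>)" "y \<in> carrier (K\<lparr>carrier := M\<rparr>)"
    then have xy: "x \<in> M" "y \<in> M" by simp_all
    have ec: "e x \<in> carrier K" "\<rho> y \<in> carrier K" "y \<in> carrier K" using Mc xy by (simp_all add: e_def)
    have comm: "(D #>\<^bsub>K\<^esub> e x) \<otimes>\<^bsub>K Mod D\<^esub> (D #>\<^bsub>K\<^esub> \<rho> y) = (D #>\<^bsub>K\<^esub> \<rho> y) \<otimes>\<^bsub>K Mod D\<^esub> (D #>\<^bsub>K\<^esub> e x)"
      using commE[OF eE[OF xy(1)] xy(2)] K.commutator_in_normal_iff[OF D_normal ec(1,2)] by blast
    have "e (x \<otimes>\<^bsub>K\<^esub> y) = inv\<^bsub>K\<^esub> (\<rho> y) \<otimes>\<^bsub>K\<^esub> e x \<otimes>\<^bsub>K\<^esub> y"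
      using Mc xy by (simp add: e_def K.word_simps)
    then have "D #>\<^bsub>K\<^esub> e (x \<otimes>\<^bsub>K\<^esub> y)
        = inv\<^bsub>K Mod D\<^esub> (D #>\<^bsub>K\<^esub> \<rho> y) \<otimes>\<^bsub>K Mod D\<^esub> (D #>\<^bsub>K\<^esub> e x) \<otimes>\<^bsub>K Mod D\<^esub> (D #>\<^bsub>K\<^esub> y)"
      using ec by simp
    also have "inv\<^bsub>K Mod D\<^esub> (D #>\<^bsub>K\<^esub> \<rho> y) \<otimes>\<^bsub>K Mod D\<^esub> (D #>\<^bsub>K\<^esub> e x)
        = (D #>\<^bsub>K\<^esub> e x) \<otimes>\<^bsub>K Mod D\<^esub> inv\<^bsub>K Mod D\<^esub> (D #>\<^bsub>K\<^esub> \<rho> y)"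
      using q.H.commute_inv[OF q.hom_closed[OF ec(1)] q.hom_closed[OF ec(2)] comm] by simp
    also have "\<dots> \<otimes>\<^bsub>K Mod D\<^esub> (D #>\<^bsub>K\<^esub> y) = D #>\<^bsub>K\<^esub> (e x \<otimes>\<^bsub>K\<^esub> e y)"
      using ec by (simp add: e_def[of y] q.H.m_assoc)
    finally show "D #>\<^bsub>K\<^esub> e (x \<otimes>\<^bsub>K\<lparr>carrier := M\<rparr>\<^esub> y) = (D #>\<^bsub>K\<^esub> e x) \<otimes>\<^bsub>?ED\<^esub> (D #>\<^bsub>K\<^esub> e y)"
      unfolding E_mod_D_eq K.mult_subquotient[OF E_mod_D_subquotient eE[OF xy(1)] eE[OF xy(2)]] by simp
  qed
  moreover have D_one: "D #>\<^bsub>K\<^esub> d = \<one>\<^bsub>?ED\<^esub>" if "d \<in> D" for d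
  proof -
    have "d \<in> carrier K" using normal_imp_subgroup[OF D_normal] that by (rule subgroup.mem_carrier)
    then show ?thesis
      unfolding E_mod_D_eq K.one_subquotient[OF E_mod_D_subquotient]
      using K.rcoset_eq_self_iff[OF D_normal] that by simp
  qed
  moreover have "D #>\<^bsub>K\<^esub> e x = \<one>\<^bsub>?ED\<^esub>" if "x \<in> rel_lcs K T c" for x
    using D_one rel_lcs_retraction_in_D[OF that] by (simp add: e_def)
  ultimately have "\<exists>\<epsilon>\<in>hom ((K\<lparr>carrier := M\<rparr>) Mod rel_lcs K T c) ?ED.
      \<forall>x\<in>M. \<epsilon> (rel_lcs K T c #>\<^bsub>K\<^esub> x) = D #>\<^bsub>K\<^esub> e x"
    by (intro K.subquotient_lift[OF MT group_E_mod_D])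
  then obtain \<epsilon> where \<epsilon>: "\<epsilon> \<in> hom ?BK ?ED"
      "\<And>x. x \<in> M \<Longrightarrow> \<epsilon> (rel_lcs K T c #>\<^bsub>K\<^esub> x) = D #>\<^bsub>K\<^esub> e x"
    unfolding K.nilpotent_baer_eq[OF T_normal] M_def by blast
  have "\<epsilon> ` carrier ?BK = carrier ?ED"
  proof
    show "\<epsilon> ` carrier ?BK \<subseteq> carrier ?ED" using \<epsilon>(1) by (auto simp: hom_def)
    show "carrier ?ED \<subseteq> \<epsilon> ` carrier ?BK"
    proof
      fix Y assume "Y \<in> carrier ?ED"
      then obtain y where y: "y \<in> E" "Y = D #>\<^bsub>K\<^esub> y"
        unfolding E_mod_D_eq K.carrier_subquotient[OF E_mod_D_subquotient] by blast
      have yM: "y \<in> M" and "\<rho> y = \<one>\<^bsub>K\<^esub>" using y(1) unfolding E_sub_eq M_def by (simp_all add: \<rho>_def)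
      then have "e y = y" using Mc[OF yM] by (simp add: e_def)
      then have "\<epsilon> (rel_lcs K T c #>\<^bsub>K\<^esub> y) = Y" using \<epsilon>(2)[OF yM] y(2) by simp
      then show "Y \<in> \<epsilon> ` carrier ?BK"
        unfolding K.carrier_baer[OF T_normal] using yM unfolding M_def by blast
    qed
  qed
  then have "\<epsilon> \<in> epi ?BK ?ED" using \<epsilon>(1) by (simp add: epi_def)
  moreover have "\<epsilon> (rel_lcs K T c #>\<^bsub>K\<^esub> x) = \<one>\<^bsub>?ED\<^esub>" if x: "x \<in> M \<inter> F'" for x
  proof -
    have "e x = \<one>\<^bsub>K\<^esub>" using \<rho>_F'[of x] Mc[of x] x by (simp add: e_def)
    moreover have "\<one>\<^bsub>K\<^esub> \<in> D" by (rule subgroup.one_closed[OF normal_imp_subgroup[OF D_normal]])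
    ultimately show ?thesis using \<epsilon>(2)[of x] x D_one[of "\<one>\<^bsub>K\<^esub>"] by simp
  qed
  ultimately show ?thesis unfolding M_def by blast
qed

end

end

section \<open>Quotients of finite abelian groups embed as subgroups\<close>

text \<open>By Bezout, \<open>x\<close> is a product of powers of \<open>x\<^sup>p\<close> and \<open>x\<^sup>i\<close> and their inverses.\<close>

lemma (in group) mem_subgroup_if_coprime_powers:
  assumes H: "subgroup H G" and x: "x \<in> carrier G" and p: "prime p" "\<not> p dvd i"
    and xp: "x [^] p \<in> H" and xi: "x [^] (i::nat) \<in> H"
  shows "x \<in> H"
proof -
  have pow: "y [^] (n::nat) \<in> H" if "y \<in> H" for y n
    using that subgroup.m_closed[OF H] subgroup.one_closed[OF H] by (induction n) auto
  have "coprime p i" using p by (rule prime_imp_coprime)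
  moreover have "i \<noteq> 0" using p(2) by (intro notI) simp
  ultimately obtain a b where ab: "i * a = p * b + 1"
    using bezout_nat[of i p] coprime_imp_gcd_eq_1[of p i] by (auto simp: gcd.commute[of i p])
  have "(x [^] i) [^] a = (x [^] p) [^] b \<otimes> x"
    using x ab by (simp add: nat_pow_pow)
  then have eq: "x = inv ((x [^] p) [^] b) \<otimes> (x [^] i) [^] a"
    using x by (simp add: inv_solve_left)
  show ?thesis
    by (rule ssubst[where P = "\<lambda>v. v \<in> H", OF eq])
       (rule subgroup.m_closed[OF H subgroup.m_inv_closed[OF H pow[OF xp]] pow[OF xi]])
qed

context comm_group
begin

lemma pow_image_subgroup: "subgroup ((\<lambda>x. x [^] (n::nat)) ` carrier G) G"
proof (rule subgroupI)
  fix a assume "a \<in> (\<lambda>x. x [^] n) ` carrier G"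
  then obtain x where x: "a = x [^] n" "x \<in> carrier G" by blast
  then have "inv a = (inv x) [^] n" by (simp add: nat_pow_inv)
  then show "inv a \<in> (\<lambda>x. x [^] n) ` carrier G" using x(2) by blast
next
  fix a b assume "a \<in> (\<lambda>x. x [^] n) ` carrier G" "b \<in> (\<lambda>x. x [^] n) ` carrier G"
  then obtain x y where x: "a = x [^] n" "x \<in> carrier G" "b = y [^] n" "y \<in> carrier G" by blast
  then have "a \<otimes> b = (x \<otimes> y) [^] n" by (simp add: nat_pow_distrib)
  then show "a \<otimes> b \<in> (\<lambda>x. x [^] n) ` carrier G" using x(2,4) by blast
qed auto

lemma powers_subgroup:
  assumes "finite (carrier G)" "y \<in> carrier G"
  shows "subgroup (range (\<lambda>i::nat. y [^] i)) G"
proof -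
  have "range (\<lambda>i::nat. y [^] i) = generate G {y}"
    unfolding generate_pow_on_finite_carrier[OF assms] by blast
  then show ?thesis using generate_is_subgroup[of "{y}"] assms(2) by simp
qed

text \<open>An element \<open>z\<close> of order \<open>p\<close> lies in a cyclic direct factor: write \<open>z = y\<^bsup>p\<^sup>k\<^esup>\<close> with \<open>k\<close> maximal,
  and let \<open>M\<close> be maximal among the subgroups that contain all \<open>p\<^bsup>k+1\<^esup>\<close>-th powers but not \<open>z\<close>.
  Such subgroups exist because \<open>z\<close> is not a \<open>p\<^bsup>k+1\<^esup>\<close>-th power.  If \<open>S = M \<langle>y\<rangle>\<close> were not the whole group, some
  \<open>g\<^sub>0 \<notin> S\<close> would satisfy \<open>g\<^sub>0\<^sup>p = m y\<^sup>i \<in> S\<close>.  If \<open>p\<close> does not divide \<open>i\<close>, raising this to the power \<open>p\<^sup>k\<close> puts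
  \<open>z\<^sup>i\<close>, and hence \<open>z\<close>, into \<open>M\<close>.  Otherwise \<open>g\<^sub>0\<close> can be modified by a power of \<open>y\<close> to \<open>g\<^sub>1 \<notin> S\<close> with \<open>g\<^sub>1\<^sup>p \<in> M\<close>;
  then \<open>z \<in> M \<langle>g\<^sub>1\<rangle>\<close> by maximality of \<open>M\<close>, which forces \<open>g\<^sub>1 \<in> S\<close>.\<close>

lemma cyclic_factor_through_order_p:
  assumes fin: "finite (carrier G)" and p: "prime p"
    and z: "z \<in> carrier G" "z \<noteq> \<one>" "z [^] p = \<one>"
  obtains k y M where "y \<in> carrier G" "ord y = p ^ Suc k" "z = y [^] (p ^ k)" "subgroup M G" "z \<notin> M"
    "\<And>g. g \<in> carrier G \<Longrightarrow> \<exists>m\<in>M. \<exists>i::nat. g = m \<otimes> y [^] i"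
proof -
  define K where "K = {k. \<exists>y\<in>carrier G. z = y [^] (p ^ k)}"
  have ord: "ord y = p ^ Suc k" if y: "y \<in> carrier G" "z = y [^] (p ^ k)" for y k
  proof -
    have "y [^] (p ^ Suc k) = \<one>" using y z(3) by (simp add: nat_pow_pow mult.commute)
    then have "ord y dvd p ^ Suc k" using y(1) by (simp only: pow_eq_id)
    moreover have "\<not> ord y dvd p ^ k" using y z(2) by (metis pow_eq_id)
    ultimately show ?thesis
      using p by (metis divides_primepow_nat dvd_refl le_SucE power_le_dvd le_imp_power_dvd)
  qed
  \<comment> \<open>An element \<open>y\<close> of order \<open>p\<^bsup>k+1\<^esup>\<close> forces \<open>k < p\<^sup>k \<le> |G|\<close>.\<close>
  have "K \<subseteq> {..order G}"
  proof
    fix k assume "k \<in> K"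
    then obtain y where y: "y \<in> carrier G" "z = y [^] (p ^ k)" by (auto simp: K_def)
    have "p ^ Suc k \<le> order G"
      using ord_dvd_group_order[OF y(1)] ord[OF y] fin by (intro dvd_imp_le) (auto simp: order_gt_0_iff_finite)
    moreover have "k < p ^ k" using prime_gt_1_nat[OF p] by (simp add: power_gt_expt)
    moreover have "p ^ k \<le> p ^ Suc k" using prime_ge_1_nat[OF p] by (intro power_increasing) simp_all
    ultimately show "k \<in> {..order G}" by (simp del: power_Suc)
  qed
  then have "finite K" by (rule finite_subset) simp
  moreover have "0 \<in> K" using z(1) by (auto simp: K_def intro!: bexI[of _ z])
  ultimately have k: "Max K \<in> K" "Suc (Max K) \<notin> K"
    by (auto intro: Max_in dest: Max_ge)
  define k where "k = Max K"
  obtain y where y: "y \<in> carrier G" "z = y [^] (p ^ k)" using k(1) by (auto simp: K_def k_def)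
  define Q where "Q = (\<lambda>x. x [^] (p ^ Suc k)) ` carrier G"
  have zQ: "z \<notin> Q" using k(2) by (auto simp: K_def k_def Q_def)
  define \<M> where "\<M> = {M. subgroup M G \<and> Q \<subseteq> M \<and> z \<notin> M}"
  have "\<M> \<subseteq> Pow (carrier G)" by (auto simp: \<M>_def dest: subgroup.mem_carrier)
  then have "finite \<M>" by (rule finite_subset) (simp add: fin)
  moreover have "Q \<in> \<M>" using zQ pow_image_subgroup by (auto simp: \<M>_def Q_def)
  ultimately obtain M where M: "M \<in> \<M>" and max: "\<And>H. H \<in> \<M> \<Longrightarrow> M \<subseteq> H \<Longrightarrow> M = H"
    using finite_has_maximal2[of \<M> Q] by metis
  have M_sub: "subgroup M G" and QM: "Q \<subseteq> M" and zM: "z \<notin> M" using M by (auto simp: \<M>_def)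
  have Mc: "m \<in> carrier G" if "m \<in> M" for m using M_sub that by (rule subgroup.mem_carrier)
  define S where "S = M <#> range (\<lambda>i::nat. y [^] i)"
  have S_iff: "g \<in> S \<longleftrightarrow> (\<exists>m\<in>M. \<exists>i::nat. g = m \<otimes> y [^] i)" for g by (auto simp: S_def set_mult_def)
  have S_sub: "subgroup S G" unfolding S_def by (rule mult_subgroups[OF M_sub powers_subgroup[OF fin y(1)]])
  have MS: "m \<in> S" if "m \<in> M" for m unfolding S_iff using that Mc[OF that] by (intro bexI[of _ m] exI[of _ 0]) auto
  have yS: "y [^] i \<in> S" for i :: nat
    unfolding S_iff using y(1) subgroup.one_closed[OF M_sub] by (intro bexI[of _ \<one>] exI[of _ i]) auto
  have "g \<in> S" if g: "g \<in> carrier G" for g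
  proof (rule ccontr)
    assume "g \<notin> S"
    have "g [^] (p ^ Suc k) \<in> S" using g QM MS by (auto simp: Q_def)
    then obtain j where j: "g [^] (p ^ j) \<in> S" "\<And>i. i < j \<Longrightarrow> g [^] (p ^ i) \<notin> S"
      using exists_least_iff[of "\<lambda>j. g [^] (p ^ j) \<in> S"] by blast
    have "j \<noteq> 0" using j(1) \<open>g \<notin> S\<close> g by (intro notI) simp
    then obtain j' where j': "j = Suc j'" by (cases j) auto
    define g0 where "g0 = g [^] (p ^ j')"
    have g0: "g0 \<in> carrier G" "g0 \<notin> S" "g0 [^] p \<in> S"
      using g j(1) j(2)[of j'] by (simp_all add: g0_def j' nat_pow_pow mult.commute)
    then obtain m and i :: nat where m: "m \<in> M" "g0 [^] p = m \<otimes> y [^] i" unfolding S_iff by blast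
    show False
    proof (cases "p dvd i")
      case True
      then obtain i' where i': "i = p * i'" by blast
      define g1 where "g1 = g0 \<otimes> inv (y [^] i')"
      have g1c: "g1 \<in> carrier G" using g0(1) y(1) by (simp add: g1_def)
      have "g1 [^] p = g0 [^] p \<otimes> inv (y [^] i)"
        using g0(1) y(1) by (simp add: g1_def nat_pow_distrib nat_pow_inv nat_pow_pow i' mult.commute)
      also have "\<dots> = m" using m Mc y(1) by (simp add: m_assoc)
      finally have g1p: "g1 [^] p \<in> M" using m(1) by simp
      have "g0 = g1 \<otimes> y [^] i'" using g0(1) y(1) by (simp add: g1_def m_assoc)
      then have g1S: "g1 \<notin> S" using g0(2) yS subgroup.m_closed[OF S_sub] by metis
      define H where "H = M <#> range (\<lambda>j::nat. g1 [^] j)"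
      have H_iff: "h \<in> H \<longleftrightarrow> (\<exists>m\<in>M. \<exists>i::nat. h = m \<otimes> g1 [^] i)" for h by (auto simp: H_def set_mult_def)
      have H_sub: "subgroup H G" unfolding H_def by (rule mult_subgroups[OF M_sub powers_subgroup[OF fin g1c]])
      have MH: "M \<subseteq> H" unfolding H_iff subset_iff using Mc by (metis r_one nat_pow_0)
      have "g1 \<in> H"
        unfolding H_iff using g1c subgroup.one_closed[OF M_sub] by (intro bexI[of _ \<one>] exI[of _ 1]) auto
      then have "M \<noteq> H" using g1S MS by auto
      then have "z \<in> H" using max[OF _ MH] H_sub MH QM by (auto simp: \<M>_def)
      then obtain h and l :: nat where h: "h \<in> M" "z = h \<otimes> g1 [^] l" unfolding H_iff by blast
      have "\<not> p dvd l"
      proof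
        assume "p dvd l"
        then obtain l' where "l = p * l'" by blast
        then have "g1 [^] l = (g1 [^] p) [^] l'" using g1c by (simp add: nat_pow_pow)
        moreover have "x [^] n \<in> M" if "x \<in> M" for x and n :: nat
          using that subgroup.m_closed[OF M_sub] subgroup.one_closed[OF M_sub] by (induction n) auto
        ultimately have "g1 [^] l \<in> M" using g1p by simp
        then show False using h zM subgroup.m_closed[OF M_sub] by simp
      qed
      moreover have "g1 [^] l = inv h \<otimes> z" using h Mc[OF h(1)] g1c z(1) by (simp add: inv_solve_left)
      then have "g1 [^] l \<in> S"
        using subgroup.m_closed[OF S_sub subgroup.m_inv_closed[OF S_sub MS[OF h(1)]]] yS[of "p ^ k"] y(2) by simp
      ultimately have "g1 \<in> S" using mem_subgroup_if_coprime_powers[OF S_sub g1c p _ MS[OF g1p]] by blast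
      then show False using g1S by simp
    next
      case False
      have "(g0 [^] p) [^] (p ^ k) = m [^] (p ^ k) \<otimes> (y [^] i) [^] (p ^ k)"
        unfolding m(2) using Mc[OF m(1)] y(1) by (simp add: nat_pow_distrib)
      also have "(y [^] i) [^] (p ^ k) = z [^] i" using y by (simp add: nat_pow_pow mult.commute)
      also have "(g0 [^] p) [^] (p ^ k) = g0 [^] (p ^ Suc k)" using g0(1) by (simp add: nat_pow_pow)
      finally have eq: "g0 [^] (p ^ Suc k) = m [^] (p ^ k) \<otimes> z [^] i" .
      have "m [^] n \<in> M" for n :: nat
        using m(1) subgroup.m_closed[OF M_sub] subgroup.one_closed[OF M_sub] by (induction n) auto
      moreover have "g0 [^] (p ^ Suc k) \<in> M" using g0(1) QM by (auto simp: Q_def)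
      moreover have "z [^] i = inv (m [^] (p ^ k)) \<otimes> g0 [^] (p ^ Suc k)"
        using eq Mc[OF m(1)] g0(1) z(1) by (simp add: inv_solve_left)
      ultimately have "z [^] i \<in> M" using subgroup.m_closed[OF M_sub] subgroup.m_inv_closed[OF M_sub] by simp
      then have "z \<in> M"
        using mem_subgroup_if_coprime_powers[OF M_sub z(1) p False] subgroup.one_closed[OF M_sub] z(3) by simp
      then show False using zM by simp
    qed
  qed
  then show ?thesis using that[OF y(1) ord[OF y] y(2) M_sub zM] S_iff by blast
qed

text \<open>In the decomposition \<open>M \<times> \<langle>y\<rangle>\<close>, apply the \<open>p\<close>-th power to the second factor: the elements of order \<open>p\<close> in
  \<open>\<langle>y\<rangle>\<close> are the nontrivial powers of \<open>z\<close>.\<close>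

lemma endomorphism_with_kernel_of_order_p:
  fixes p :: nat
  assumes fin: "finite (carrier G)" and p: "prime p"
    and z: "z \<in> carrier G" "z \<noteq> \<one>" "z [^] p = \<one>"
  shows "\<exists>\<phi>\<in>hom G G. kernel G G \<phi> = range (\<lambda>i::nat. z [^] i)"
proof -
  from cyclic_factor_through_order_p[OF assms] obtain k y M where
    y: "y \<in> carrier G" "ord y = p ^ Suc k" "z = y [^] (p ^ k)" and M_sub: "subgroup M G" and zM: "z \<notin> M"
    and dec: "\<And>g. g \<in> carrier G \<Longrightarrow> \<exists>m\<in>M. \<exists>i::nat. g = m \<otimes> y [^] i" by metis
  have Mc: "m \<in> carrier G" if "m \<in> M" for m using M_sub that by (rule subgroup.mem_carrier)
  have Mpow: "x [^] n \<in> M" if "x \<in> M" for x and n :: nat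
    using that subgroup.m_closed[OF M_sub] subgroup.one_closed[OF M_sub] by (induction n) auto
  \<comment> \<open>Every nontrivial subgroup of the cyclic \<open>p\<close>-group \<open>\<langle>y\<rangle>\<close> contains \<open>z\<close>, so \<open>\<langle>y\<rangle>\<close> meets \<open>M\<close> trivially.\<close>
  have disjoint: "y [^] n = \<one>" if "y [^] n \<in> M" for n :: nat
  proof (rule ccontr)
    assume "y [^] n \<noteq> \<one>"
    then have n: "\<not> p ^ Suc k dvd n" using y by (simp add: pow_eq_id)
    then have "n \<noteq> 0" by (intro notI) simp
    moreover have "\<not> is_unit p" using p by auto
    ultimately obtain e u where u: "n = p ^ e * u" "\<not> p dvd u"
      using multiplicity_decompose'[of n p] by metis
    have le: "e \<le> k"
    proof (rule ccontr)
      assume "\<not> e \<le> k"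
      then have "p ^ Suc k dvd p ^ e" by (intro le_imp_power_dvd) simp
      then show False using n u(1) by (simp del: power_Suc)
    qed
    have "(y [^] n) [^] (p ^ (k - e)) = y [^] (p ^ e * p ^ (k - e) * u)"
      unfolding u(1) using y(1) by (simp add: nat_pow_pow mult_ac)
    also have "p ^ e * p ^ (k - e) = p ^ k"
      using le by (simp flip: power_add)
    also have "y [^] (p ^ k * u) = z [^] u" using y(1) by (simp add: y(3) nat_pow_pow)
    finally have "z [^] u \<in> M" using Mpow[OF that] by metis
    then have "z \<in> M"
      using mem_subgroup_if_coprime_powers[OF M_sub z(1) p u(2)] z(3) subgroup.one_closed[OF M_sub] by simp
    then show False using zM by simp
  qed
  have unique: "m = m' \<and> y [^] i = y [^] j" if "m \<in> M" "m' \<in> M" "m \<otimes> y [^] i = m' \<otimes> y [^] j"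
    for m m' and i j :: nat
  proof -
    have c: "m \<in> carrier G" "m' \<in> carrier G" using that Mc by auto
    \<comment> \<open>The exponent is chosen such that \<open>y\<^sup>l\<close> is the inverse of \<open>y\<^sup>j\<close>.\<close>
    define l where "l = (p ^ Suc k - 1) * j"
    have "l + j = p ^ Suc k * j" using prime_gt_0_nat[OF p] by (simp add: l_def algebra_simps flip: add_mult_distrib)
    then have "y [^] l \<otimes> y [^] j = \<one>"
      using y(1,2) by (simp add: nat_pow_mult pow_eq_id)
    then have l: "y [^] l = inv (y [^] j)" using y(1) by (intro inv_equality[symmetric]) auto
    have "y [^] (i + l) = inv m \<otimes> m'"
    proof -
      have "y [^] (i + l) = y [^] i \<otimes> inv (y [^] j)" using y(1) by (simp add: l flip: nat_pow_mult)
      also have "y [^] i = inv m \<otimes> (m' \<otimes> y [^] j)" using that(3) c y(1) by (simp add: inv_solve_left)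
      finally show ?thesis using c y(1) by (simp add: m_assoc)
    qed
    then have 1: "y [^] (i + l) = \<one>" using disjoint[of "i + l"] that M_sub
      by (simp add: subgroup.m_closed subgroup.m_inv_closed)
    then have "y [^] i \<otimes> inv (y [^] j) = \<one>" using y(1) by (simp add: l flip: nat_pow_mult)
    then have "y [^] i = y [^] j" using y(1) by (metis inv_equality inv_inv inv_closed nat_pow_closed)
    moreover from this have "m = m'" using that(3) c y(1) by simp
    ultimately show ?thesis by simp
  qed
  \<comment> \<open>The decomposition \<open>g = m y\<^sup>i\<close> is chosen; only \<open>i\<close> modulo the order of \<open>y\<close> is determined, which suffices for \<open>\<phi>\<close>.\<close>
  define r where "r g = (SOME (m, i::nat). m \<in> M \<and> g = m \<otimes> y [^] i)" for g
  define \<phi> where "\<phi> g = (case r g of (m, i) \<Rightarrow> m \<otimes> (y [^] i) [^] p)" for g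
  have \<phi>: "\<phi> (m \<otimes> y [^] i) = m \<otimes> (y [^] i) [^] p" if m: "m \<in> M" for m and i :: nat
  proof -
    have "case r (m \<otimes> y [^] i) of (m', j) \<Rightarrow> m' \<in> M \<and> m \<otimes> y [^] i = m' \<otimes> y [^] j"
      unfolding r_def by (rule someI[of _ "(m, i)"]) (use m in auto)
    then obtain m' j where "r (m \<otimes> y [^] i) = (m', j)" "m' \<in> M" "m \<otimes> y [^] i = m' \<otimes> y [^] j"
      by (auto split: prod.splits)
    moreover from this have "m = m'" "y [^] i = y [^] j" using unique[OF m] by blast+
    ultimately show ?thesis by (simp add: \<phi>_def)
  qed
  have "\<phi> \<in> hom G G"
  proof (rule homI)
    fix g assume "g \<in> carrier G"
    then obtain m and i :: nat where "m \<in> M" "g = m \<otimes> y [^] i" using dec by blast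
    then show "\<phi> g \<in> carrier G" using \<phi> Mc y(1) by simp
  next
    fix g h assume "g \<in> carrier G" "h \<in> carrier G"
    then obtain m m' and i j :: nat where gh: "m \<in> M" "g = m \<otimes> y [^] i" "m' \<in> M" "h = m' \<otimes> y [^] j"
      using dec by metis
    have "g \<otimes> h = (m \<otimes> m') \<otimes> y [^] (i + j)"
      using gh Mc y(1) by (simp add: m_ac flip: nat_pow_mult)
    then have "\<phi> (g \<otimes> h) = (m \<otimes> m') \<otimes> (y [^] (i + j)) [^] p"
      using \<phi>[OF subgroup.m_closed[OF M_sub gh(1,3)]] by simp
    also have "\<dots> = (m \<otimes> (y [^] i) [^] p) \<otimes> (m' \<otimes> (y [^] j) [^] p)"
      using gh Mc y(1) by (simp add: m_ac nat_pow_distrib flip: nat_pow_mult)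
    finally show "\<phi> (g \<otimes> h) = \<phi> g \<otimes> \<phi> h" using gh \<phi> by simp
  qed
  moreover have "kernel G G \<phi> = range (\<lambda>i::nat. z [^] i)"
  proof (intro equalityI subsetI)
    fix g assume "g \<in> kernel G G \<phi>"
    then have g: "g \<in> carrier G" "\<phi> g = \<one>" by (auto simp: kernel_def)
    then obtain m and i :: nat where mi: "m \<in> M" "g = m \<otimes> y [^] i" using dec by blast
    have "m \<otimes> y [^] (i * p) = \<one> \<otimes> y [^] (0::nat)" using g(2) mi \<phi> y(1) by (simp add: nat_pow_pow)
    then have "m = \<one>" "y [^] (i * p) = \<one>"
      using unique[OF mi(1) subgroup.one_closed[OF M_sub], of "i * p" 0] by auto
    then have "p ^ Suc k dvd i * p" using y by (simp add: pow_eq_id)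
    then obtain l where "i = p ^ k * l" using prime_gt_0_nat[OF p] by (auto simp: mult.commute elim: dvdE)
    then have "g = z [^] l" using mi \<open>m = \<one>\<close> y(1) by (simp add: y(3) nat_pow_pow)
    then show "g \<in> range (\<lambda>i::nat. z [^] i)" by simp
  next
    fix g assume "g \<in> range (\<lambda>i::nat. z [^] i)"
    then obtain i :: nat where g: "g = z [^] i" by blast
    have "g = \<one> \<otimes> y [^] (p ^ k * i)" using y(1) by (simp add: g y(3) nat_pow_pow)
    then have "\<phi> g = (y [^] (p ^ k * i)) [^] p" using \<phi>[OF subgroup.one_closed[OF M_sub]] y(1) by simp
    also have "\<dots> = \<one>" using y(1,2) by (simp add: nat_pow_pow pow_eq_id)
    finally show "g \<in> kernel G G \<phi>" using g z(1) by (simp add: kernel_def)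
  qed
  ultimately show ?thesis by blast
qed

text \<open>An endomorphism \<open>\<phi>\<close> whose kernel is a subgroup of prime order of \<open>N\<close> makes \<open>\<phi>(N)\<close> smaller than \<open>N\<close>, and if
  \<open>\<psi>\<close> has kernel \<open>\<phi>(N)\<close>, then \<open>\<psi> \<circ> \<phi>\<close> has kernel \<open>N\<close>.\<close>

lemma endomorphism_with_kernel:
  assumes fin: "finite (carrier G)"
  shows "subgroup N G \<Longrightarrow> \<exists>\<psi>\<in>hom G G. kernel G G \<psi> = N"
proof (induction "card N" arbitrary: N rule: less_induct)
  case less
  have Nc: "x \<in> carrier G" if "x \<in> N" for x using less.prems that by (rule subgroup.mem_carrier)
  have finN: "finite N" using Nc fin by (auto intro: finite_subset)
  show ?case
  proof (cases "N = {\<one>}")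
    case True
    then show ?thesis by (intro bexI[of _ "\<lambda>x. x"]) (auto simp: kernel_def hom_def)
  next
    case False
    then obtain x where x: "x \<in> N" "x \<noteq> \<one>" using subgroup.one_closed[OF less.prems] by blast
    have "ord x \<noteq> 1" using x Nc ord_eq_1 by blast
    then obtain p where p: "prime p" "p dvd ord x" using prime_factor_nat by blast
    obtain q where q: "ord x = p * q" using p(2) by blast
    have ox: "ord x \<noteq> 0" using ord_ge_1[OF fin Nc[OF x(1)]] by simp
    define z where "z = x [^] q"
    have Npow: "x [^] n \<in> N" if "x \<in> N" for x and n :: nat
      using that subgroup.m_closed[OF less.prems] subgroup.one_closed[OF less.prems] by (induction n) auto
    have z: "z \<in> N" "z [^] p = \<one>" using x(1) Nc[OF x(1)] Npow
      by (auto simp: z_def nat_pow_pow pow_eq_id q mult.commute)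
    have "\<not> p * q dvd q" using ox q prime_gt_1_nat[OF p(1)] by (auto dest: dvd_imp_le)
    then have "z \<noteq> \<one>" using Nc[OF x(1)] by (simp add: z_def pow_eq_id q)
    from endomorphism_with_kernel_of_order_p[OF fin p(1) Nc[OF z(1)] this z(2)] obtain \<phi>
      where \<phi>: "\<phi> \<in> hom G G" "kernel G G \<phi> = range (\<lambda>i::nat. z [^] i)" by blast
    interpret \<phi>: group_hom G G \<phi> using \<phi>(1) by (simp add: group_hom_def group_hom_axioms_def is_group)
    have kerN: "kernel G G \<phi> \<subseteq> N" using \<phi>(2) Npow[OF z(1)] by auto
    have "\<not> inj_on \<phi> N"
    proof
      have "\<phi> z = \<one>" using \<phi>(2) rangeI[of "\<lambda>i::nat. z [^] i" 1] Nc[OF z(1)] by (auto simp: kernel_def)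
      moreover assume "inj_on \<phi> N"
      ultimately show False
        using z(1) \<open>z \<noteq> \<one>\<close> subgroup.one_closed[OF less.prems] \<phi>.hom_one by (metis inj_on_eq_iff)
    qed
    then have "card (\<phi> ` N) < card N" using finN
      by (metis card_image_le eq_card_imp_inj_on le_neq_implies_less)
    from less.hyps[OF this \<phi>.subgroup_img_is_subgroup[OF less.prems]] obtain \<psi>
      where \<psi>: "\<psi> \<in> hom G G" "kernel G G \<psi> = \<phi> ` N" by blast
    have "kernel G G (\<lambda>x. \<psi> (\<phi> x)) = N"
    proof (intro equalityI subsetI)
      fix x assume "x \<in> kernel G G (\<lambda>x. \<psi> (\<phi> x))"
      then have x: "x \<in> carrier G" "\<phi> x \<in> kernel G G \<psi>" by (auto simp: kernel_def)
      then obtain n where n: "n \<in> N" "\<phi> x = \<phi> n" using \<psi>(2) by auto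
      have "x \<otimes> inv n \<in> kernel G G \<phi>" using x n Nc by (simp add: kernel_def)
      then have "x \<otimes> inv n \<otimes> n \<in> N" using kerN n(1) subgroup.m_closed[OF less.prems] by blast
      then show "x \<in> N" using x(1) Nc[OF n(1)] by (simp add: m_assoc)
    next
      fix x assume x: "x \<in> N"
      then have "\<phi> x \<in> kernel G G \<psi>" using \<psi>(2) by auto
      then show "x \<in> kernel G G (\<lambda>x. \<psi> (\<phi> x))" using Nc[OF x] by (simp add: kernel_def)
    qed
    moreover have "(\<lambda>x. \<psi> (\<phi> x)) \<in> hom G G"
      using Group.hom_compose[OF \<phi>(1) \<psi>(1)] by (simp add: comp_def)
    ultimately show ?thesis by (intro bexI)
  qed
qed

text \<open>The image of an endomorphism with the same kernel as \<open>h\<close> is isomorphic to \<open>T\<close>.\<close>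

lemma quotient_iso_subgroup:
  assumes fin: "finite (carrier G)" and T: "group T" and h: "h \<in> epi G T"
  shows "\<exists>H. subgroup H G \<and> T \<cong> G\<lparr>carrier := H\<rparr>"
proof -
  have hh: "h \<in> hom G T" "h ` carrier G = carrier T" using h by (auto simp: epi_def)
  interpret h: group_hom G T h using hh(1) T by (simp add: group_hom_def group_hom_axioms_def is_group)
  obtain \<psi> where \<psi>: "\<psi> \<in> hom G G" "kernel G G \<psi> = kernel G T h"
    using endomorphism_with_kernel[OF fin h.subgroup_kernel] by blast
  interpret \<psi>: group_hom G G \<psi> using \<psi>(1) by (simp add: group_hom_def group_hom_axioms_def is_group)
  have sub: "subgroup (\<psi> ` carrier G) G" by (rule \<psi>.img_is_subgroup)
  let ?I = "G\<lparr>carrier := \<psi> ` carrier G\<rparr>"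
  have "\<psi> \<in> hom G ?I" by (rule homI) auto
  then have "group_hom G ?I \<psi>"
    using subgroup_imp_group[OF sub] by (simp add: group_hom_def group_hom_axioms_def is_group)
  then have "G Mod kernel G ?I \<psi> \<cong> ?I" by (rule group_hom.FactGroup_iso) simp
  moreover have "kernel G ?I \<psi> = kernel G T h" using \<psi>(2) by (simp add: kernel_def)
  moreover have "G Mod kernel G T h \<cong> T" using h.FactGroup_iso hh(2) by blast
  then have "T \<cong> G Mod kernel G T h"
    using group.iso_sym[OF normal.factorgroup_is_group[OF h.normal_kernel]] by blast
  ultimately have "T \<cong> ?I" using iso_trans by metis
  then show ?thesis using sub by blast
qed

end

section \<open>The presentation of the free wreath product\<close>

context
  fixes P :: "('p, 'mp) monoid_scheme" and G :: "('g, 'mg) monoid_scheme" and \<pi> R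
  assumes proj: "projection_with_kernel P G \<pi> R"
begin

lemma projection_hom: "group_hom P G \<pi>"
  and projection_surj: "\<pi> ` carrier P = carrier G"
  and projection_kernel: "kernel P G \<pi> = R"
  using proj by (simp_all add: projection_with_kernel_def)

lemma projection_kernel_iff: "x \<in> carrier P \<Longrightarrow> x \<in> R \<longleftrightarrow> \<pi> x = \<one>\<^bsub>G\<^esub>"
  by (simp add: projection_kernel[symmetric] kernel_def)

lemma projection_kernel_normal: "R \<lhd> P"
  using group_hom.normal_kernel[OF projection_hom] by (simp add: projection_kernel)

lemma projection_kernel_mem: "x \<in> R \<Longrightarrow> x \<in> carrier P" "x \<in> R \<Longrightarrow> \<pi> x = \<one>\<^bsub>G\<^esub>"
  by (auto simp: projection_kernel[symmetric] kernel_def)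

lemma projection_rcoset_eq:
  assumes "x \<in> carrier P" "y \<in> carrier P" "\<pi> x = \<pi> y"
  shows "R #>\<^bsub>P\<^esub> x = R #>\<^bsub>P\<^esub> y"
proof -
  interpret \<pi>: group_hom P G \<pi> by (rule projection_hom)
  have "x \<otimes>\<^bsub>P\<^esub> inv\<^bsub>P\<^esub> y \<in> R" using assms by (simp add: projection_kernel_iff)
  then show ?thesis using \<pi>.G.rcoset_eq_iff[OF projection_kernel_normal assms(1,2)] by simp
qed

lemma projection_factor:
  assumes g: "group_hom P X g" and ker: "\<And>x. x \<in> R \<Longrightarrow> g x = \<one>\<^bsub>X\<^esub>"
  shows "\<exists>\<alpha>. group_hom G X \<alpha> \<and> (\<forall>x\<in>carrier P. \<alpha> (\<pi> x) = g x)"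
proof -
  interpret \<pi>: group_hom P G \<pi> by (rule projection_hom)
  interpret g: group_hom P X g by (rule g)
  have eq: "g x = g y" if xy: "x \<in> carrier P" "y \<in> carrier P" "\<pi> x = \<pi> y" for x y
  proof -
    have "inv\<^bsub>P\<^esub> x \<otimes>\<^bsub>P\<^esub> y \<in> R" using xy by (simp add: projection_kernel_iff)
    then have "inv\<^bsub>X\<^esub> g x \<otimes>\<^bsub>X\<^esub> g y = \<one>\<^bsub>X\<^esub>" using ker xy by (metis g.hom_inv g.hom_mult \<pi>.G.inv_closed)
    then show ?thesis using g.H.inv_mult_eq_one_iff xy by simp
  qed
  define \<alpha> where "\<alpha> a = g (inv_into (carrier P) \<pi> a)" for a
  have \<alpha>: "\<alpha> (\<pi> x) = g x" if x: "x \<in> carrier P" for x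
  proof -
    have "\<pi> x \<in> \<pi> ` carrier P" using x by simp
    then show ?thesis unfolding \<alpha>_def using x by (intro eq inv_into_into f_inv_into_f)
  qed
  have "\<alpha> \<in> hom G X"
  proof (rule homI)
    fix a assume "a \<in> carrier G"
    then obtain x where "a = \<pi> x" "x \<in> carrier P" using projection_surj by blast
    then show "\<alpha> a \<in> carrier X" using \<alpha> by simp
  next
    fix a b assume "a \<in> carrier G" "b \<in> carrier G"
    then obtain x y where xy: "a = \<pi> x" "x \<in> carrier P" "b = \<pi> y" "y \<in> carrier P" using projection_surj by blast
    then show "\<alpha> (a \<otimes>\<^bsub>G\<^esub> b) = \<alpha> a \<otimes>\<^bsub>X\<^esub> \<alpha> b"
      using \<alpha>[of "x \<otimes>\<^bsub>P\<^esub> y"] \<alpha>[OF xy(2)] \<alpha>[OF xy(4)] by simp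
  qed
  then show ?thesis using \<alpha> group_homI[OF \<pi>.H.is_group g.H.is_group] by blast
qed

end

text \<open>The lift exists by projectivity of \<open>P\<close>; it maps \<open>R\<close> into \<open>S\<close> because it covers a homomorphism of the
  presented groups.\<close>

lemma presentation_lift:
  assumes "is_free P" and P: "projection_with_kernel P G \<pi> R" and Q: "projection_with_kernel Q H \<pi>' S"
    and f: "group_hom G H f"
  shows "\<exists>u. group_hom P Q u \<and> (\<forall>x\<in>carrier P. \<pi>' (u x) = f (\<pi> x)) \<and> u ` R \<subseteq> S"
proof -
  interpret \<pi>: group_hom P G \<pi> by (rule projection_hom[OF P])
  interpret f: group_hom G H f by (rule f)
  have "group_hom P H (\<lambda>x. f (\<pi> x))" by (intro group_homI homI \<pi>.G.is_group f.H.is_group) simp_all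
  from free_group_lift[OF assms(1) projection_hom[OF Q] projection_surj[OF Q] this]
  obtain u where u: "group_hom P Q u" "\<And>x. x \<in> carrier P \<Longrightarrow> \<pi>' (u x) = f (\<pi> x)" by blast
  have "u x \<in> S" if "x \<in> R" for x
    using projection_kernel_mem[OF P that] u(2) projection_kernel_iff[OF Q, of "u x"]
      group_hom.hom_closed[OF u(1), of x] by simp
  then show ?thesis using u by blast
qed

lemma group_hom_compose:
  "group_hom P Q u \<Longrightarrow> group_hom Q H v \<Longrightarrow> group_hom P H (\<lambda>x. v (u x))"
  using Group.hom_compose[of u P Q v H] by (simp add: group_hom_def group_hom_axioms_def comp_def)

lemma lift_cong:
  assumes Q: "projection_with_kernel Q H \<pi> S" and f: "group_hom P Q f" and g: "group_hom P Q g"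
    and eq: "\<And>x. x \<in> carrier P \<Longrightarrow> \<pi> (f x) = \<pi> (g x)" and x: "x \<in> rel_lcs P (carrier P) c"
  shows "rel_lcs Q S c #>\<^bsub>Q\<^esub> f x = rel_lcs Q S c #>\<^bsub>Q\<^esub> g x"
proof (rule hom_cong_rel_lcs[OF f g projection_kernel_normal[OF Q] _ x])
  fix p assume p: "p \<in> carrier P"
  show "S #>\<^bsub>Q\<^esub> f p = S #>\<^bsub>Q\<^esub> g p"
    by (rule projection_rcoset_eq[OF Q group_hom.hom_closed[OF f p] group_hom.hom_closed[OF g p] eq[OF p]])
qed

text \<open>Presenting only the factor \<open>A\<close> of the free wreath product presents the wreath product as \<open>K/R\<^sup>K\<close>.  This is where
  its universal property as a free product \<open>A * B\<close> is used: the homomorphisms \<open>A \<rightarrow> K/R\<^sup>K\<close> and \<open>B \<rightarrow> K/R\<^sup>K\<close>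
  combine to an inverse of the induced map from \<open>K/R\<^sup>K\<close>.\<close>

lemma (in relative_product) wreath_projection:
  assumes A: "group A" and p: "projection_with_kernel F A p R"
  shows "\<exists>\<kappa>. projection_with_kernel K (free_wreath A B) \<kappa> T \<and>
    (\<forall>x\<in>carrier F. \<kappa> (i1 x) = wreath_inl A B (p x)) \<and> (\<forall>y\<in>carrier B. \<kappa> (i2 y) = wreath_inr A B y)"
proof -
  let ?W = "free_wreath A B"
  have W: "group ?W" by (rule group_free_wreath[OF A B.is_group])
  interpret p: group_hom F A p by (rule projection_hom[OF p])
  interpret wl: group_hom A ?W "wreath_inl A B" by (rule group_homI[OF A W wreath_inl_hom[OF A B.is_group]])
  interpret wr: group_hom B ?W "wreath_inr A B" by (rule group_homI[OF B.is_group W wreath_inr_hom[OF A B.is_group]])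
  have "group_hom F ?W (\<lambda>x. wreath_inl A B (p x))" by (intro group_homI homI F.is_group W) simp_all
  from free_prod2_lift[OF F.is_group B.is_group this wr.group_hom_axioms]
  obtain \<kappa> where \<kappa>: "group_hom K ?W \<kappa>" "\<And>x. x \<in> carrier F \<Longrightarrow> \<kappa> (i1 x) = wreath_inl A B (p x)"
    "\<And>y. y \<in> carrier B \<Longrightarrow> \<kappa> (i2 y) = wreath_inr A B y" by blast
  interpret \<kappa>: group_hom K ?W \<kappa> by (rule \<kappa>(1))
  have gens: "wreath_inl A B ` carrier A \<union> wreath_inr A B ` carrier B \<subseteq> \<kappa> ` carrier K"
  proof -
    have "wreath_inl A B a \<in> \<kappa> ` carrier K" if "a \<in> carrier A" for a
    proof -
      from that have "a \<in> p ` carrier F" unfolding projection_surj[OF p] .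
      then obtain x where x: "a = p x" "x \<in> carrier F" by (rule imageE)
      show ?thesis unfolding x(1) \<kappa>(2)[OF x(2), symmetric] using i1.hom_closed[OF x(2)] by (rule imageI)
    qed
    moreover have "wreath_inr A B b \<in> \<kappa> ` carrier K" if "b \<in> carrier B" for b
      unfolding \<kappa>(3)[OF that, symmetric] using i2.hom_closed[OF that] by (rule imageI)
    ultimately show ?thesis by (intro Un_least image_subsetI)
  qed
  have surj: "\<kappa> ` carrier K = carrier ?W"
  proof
    show "\<kappa> ` carrier K \<subseteq> carrier ?W" by (rule subgroup.subset[OF \<kappa>.img_is_subgroup])
    show "carrier ?W \<subseteq> \<kappa> ` carrier K"
      unfolding carrier_free_wreath_generate[OF A B.is_group]
      by (rule group.generate_subgroup_incl[OF W gens \<kappa>.img_is_subgroup])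
  qed
  interpret q: group_hom K "K Mod T" "\<lambda>x. T #>\<^bsub>K\<^esub> x" by (rule K.quotient_hom[OF T_normal])
  have T_one: "T #>\<^bsub>K\<^esub> x = \<one>\<^bsub>K Mod T\<^esub> \<longleftrightarrow> x \<in> T" if "x \<in> carrier K" for x
    unfolding one_FactGroup by (rule K.rcoset_eq_self_iff[OF T_normal that])
  have ker: "T \<subseteq> kernel K ?W \<kappa>"
  proof (rule K.normal_closure_least[OF \<kappa>.normal_kernel])
    have "i1 r \<in> kernel K ?W \<kappa>" if "r \<in> R" for r
      using projection_kernel_mem[OF p that] \<kappa>(2)[of r] by (simp add: kernel_def)
    then show "R' \<subseteq> kernel K ?W \<kappa>" by blast
  qed
  \<comment> \<open>The quotient map \<open>K \<rightarrow> K/R\<^sup>K\<close> factors through \<open>\<kappa>\<close>, by the universal property of the wreath product.\<close>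
  have "\<exists>\<alpha>. group_hom A (K Mod T) \<alpha> \<and> (\<forall>x\<in>carrier F. \<alpha> (p x) = T #>\<^bsub>K\<^esub> i1 x)"
  proof (rule projection_factor[OF p])
    show "group_hom F (K Mod T) (\<lambda>x. T #>\<^bsub>K\<^esub> i1 x)" by (intro group_homI homI F.is_group q.H.is_group) simp_all
    show "T #>\<^bsub>K\<^esub> i1 x = \<one>\<^bsub>K Mod T\<^esub>" if "x \<in> R" for x
    proof -
      have "i1 x \<in> T" by (rule subsetD[OF K.subset_normal_closure]) (use that in simp)
      then show ?thesis using T_one[of "i1 x"] T_subset[of "i1 x"] by simp
    qed
  qed
  then obtain \<alpha> where \<alpha>: "group_hom A (K Mod T) \<alpha>" "\<And>x. x \<in> carrier F \<Longrightarrow> \<alpha> (p x) = T #>\<^bsub>K\<^esub> i1 x" by blast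
  have "group_hom B (K Mod T) (\<lambda>y. T #>\<^bsub>K\<^esub> i2 y)" by (intro group_homI homI B.is_group q.H.is_group) simp_all
  from free_wreath_lift[OF A B.is_group \<alpha>(1) this] obtain \<theta> where \<theta>: "group_hom ?W (K Mod T) \<theta>"
     "\<And>x. x \<in> carrier A \<Longrightarrow> \<theta> (wreath_inl A B x) = \<alpha> x"
     "\<And>y. y \<in> carrier B \<Longrightarrow> \<theta> (wreath_inr A B y) = T #>\<^bsub>K\<^esub> i2 y" by blast
  interpret \<theta>: group_hom ?W "K Mod T" \<theta> by (rule \<theta>(1))
  have \<theta>\<kappa>: "group_hom K (K Mod T) (\<lambda>x. \<theta> (\<kappa> x))" by (intro group_homI homI K.is_group q.H.is_group) simp_all
  have \<theta>\<kappa>_eq: "\<theta> (\<kappa> x) = T #>\<^bsub>K\<^esub> x" if "x \<in> carrier K" for x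
  proof (rule hom_eq_on_generators[OF \<theta>\<kappa> q.group_hom_axioms generators(2) _ _ that])
    show "s \<in> carrier K" if "s \<in> F' \<union> B'" for s by (rule subsetD[OF generators(1) that])
    show "\<theta> (\<kappa> s) = T #>\<^bsub>K\<^esub> s" if "s \<in> F' \<union> B'" for s
      using that
    proof
      assume "s \<in> F'"
      then obtain f where f: "s = i1 f" "f \<in> carrier F" by blast
      then show ?thesis using \<kappa>(2)[OF f(2)] \<theta>(2)[of "p f"] \<alpha>(2)[OF f(2)] by simp
    next
      assume "s \<in> B'"
      then obtain b where b: "s = i2 b" "b \<in> carrier B" by blast
      then show ?thesis using \<kappa>(3)[OF b(2)] \<theta>(3)[OF b(2)] by simp
    qed
  qed
  have "x \<in> T" if "x \<in> kernel K ?W \<kappa>" for x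
    using that \<theta>\<kappa>_eq[of x] T_one[of x] by (simp add: kernel_def)
  then have "kernel K ?W \<kappa> \<subseteq> T" by blast
  then have "projection_with_kernel K ?W \<kappa> T"
    unfolding projection_with_kernel_def using \<kappa>(1) surj ker by blast
  then show ?thesis using \<kappa>(2,3) by blast
qed

section \<open>The epimorphism\<close>

text \<open>Values in the first two factors can be corrected by means of sections that the other
  components do not see, so surjectivity onto the third factor suffices.\<close>

lemma epi_DirProd3_if_sections:
  assumes G: "group G" and X: "group X" and Y: "group Y" and Z: "group Z"
    and h: "hX \<in> hom G X" "hY \<in> hom G Y" "hZ \<in> epi G Z"
    and sX: "\<And>x. x \<in> carrier X \<Longrightarrow> \<exists>g\<in>carrier G. hX g = x \<and> hY g = \<one>\<^bsub>Y\<^esub> \<and> hZ g = \<one>\<^bsub>Z\<^esub>"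
    and sY: "\<And>y. y \<in> carrier Y \<Longrightarrow> \<exists>g\<in>carrier G. hX g = \<one>\<^bsub>X\<^esub> \<and> hY g = y \<and> hZ g = \<one>\<^bsub>Z\<^esub>"
  shows "(\<lambda>g. (hX g, (hY g, hZ g))) \<in> epi G (X \<times>\<times> (Y \<times>\<times> Z))"
proof -
  have hZ: "hZ \<in> hom G Z" "hZ ` carrier G = carrier Z" using h(3) by (simp_all add: epi_def)
  interpret hX: group_hom G X hX by (rule group_homI[OF G X h(1)])
  interpret hY: group_hom G Y hY by (rule group_homI[OF G Y h(2)])
  interpret hZ: group_hom G Z hZ by (rule group_homI[OF G Z hZ(1)])
  let ?h = "\<lambda>g. (hX g, (hY g, hZ g))"
  have hom: "?h \<in> hom G (X \<times>\<times> (Y \<times>\<times> Z))" by (rule homI) simp_all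
  have "(x, y, z) \<in> ?h ` carrier G" if xyz: "x \<in> carrier X" "y \<in> carrier Y" "z \<in> carrier Z" for x y z
  proof -
    from xyz(3) have "z \<in> hZ ` carrier G" unfolding hZ(2) .
    then obtain g where g: "z = hZ g" "g \<in> carrier G" by (rule imageE)
    have "x \<otimes>\<^bsub>X\<^esub> inv\<^bsub>X\<^esub> hX g \<in> carrier X" using xyz(1) g(2) by simp
    from sX[OF this] obtain a where a: "a \<in> carrier G"
      "hX a = x \<otimes>\<^bsub>X\<^esub> inv\<^bsub>X\<^esub> hX g \<and> hY a = \<one>\<^bsub>Y\<^esub> \<and> hZ a = \<one>\<^bsub>Z\<^esub>" by (rule bexE)
    have "y \<otimes>\<^bsub>Y\<^esub> inv\<^bsub>Y\<^esub> hY g \<in> carrier Y" using xyz(2) g(2) by simp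
    from sY[OF this] obtain b where b: "b \<in> carrier G"
      "hX b = \<one>\<^bsub>X\<^esub> \<and> hY b = y \<otimes>\<^bsub>Y\<^esub> inv\<^bsub>Y\<^esub> hY g \<and> hZ b = \<one>\<^bsub>Z\<^esub>" by (rule bexE)
    have "?h (a \<otimes>\<^bsub>G\<^esub> b \<otimes>\<^bsub>G\<^esub> g) = (x, y, z)"
      using a b g xyz by (simp add: hX.H.m_assoc hY.H.m_assoc)
    moreover have "a \<otimes>\<^bsub>G\<^esub> b \<otimes>\<^bsub>G\<^esub> g \<in> carrier G" using a(1) b(1) g(2) by simp
    ultimately show ?thesis by (rule image_eqI[OF HOL.sym])
  qed
  then have "carrier (X \<times>\<times> (Y \<times>\<times> Z)) \<subseteq> ?h ` carrier G"
    unfolding carrier_DirProd by (simp only: subset_iff split_paired_All mem_Times_iff fst_conv snd_conv) blast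
  moreover have "?h ` carrier G \<subseteq> carrier (X \<times>\<times> (Y \<times>\<times> Z))" by (simp add: image_subset_iff)
  ultimately show ?thesis using hom unfolding epi_def by blast
qed

text \<open>Let \<open>W\<close> be the wreath product.  The components come from lifts \<open>u\<close> of \<open>W \<rightarrow> A\<close>, \<open>W \<rightarrow> B\<close> and of the identity
  of \<open>W\<close> to \<open>FA\<close>, \<open>FB\<close> and \<open>K\<close>; the sections of the first two come from lifts \<open>v\<close> of \<open>A \<rightarrow> W\<close> and \<open>B \<rightarrow> W\<close>.
  On the Baer invariants only the composites of the covered maps count.  In particular, seen
  in \<open>K\<close>, the two sections take values represented by elements of \<open>F\<close> and by \<open>1\<close>, respectively, and these
  go to \<open>1\<close> in \<open>E\<^sub>c/D\<^sub>c\<close>.\<close>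

lemma baer_wreath_epimorphism:
  assumes c: "c \<ge> 1" and A: "group A" and B: "group B"
    and "free_presentation F1 R1 A" and "free_presentation FA RA A"
    and "free_presentation FB RB B" and "free_presentation FW RW (free_wreath A B)"
  shows "\<exists>h. h \<in> epi (nilpotent_baer c FW RW)
                 (nilpotent_baer c FA RA \<times>\<times> nilpotent_baer c FB RB \<times>\<times> E_mod_D c F1 R1 B)"
proof -
  let ?BW = "nilpotent_baer c FW RW" and ?BA = "nilpotent_baer c FA RA" and ?BB = "nilpotent_baer c FB RB"
    and ?ED = "E_mod_D c F1 R1 B"
  let ?W = "free_wreath A B"
  have W: "group ?W" by (rule group_free_wreath[OF A B])
  have free: "is_free FA" "is_free FB" "is_free FW"
    using assms(5-7) by (simp_all add: free_presentation_def)
  obtain p1 pA pB pW where p1: "projection_with_kernel F1 A p1 R1"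
    and pA: "projection_with_kernel FA A pA RA" and pB: "projection_with_kernel FB B pB RB"
    and pW: "projection_with_kernel FW ?W pW RW"
    using free_presentation_projection[OF assms(4) A] free_presentation_projection[OF assms(5) A]
      free_presentation_projection[OF assms(6) B] free_presentation_projection[OF assms(7) W] by blast
  interpret p1: group_hom F1 A p1 by (rule projection_hom[OF p1])
  interpret pA: group_hom FA A pA by (rule projection_hom[OF pA])
  interpret pB: group_hom FB B pB by (rule projection_hom[OF pB])
  interpret pW: group_hom FW ?W pW by (rule projection_hom[OF pW])
  interpret relative_product F1 B R1
    by (intro relative_product.intro p1.G.is_group B projection_kernel_normal[OF p1])
  let ?BK = "nilpotent_baer c K T"
  note nA = projection_kernel_normal[OF pA] and nB = projection_kernel_normal[OF pB]
    and nW = projection_kernel_normal[OF pW]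
  obtain \<kappa> where \<kappa>: "projection_with_kernel K ?W \<kappa> T"
    "\<And>x. x \<in> carrier F1 \<Longrightarrow> \<kappa> (i1 x) = wreath_inl A B (p1 x)"
    "\<And>y. y \<in> carrier B \<Longrightarrow> \<kappa> (i2 y) = wreath_inr A B y"
    using wreath_projection[OF A p1] by blast
  let ?wA = "wreath_inl A B" and ?wB = "wreath_inr A B"
  have wA: "group_hom A ?W ?wA" by (rule group_homI[OF A W wreath_inl_hom[OF A B]])
  have wB: "group_hom B ?W ?wB" by (rule group_homI[OF B W wreath_inr_hom[OF A B]])
  interpret wA: group_hom A ?W ?wA by (rule wA)
  interpret wB: group_hom B ?W ?wB by (rule wB)
  have idA: "group_hom A A (\<lambda>x. x)" and idB: "group_hom B B (\<lambda>x. x)" and idW: "group_hom ?W ?W (\<lambda>x. x)"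
    by (intro group_homI homI A B W; simp)+
  obtain rA where rA: "group_hom ?W A rA" "\<And>x. x \<in> carrier A \<Longrightarrow> rA (?wA x) = x"
    "\<And>y. y \<in> carrier B \<Longrightarrow> rA (?wB y) = \<one>\<^bsub>A\<^esub>"
    using free_wreath_lift[OF A B idA trivial_hom[OF B A]] by blast
  obtain rB where rB: "group_hom ?W B rB" "\<And>x. x \<in> carrier A \<Longrightarrow> rB (?wA x) = \<one>\<^bsub>B\<^esub>"
    "\<And>y. y \<in> carrier B \<Longrightarrow> rB (?wB y) = y"
    using free_wreath_lift[OF A B trivial_hom[OF A B] idB] by blast
  obtain uA where uA: "group_hom FW FA uA" "\<And>x. x \<in> carrier FW \<Longrightarrow> pA (uA x) = rA (pW x)" "uA ` RW \<subseteq> RA"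
    using presentation_lift[OF free(3) pW pA rA(1)] by blast
  obtain uB where uB: "group_hom FW FB uB" "\<And>x. x \<in> carrier FW \<Longrightarrow> pB (uB x) = rB (pW x)" "uB ` RW \<subseteq> RB"
    using presentation_lift[OF free(3) pW pB rB(1)] by blast
  obtain uK where uK: "group_hom FW K uK" "\<And>x. x \<in> carrier FW \<Longrightarrow> \<kappa> (uK x) = pW x" "uK ` RW \<subseteq> T"
    using presentation_lift[OF free(3) pW \<kappa>(1) idW] by blast
  obtain vA where vA: "group_hom FA FW vA" "\<And>x. x \<in> carrier FA \<Longrightarrow> pW (vA x) = ?wA (pA x)" "vA ` RA \<subseteq> RW"
    using presentation_lift[OF free(1) pA pW wA] by blast
  obtain vB where vB: "group_hom FB FW vB" "\<And>x. x \<in> carrier FB \<Longrightarrow> pW (vB x) = ?wB (pB x)" "vB ` RB \<subseteq> RW"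
    using presentation_lift[OF free(2) pB pW wB] by blast
  obtain s where s: "group_hom FA F1 s" "\<And>x. x \<in> carrier FA \<Longrightarrow> p1 (s x) = pA x" "s ` RA \<subseteq> R1"
    using presentation_lift[OF free(1) pA p1 idA] by blast
  interpret uA: group_hom FW FA uA by (rule uA(1))
  interpret uB: group_hom FW FB uB by (rule uB(1))
  interpret uK: group_hom FW K uK by (rule uK(1))
  interpret vA: group_hom FA FW vA by (rule vA(1))
  interpret vB: group_hom FB FW vB by (rule vB(1))
  interpret s: group_hom FA F1 s by (rule s(1))
  define LW where "LW = rel_lcs FW RW c"
  define LA where "LA = rel_lcs FA RA c"
  define LB where "LB = rel_lcs FB RB c"
  define LK where "LK = rel_lcs K T c"
  define MW where "MW = RW \<inter> rel_lcs FW (carrier FW) c"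
  define MA where "MA = RA \<inter> rel_lcs FA (carrier FA) c"
  define MB where "MB = RB \<inter> rel_lcs FB (carrier FB) c"
  define MK where "MK = T \<inter> rel_lcs K (carrier K) c"
  note defs = LW_def LA_def LB_def LK_def MW_def MA_def MB_def MK_def
  have "\<exists>h\<in>hom ?BW ?BA. \<forall>x\<in>MW. h (LW #>\<^bsub>FW\<^esub> x) = LA #>\<^bsub>FA\<^esub> uA x"
    unfolding defs by (rule uA.baer_map[OF nW nA uA(3)])
  then obtain hA where hA: "hA \<in> hom ?BW ?BA"
    "\<forall>x\<in>MW. hA (LW #>\<^bsub>FW\<^esub> x) = LA #>\<^bsub>FA\<^esub> uA x" by (rule bexE)
  have "\<exists>h\<in>hom ?BW ?BB. \<forall>x\<in>MW. h (LW #>\<^bsub>FW\<^esub> x) = LB #>\<^bsub>FB\<^esub> uB x"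
    unfolding defs by (rule uB.baer_map[OF nW nB uB(3)])
  then obtain hB where hB: "hB \<in> hom ?BW ?BB"
    "\<forall>x\<in>MW. hB (LW #>\<^bsub>FW\<^esub> x) = LB #>\<^bsub>FB\<^esub> uB x" by (rule bexE)
  have "\<exists>h\<in>hom ?BW ?BK. \<forall>x\<in>MW. h (LW #>\<^bsub>FW\<^esub> x) = LK #>\<^bsub>K\<^esub> uK x"
    unfolding defs by (rule uK.baer_map[OF nW T_normal uK(3)])
  then obtain hK where hK: "hK \<in> hom ?BW ?BK"
    "\<forall>x\<in>MW. hK (LW #>\<^bsub>FW\<^esub> x) = LK #>\<^bsub>K\<^esub> uK x" by (rule bexE)
  have "\<exists>\<epsilon>\<in>epi ?BK ?ED. \<forall>x\<in>MK \<inter> F'. \<epsilon> (LK #>\<^bsub>K\<^esub> x) = \<one>\<^bsub>?ED\<^esub>"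
    unfolding defs by (rule baer_to_E_mod_D[OF c])
  then obtain \<epsilon> where \<epsilon>: "\<epsilon> \<in> epi ?BK ?ED"
    "\<forall>x\<in>MK \<inter> F'. \<epsilon> (LK #>\<^bsub>K\<^esub> x) = \<one>\<^bsub>?ED\<^esub>" by (rule bexE)
  have groups: "group ?BW" "group ?BA"
    "group ?BB" "group ?BK" "group ?ED"
    by (rule pW.G.group_baer[OF nW] pA.G.group_baer[OF nA] pB.G.group_baer[OF nB]
        K.group_baer[OF T_normal] group_E_mod_D[OF c])+
  have ones: "\<one>\<^bsub>?BA\<^esub> = LA" "\<one>\<^bsub>?BB\<^esub> = LB"
    unfolding defs pA.G.nilpotent_baer_eq[OF nA] pB.G.nilpotent_baer_eq[OF nB] by (rule one_FactGroup)+
  have coset_one: "LA #>\<^bsub>FA\<^esub> \<one>\<^bsub>FA\<^esub> = LA" "LB #>\<^bsub>FB\<^esub> \<one>\<^bsub>FB\<^esub> = LB"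
    unfolding defs
    using pA.G.coset_mult_one[OF subgroup.subset[OF normal_imp_subgroup[OF pA.G.rel_lcs_normal[OF nA]]]]
      pB.G.coset_mult_one[OF subgroup.subset[OF normal_imp_subgroup[OF pB.G.rel_lcs_normal[OF nB]]]] by simp_all
  have carriers: "carrier ?BW = (\<lambda>x. LW #>\<^bsub>FW\<^esub> x) ` MW"
    "carrier ?BA = (\<lambda>x. LA #>\<^bsub>FA\<^esub> x) ` MA"
    "carrier ?BB = (\<lambda>x. LB #>\<^bsub>FB\<^esub> x) ` MB"
    "carrier ?BK = (\<lambda>x. LK #>\<^bsub>K\<^esub> x) ` MK"
    unfolding defs by (rule pW.G.carrier_baer[OF nW] pA.G.carrier_baer[OF nA]
        pB.G.carrier_baer[OF nB] K.carrier_baer[OF T_normal])+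
  have vA_MW: "vA x \<in> MW" if "x \<in> MA" for x
  proof -
    have "vA ` carrier FA \<subseteq> carrier FW" by auto
    from vA.hom_rel_lcs[OF subset_refl this subset_refl] show ?thesis using that vA(3) unfolding defs by blast
  qed
  have vB_MW: "vB x \<in> MW" if "x \<in> MB" for x
  proof -
    have "vB ` carrier FB \<subseteq> carrier FW" by auto
    from vB.hom_rel_lcs[OF subset_refl this subset_refl] show ?thesis using that vB(3) unfolding defs by blast
  qed
  have MA: "x \<in> carrier FA \<and> x \<in> RA \<and> x \<in> rel_lcs FA (carrier FA) c" if "x \<in> MA" for x
    using that projection_kernel_mem(1)[OF pA, of x] by (simp add: MA_def)
  have MB: "x \<in> carrier FB \<and> x \<in> RB \<and> x \<in> rel_lcs FB (carrier FB) c" if "x \<in> MB" for x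
    using that projection_kernel_mem(1)[OF pB, of x] by (simp add: MB_def)
  have idFA: "group_hom FA FA (\<lambda>x. x)" and idFB: "group_hom FB FB (\<lambda>x. x)"
    by (intro group_homI homI pA.G.is_group pB.G.is_group; simp)+
  \<comment> \<open>Each composite below covers a composite of \<open>A, B \<rightarrow> W\<close> with \<open>W \<rightarrow> A, B, W\<close>, hence agrees modulo the
     kernel, and so on the Baer invariants, with the obvious lift of that composite.\<close>
  have uA_vA: "LA #>\<^bsub>FA\<^esub> uA (vA x) = LA #>\<^bsub>FA\<^esub> x" if x: "x \<in> MA" for x
    unfolding LA_def using MA[OF x]
    by (intro lift_cong[OF pA group_hom_compose[OF vA(1) uA(1)] idFA]) (simp_all add: uA(2) vA(2) rA(2))
  have uB_vB: "LB #>\<^bsub>FB\<^esub> uB (vB x) = LB #>\<^bsub>FB\<^esub> x" if x: "x \<in> MB" for x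
    unfolding LB_def using MB[OF x]
    by (intro lift_cong[OF pB group_hom_compose[OF vB(1) uB(1)] idFB]) (simp_all add: uB(2) vB(2) rB(3))
  have uB_vA: "LB #>\<^bsub>FB\<^esub> uB (vA x) = LB #>\<^bsub>FB\<^esub> \<one>\<^bsub>FB\<^esub>" if x: "x \<in> MA" for x
    unfolding LB_def using MA[OF x]
    by (intro lift_cong[OF pB group_hom_compose[OF vA(1) uB(1)] trivial_hom[OF pA.G.is_group pB.G.is_group]])
       (simp_all add: uB(2) vA(2) rB(2))
  have uA_vB: "LA #>\<^bsub>FA\<^esub> uA (vB x) = LA #>\<^bsub>FA\<^esub> \<one>\<^bsub>FA\<^esub>" if x: "x \<in> MB" for x
    unfolding LA_def using MB[OF x]
    by (intro lift_cong[OF pA group_hom_compose[OF vB(1) uA(1)] trivial_hom[OF pB.G.is_group pA.G.is_group]])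
       (simp_all add: uA(2) vB(2) rA(3))
  have uK_vA: "LK #>\<^bsub>K\<^esub> uK (vA x) = LK #>\<^bsub>K\<^esub> i1 (s x)" if x: "x \<in> MA" for x
    unfolding LK_def using MA[OF x]
    by (intro lift_cong[OF \<kappa>(1) group_hom_compose[OF vA(1) uK(1)] group_hom_compose[OF s(1) i1.group_hom_axioms]])
       (simp_all add: uK(2) vA(2) \<kappa>(2) s(2))
  have uK_vB: "LK #>\<^bsub>K\<^esub> uK (vB x) = LK #>\<^bsub>K\<^esub> \<one>\<^bsub>K\<^esub>" if x: "x \<in> MB" for x
  proof -
    have "LK #>\<^bsub>K\<^esub> uK (vB x) = LK #>\<^bsub>K\<^esub> i2 (pB x)"
      unfolding LK_def using MB[OF x]
      by (intro lift_cong[OF \<kappa>(1) group_hom_compose[OF vB(1) uK(1)] group_hom_compose[OF projection_hom[OF pB] i2.group_hom_axioms]])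
         (simp_all add: uK(2) vB(2) \<kappa>(3))
    moreover have "pB x = \<one>\<^bsub>B\<^esub>" using MB[OF x] projection_kernel_mem(2)[OF pB, of x] by simp
    ultimately show ?thesis by simp
  qed
  \<comment> \<open>As \<open>u(FW)\<close> and \<open>T\<close> generate \<open>K\<close>, elements of \<open>\<gamma>\<^bsub>c+1\<^esub>(K)\<close> lift to \<open>\<gamma>\<^bsub>c+1\<^esub>(FW)\<close> modulo \<open>[T, \<^sub>c K]\<close>.\<close>
  have hK_surj: "hK ` carrier ?BW = carrier ?BK"
  proof
    show "hK ` carrier ?BW \<subseteq> carrier ?BK"
      using hK(1) by (auto simp: hom_def)
    show "carrier ?BK \<subseteq> hK ` carrier ?BW"
    proof
      fix Y assume "Y \<in> carrier ?BK"
      then obtain y where y: "Y = LK #>\<^bsub>K\<^esub> y" "y \<in> MK" unfolding carriers by blast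
      have yT: "y \<in> T" and y\<gamma>: "y \<in> rel_lcs K (carrier K) c" using y(2) unfolding defs by blast+
      have yc: "y \<in> carrier K" by (rule T_subset[OF yT])
      have "\<exists>x\<in>carrier FW. T #>\<^bsub>K\<^esub> k = T #>\<^bsub>K\<^esub> uK x" if k: "k \<in> carrier K" for k
      proof -
        have "\<kappa> k \<in> pW ` carrier FW"
          using group_hom.hom_closed[OF projection_hom[OF \<kappa>(1)] k] projection_surj[OF pW] by simp
        then obtain x where x: "x \<in> carrier FW" "\<kappa> k = pW x" by blast
        then have "T #>\<^bsub>K\<^esub> k = T #>\<^bsub>K\<^esub> uK x"
          using k by (intro projection_rcoset_eq[OF \<kappa>(1)]) (simp_all add: uK(2))
        then show ?thesis using x(1) by blast
      qed
      from uK.lower_central_lift[OF T_normal this y\<gamma>]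
      obtain x where x: "x \<in> rel_lcs FW (carrier FW) c" "LK #>\<^bsub>K\<^esub> y = LK #>\<^bsub>K\<^esub> uK x"
        unfolding LK_def by blast
      have xc: "x \<in> carrier FW" using x(1) pW.G.rel_lcs_mem[OF pW.G.normal_self] by blast
      have "y \<otimes>\<^bsub>K\<^esub> inv\<^bsub>K\<^esub> uK x \<in> LK"
        using K.rcoset_eq_iff[OF K.rel_lcs_normal[OF T_normal] yc uK.hom_closed[OF xc]] x(2) unfolding LK_def by blast
      then have "y \<otimes>\<^bsub>K\<^esub> inv\<^bsub>K\<^esub> uK x \<in> T" using K.rel_lcs_subset[OF T_normal] unfolding LK_def by blast
      then have "T #>\<^bsub>K\<^esub> y = T #>\<^bsub>K\<^esub> uK x"
        using K.rcoset_eq_iff[OF T_normal yc uK.hom_closed[OF xc]] by blast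
      moreover have "T #>\<^bsub>K\<^esub> y = T" using K.rcoset_eq_self_iff[OF T_normal yc] yT by blast
      ultimately have "uK x \<in> T" using K.rcoset_eq_self_iff[OF T_normal uK.hom_closed[OF xc]] by simp
      then have "pW x = \<one>\<^bsub>?W\<^esub>" using projection_kernel_mem(2)[OF \<kappa>(1)] uK(2)[OF xc] by metis
      then have "x \<in> MW" using projection_kernel_iff[OF pW xc] x(1) unfolding defs by blast
      then have "LW #>\<^bsub>FW\<^esub> x \<in> carrier ?BW" "hK (LW #>\<^bsub>FW\<^esub> x) = Y"
        using hK(2) x(2) y(1) unfolding carriers by auto
      then show "Y \<in> hK ` carrier ?BW" by blast
    qed
  qed
  have "(\<lambda>z. \<epsilon> (hK z)) \<in> hom ?BW ?ED"
    using Group.hom_compose[OF hK(1), of \<epsilon> "?ED"] \<epsilon>(1) by (simp add: comp_def epi_def)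
  moreover have "(\<lambda>z. \<epsilon> (hK z)) ` carrier ?BW = carrier ?ED"
    using \<epsilon>(1) hK_surj by (simp add: epi_def flip: image_image)
  ultimately have hE: "(\<lambda>z. \<epsilon> (hK z)) \<in> epi ?BW ?ED"
    by (simp add: epi_def)
  have "(\<lambda>z. (hA z, (hB z, \<epsilon> (hK z)))) \<in> epi ?BW
      (?BA \<times>\<times> ?BB \<times>\<times> ?ED)"
  proof (rule epi_DirProd3_if_sections[OF groups(1,2,3,5) hA(1) hB(1) hE])
    fix X assume "X \<in> carrier ?BA"
    then obtain x where x: "X = LA #>\<^bsub>FA\<^esub> x" "x \<in> MA" unfolding carriers by blast
    note v = vA_MW[OF x(2)]
    have xc: "x \<in> carrier FA" "x \<in> RA" "x \<in> rel_lcs FA (carrier FA) c" using MA[OF x(2)] by simp_all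
    have "i1 (s x) \<in> MK"
    proof -
      have "s ` carrier FA \<subseteq> carrier F1" "i1 ` carrier F1 \<subseteq> carrier K" by auto
      then have "i1 (s x) \<in> rel_lcs K (carrier K) c"
        using xc(3) by (intro i1.hom_rel_lcs[of "carrier F1"] s.hom_rel_lcs[of "carrier FA"]) simp_all
      moreover have "i1 (s x) \<in> T" using s(3) xc(2) K.subset_normal_closure[of R'] by blast
      ultimately show ?thesis unfolding defs by blast
    qed
    moreover have "i1 (s x) \<in> F'" using s.hom_closed[OF xc(1)] by blast
    ultimately have "\<epsilon> (hK (LW #>\<^bsub>FW\<^esub> vA x)) = \<one>\<^bsub>?ED\<^esub>"
      using bspec[OF hK(2) v] uK_vA[OF x(2)] bspec[OF \<epsilon>(2) IntI] by simp
    moreover have "hA (LW #>\<^bsub>FW\<^esub> vA x) = X" "hB (LW #>\<^bsub>FW\<^esub> vA x) = \<one>\<^bsub>?BB\<^esub>"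
      using bspec[OF hA(2) v] bspec[OF hB(2) v] uA_vA[OF x(2)] uB_vA[OF x(2)] x(1) ones coset_one by simp_all
    moreover have "LW #>\<^bsub>FW\<^esub> vA x \<in> carrier ?BW" unfolding carriers using v by blast
    ultimately show "\<exists>g\<in>carrier ?BW. hA g = X \<and> hB g = \<one>\<^bsub>?BB\<^esub>
        \<and> \<epsilon> (hK g) = \<one>\<^bsub>?ED\<^esub>" by blast
  next
    fix X assume "X \<in> carrier ?BB"
    then obtain x where x: "X = LB #>\<^bsub>FB\<^esub> x" "x \<in> MB" unfolding carriers by blast
    note v = vB_MW[OF x(2)]
    have "\<one>\<^bsub>K\<^esub> \<in> MK"
      unfolding MK_def by (rule subgroup.one_closed[OF K.baer_numerator[OF T_normal]])
    moreover have "\<one>\<^bsub>K\<^esub> \<in> F'" by (rule subgroup.one_closed[OF F'_subgroup])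
    ultimately have "\<epsilon> (hK (LW #>\<^bsub>FW\<^esub> vB x)) = \<one>\<^bsub>?ED\<^esub>"
      using bspec[OF hK(2) v] uK_vB[OF x(2)] bspec[OF \<epsilon>(2) IntI] by simp
    moreover have "hA (LW #>\<^bsub>FW\<^esub> vB x) = \<one>\<^bsub>?BA\<^esub>" "hB (LW #>\<^bsub>FW\<^esub> vB x) = X"
      using bspec[OF hA(2) v] bspec[OF hB(2) v] uA_vB[OF x(2)] uB_vB[OF x(2)] x(1) ones coset_one by simp_all
    moreover have "LW #>\<^bsub>FW\<^esub> vB x \<in> carrier ?BW" unfolding carriers using v by blast
    ultimately show "\<exists>g\<in>carrier ?BW. hA g = \<one>\<^bsub>?BA\<^esub> \<and> hB g = X
        \<and> \<epsilon> (hK g) = \<one>\<^bsub>?ED\<^esub>" by blast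
  qed
  then show ?thesis by blast
qed

theorem theorem5p3:
  fixes c :: nat
    and A :: "('a, 'ma) monoid_scheme" and B :: "('b, 'mb) monoid_scheme"
    and F1 :: "('f1, 'm1) monoid_scheme" and R1 :: "'f1 set"
    and FA :: "('fa, 'm2) monoid_scheme" and RA :: "'fa set"
    and FB :: "('fb, 'm3) monoid_scheme" and RB :: "'fb set"
    and FW :: "('fw, 'm4) monoid_scheme" and RW :: "'fw set"
  assumes "c \<ge> 1"
    and "group A" and "group B"
    and "free_presentation F1 R1 A"
    and "free_presentation FA RA A"
    and "free_presentation FB RB B"
    and "free_presentation FW RW (free_wreath A B)"
  shows "(\<exists>h. h \<in> epi (nilpotent_baer c FW RW)
                 (nilpotent_baer c FA RA \<times>\<times> nilpotent_baer c FB RB \<times>\<times> E_mod_D c F1 R1 B))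
       \<and> (finite (carrier (nilpotent_baer c FW RW)) \<longrightarrow>
           (\<exists>H. subgroup H (nilpotent_baer c FW RW) \<and>
                nilpotent_baer c FA RA \<times>\<times> nilpotent_baer c FB RB \<times>\<times> E_mod_D c F1 R1 B
                  \<cong> (nilpotent_baer c FW RW)\<lparr>carrier := H\<rparr>))"
proof -
  let ?target = "nilpotent_baer c FA RA \<times>\<times> nilpotent_baer c FB RB \<times>\<times> E_mod_D c F1 R1 B"
  obtain h where h: "h \<in> epi (nilpotent_baer c FW RW) ?target"
    using baer_wreath_epimorphism[OF assms] by blast
  have normal: "R1 \<lhd> F1" "RA \<lhd> FA" "RB \<lhd> FB" "RW \<lhd> FW"
    using assms(4-7) by (simp_all add: free_presentation_def)
  have presented: "group F1" "group FA" "group FB" "group FW"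
    using normal by (simp_all add: normal_def)
  have "relative_product F1 B R1"
    using presented(1) assms(3) normal(1) by (simp add: relative_product_def)
  then have target: "group ?target"
    by (intro DirProd_group group.group_baer relative_product.group_E_mod_D assms(1) presented normal)
  have "comm_group (nilpotent_baer c FW RW)" by (rule group.comm_group_baer[OF presented(4) normal(4)])
  then show ?thesis using h comm_group.quotient_iso_subgroup[OF _ _ target h] by blast
qed

end
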